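(* Let $d>0$, and suppose that $\phi,\psi$ satisfy (C1) or (C2) on $\Delta$. Then, for each choice of sign, the differential equation $$\frac{d^2W(u,\xi)}{d\xi^2}=\left(u^2+u\phi(\xi)+\psi(\xi)\right)W(u,\xi)$$ has solutions of the form $$W^{\pm}(u,\xi)=\exp\!\left(\pm u\xi\pm\frac12\int_{\alpha^{\pm}}^{\xi}\phi(t)\,dt\right)\left(1+\eta^{\pm}(u,\xi)\right),$$ where $\eta^{\pm}(u,\xi)$ are analytic functions in $\{u:\Re u>0\}\times\Gamma^{\pm}(d)$, satisfy $$\lim_{\Re\xi\to\mp\infty}\eta^{\pm}(u,\xi)=0 \qquad(\xi\in\Gamma^{\pm}(d)),$$ and can be represented in the form $$\eta^{\pm}(u,\xi)=\int_0^{+\infty}e^{-ut}F^{\pm}(t,\xi)\,dt .$$ Here the functions $F^{\pm}(t,\xi)$ (the Borel transforms) are analytic in $U(2d)\times\Gamma^{\pm}(d)$, with convergent power series expansions $$F^{\pm}(t,\xi)=\sum_{n=0}^{\infty}\frac{\mathsf{A}^{\pm}_{n+1}(\xi)}{n!}t^n$$ valid when $(t,\xi)\in B(2d)\times\Gamma^{\pm}(d)$. In addition, for each $\sigma>0$ and $0<r<d$, there exist positive numbers $K^{\pm}=K^{\pm}(\sigma,r)$, independent of $t$ and $\xi$, such that $$\left|F^{\pm}(t,\xi)\right|\le K^{\pm}\frac{e^{\sigma\Re t}}{\max\left(1,\mp\operatorname{sgn}(\Re\xi)|\Re\xi|^{\rho}\right)}$$ when $(t,\xi)\in U(2r)\times\Gamma^{\pm}(d)$.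 Finally, for each $\sigma>0$, $$\eta^{\pm}(u,\xi)\sim\sum_{n=1}^{\infty}\frac{\mathsf{A}^{\pm}_n(\xi)}{u^n}$$ as $|u|\to+\infty$ in the open half-plane $\Re u>\sigma$, uniformly with respect to $\xi\in\Gamma^{\pm}(d)$. In particular, these asymptotic expansions hold in any closed subsector of $|\arg u|<\frac{\pi}{2}$.
   Context: Setting. $u$ is a complex parameter. $\mathbf{G}$ is a domain in the complex $\xi$-plane (or, more generally, a domain of a Riemann surface spread over the $\xi$-plane, in which case $|\xi|,\Re\xi,\Im\xi$ refer to the projection of $\xi$), and $\phi,\psi$ are holomorphic in $\mathbf{G}$ and independent of $u$. $\Delta\subset\mathbf{G}$ is a domain. Upper signs go with upper signs and lower with lower throughout. Condition (C1): there are positive constants $c,\rho$, independent of $u$ and $\xi$, such that for all $\xi\in\Delta$, $|\phi(\xi)|\le\frac{c}{1+|\xi|^{1+\rho}}$ and $|\psi(\xi)|\le\frac{c}{1+|\xi|^{1+\rho}}$. Condition (C2): there are positive constants $c,\rho$, independent of $u$ and $\xi$, such that for all $\xi\in\Delta$, $|\phi(\xi)|\le\frac{c}{1+|\xi|^{1/2+\rho}}$, $|\phi'(\xi)|\le\frac{c}{1+|\xi|^{1+\rho}}$ and $|\psi(\xi)|\le\frac{c}{1+|\xi|^{1+\rho}}$. The number $\rho$ in the claim is the one from whichever condition is assumed. Domains $\Gamma^{\pm}(d)$. For $d>0$, $\Gamma^{\pm}(d)$ denote any non-empty subdomains of $\Delta$ such that (i) the distance between each point of $\Gamma^{\pm}(d)$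 and each boundary point of $\Delta$ is at least $d$ (i.e. the open disc of radius $d$ about each point of $\Gamma^{\pm}(d)$ lies in $\Delta$); (ii) if $\xi\in\Gamma^{\pm}(d)$ then $\xi\mp x\in\Gamma^{\pm}(d)$ for all $x>0$. It is assumed that $d$ is such that these domains are non-empty. Paths. For $\xi\in\Gamma^{+}(d)$, $\mathscr{P}(-\infty,\xi)$ is the horizontal half-line running from $-\infty+i\Im\xi$ to $\xi$; for $\xi\in\Gamma^{-}(d)$, $\mathscr{P}(+\infty,\xi)$ is the horizontal half-line running from $+\infty+i\Im\xi$ to $\xi$. Base points. $\alpha^{\pm}\in\mathbf{G}$ are fixed; the contours of integration in $\int_{\alpha^{\pm}}^{\xi}\phi(t)\,dt$ lie in $\mathbf{G}$ and may be infinite provided the integrals converge. Coefficients. $\mathsf{A}_0^{\pm}(\xi)=1$ and, for $n\ge0$ and $\xi\in\Gamma^{\pm}(d)$, $$\mathsf{A}_{n+1}^{\pm}(\xi)=-\frac12\phi(\xi)\mathsf{A}_n^{\pm}(\xi)\mp\frac12\frac{d\mathsf{A}_n^{\pm}(\xi)}{d\xi}\mp\frac12\int_{\mathscr{P}(\mp\infty,\xi)}\left(\frac14\phi^2(t)\mp\frac12\phi'(t)-\psi(t)\right)\mathsf{A}_n^{\pm}(t)\,dt .$$ Regions. For $r>0$, $B(r)=\{t\in\mathbb{C}:|t|<r\}$ and $U(r)=\{t\in\mathbb{C}:\Re t>0,\ |\Im t|<r\}\cup B(r)$. Uniform asymptotic expansion means: for every $N\ge1$, $\eta^{\pm}(u,\xi)-\sum_{n=1}^{N-1}\mathsf{A}_n^{\pm}(\xi)u^{-n}=O(|u|^{-N})$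 as $|u|\to+\infty$ in the indicated $u$-region, with implied constant independent of $\xi\in\Gamma^{\pm}(d)$. *)

theory Defs
  imports "HOL-Analysis.Analysis"
begin

section \<open>Domains spread over the complex plane\<close>

text \<open>
  A domain \<open>G\<close> of a Riemann surface spread over the \<open>\<xi>\<close>-plane is a non-empty connected open set of
  a Hausdorff space with a projection \<open>p\<close> that is a local homeomorphism into the complex numbers, so
  that \<open>p\<close> is a local coordinate (no branch points inside \<open>G\<close>). Plane domains are the case where
  \<open>p\<close> is the identity.
\<close>

definition domain_in :: "'a::topological_space set \<Rightarrow> 'a set \<Rightarrow> bool" where
  "domain_in S D \<longleftrightarrow> open D \<and> connected D \<and> D \<noteq> {} \<and> D \<subseteq> S"

definition spread_domain :: "('a::t2_space \<Rightarrow> complex) \<Rightarrow> 'a set \<Rightarrow> bool" where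
  "spread_domain p G \<longleftrightarrow> domain_in UNIV G \<and>
     (\<forall>\<xi>\<in>G. \<exists>V g. open V \<and> \<xi> \<in> V \<and> V \<subseteq> G \<and> open (p ` V) \<and> homeomorphism V (p ` V) p g)"

text \<open>
  Differentiation with respect to the coordinate \<open>p\<close>. Functions on the surface are total in HOL; only
  their values near the point in question matter.
\<close>

definition has_spread_deriv ::
    "('a::t2_space \<Rightarrow> complex) \<Rightarrow> ('a \<Rightarrow> complex) \<Rightarrow> complex \<Rightarrow> 'a \<Rightarrow> bool" where
  "has_spread_deriv p f D \<xi> \<longleftrightarrow> ((\<lambda>\<zeta>. (f \<zeta> - f \<xi>) / (p \<zeta> - p \<xi>)) \<longlongrightarrow> D) (at \<xi>)"

definition spread_deriv :: "('a::t2_space \<Rightarrow> complex) \<Rightarrow> ('a \<Rightarrow> complex) \<Rightarrow> 'a \<Rightarrow> complex" where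
  "spread_deriv p f \<xi> = (SOME D. has_spread_deriv p f D \<xi>)"

definition spread_holomorphic :: "('a::t2_space \<Rightarrow> complex) \<Rightarrow> ('a \<Rightarrow> complex) \<Rightarrow> 'a set \<Rightarrow> bool" where
  "spread_holomorphic p f S \<longleftrightarrow> (\<forall>\<xi>\<in>S. \<exists>D. has_spread_deriv p f D \<xi>)"

text \<open>
  Joint analyticity of \<open>f t \<xi>\<close> on an open set \<open>T \<times> S\<close>: complex differentiability as a function of two
  complex variables (the Frechet derivative is the complex-linear map with coefficients \<open>a, b\<close>).
\<close>

definition jointly_analytic ::
    "('a::t2_space \<Rightarrow> complex) \<Rightarrow> (complex \<Rightarrow> 'a \<Rightarrow> complex) \<Rightarrow> complex set \<Rightarrow> 'a set \<Rightarrow> bool" where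
  "jointly_analytic p f T S \<longleftrightarrow> (\<forall>t\<^sub>0\<in>T. \<forall>\<xi>\<^sub>0\<in>S. \<exists>a b.
     ((\<lambda>(t, \<xi>). (f t \<xi> - f t\<^sub>0 \<xi>\<^sub>0 - (a * (t - t\<^sub>0) + b * (p \<xi> - p \<xi>\<^sub>0)))
         / complex_of_real (norm (t - t\<^sub>0, p \<xi> - p \<xi>\<^sub>0))) \<longlongrightarrow> 0) (at (t\<^sub>0, \<xi>\<^sub>0)))"

lemma has_spread_deriv_plane:
  "has_spread_deriv (\<lambda>z. z) f D \<xi> \<longleftrightarrow> (f has_field_derivative D) (at \<xi>)"
  by (simp add: has_spread_deriv_def has_field_derivative_iff)

lemma spread_deriv_plane: "spread_deriv (\<lambda>z. z) f = deriv f"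
  by (simp add: spread_deriv_def deriv_def has_spread_deriv_plane fun_eq_iff)

lemma spread_holomorphic_plane:
  assumes "open S"
  shows "spread_holomorphic (\<lambda>z. z) f S \<longleftrightarrow> f holomorphic_on S"
  unfolding spread_holomorphic_def has_spread_deriv_plane holomorphic_on_def field_differentiable_def
  by (intro ball_cong refl) (simp only: at_within_open[OF _ assms])

lemma jointly_analytic_plane:
  "jointly_analytic (\<lambda>z. z) f T S \<longleftrightarrow> (\<forall>t\<^sub>0\<in>T. \<forall>\<xi>\<^sub>0\<in>S. \<exists>a b.
     ((\<lambda>(t, \<xi>). f t \<xi>) has_derivative (\<lambda>(h, k). a * h + b * k)) (at (t\<^sub>0, \<xi>\<^sub>0)))"
proof -
  have bl: "bounded_linear (\<lambda>(h, k). a * h + b * k)" for a b :: complex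
    unfolding split_beta'
    using bounded_linear_add[OF bounded_linear_const_mult[OF bounded_linear_fst]
        bounded_linear_const_mult[OF bounded_linear_snd]] .
  show ?thesis
    unfolding jointly_analytic_def has_derivative_at_within
    by (simp add: bl[unfolded split_beta'] split_beta' scaleR_conv_of_real divide_inverse mult.commute minus_prod_def)
qed


section \<open>Conditions on the potential\<close>

definition C1 :: "('a::t2_space \<Rightarrow> complex) \<Rightarrow> ('a \<Rightarrow> complex) \<Rightarrow> ('a \<Rightarrow> complex) \<Rightarrow> 'a set
    \<Rightarrow> real \<Rightarrow> real \<Rightarrow> bool" where
  "C1 p \<phi> \<psi> \<Delta> c \<rho> \<longleftrightarrow> c > 0 \<and> \<rho> > 0 \<and>
     (\<forall>\<xi>\<in>\<Delta>. norm (\<phi> \<xi>) \<le> c / (1 + norm (p \<xi>) powr (1 + \<rho>)) \<and>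
            norm (\<psi> \<xi>) \<le> c / (1 + norm (p \<xi>) powr (1 + \<rho>)))"

definition C2 :: "('a::t2_space \<Rightarrow> complex) \<Rightarrow> ('a \<Rightarrow> complex) \<Rightarrow> ('a \<Rightarrow> complex) \<Rightarrow> 'a set
    \<Rightarrow> real \<Rightarrow> real \<Rightarrow> bool" where
  "C2 p \<phi> \<psi> \<Delta> c \<rho> \<longleftrightarrow> c > 0 \<and> \<rho> > 0 \<and>
     (\<forall>\<xi>\<in>\<Delta>. norm (\<phi> \<xi>) \<le> c / (1 + norm (p \<xi>) powr (1/2 + \<rho>)) \<and>
            norm (spread_deriv p \<phi> \<xi>) \<le> c / (1 + norm (p \<xi>) powr (1 + \<rho>)) \<and>
            norm (\<psi> \<xi>) \<le> c / (1 + norm (p \<xi>) powr (1 + \<rho>)))"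


section \<open>The domains and the horizontal half-lines\<close>

text \<open>
  From here on \<open>s\<close> is the sign: \<open>s = 1\<close> selects the upper signs and \<open>s = -1\<close> the lower ones.
  The point written \<open>\<xi> \<mp> x\<close> is the endpoint of the lift, starting at \<open>\<xi>\<close>, of the horizontal segment
  from \<open>p \<xi>\<close> to \<open>p \<xi> \<mp> x\<close>.
\<close>

definition horizontal_lift ::
    "('a::t2_space \<Rightarrow> complex) \<Rightarrow> real \<Rightarrow> 'a set \<Rightarrow> 'a \<Rightarrow> (real \<Rightarrow> 'a) \<Rightarrow> bool" where
  "horizontal_lift p s S \<xi> \<gamma> \<longleftrightarrow> continuous_on {0..} \<gamma> \<and> \<gamma> ` {0..} \<subseteq> S \<and> \<gamma> 0 = \<xi> \<and>
     (\<forall>x\<ge>0. p (\<gamma> x) = p \<xi> - complex_of_real (s * x))"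

definition horizontal_ray ::
    "('a::t2_space \<Rightarrow> complex) \<Rightarrow> real \<Rightarrow> 'a set \<Rightarrow> 'a \<Rightarrow> real \<Rightarrow> 'a" where
  "horizontal_ray p s S \<xi> = (SOME \<gamma>. horizontal_lift p s S \<xi> \<gamma>)"

text \<open>By uniqueness of lifts, the choice above is determined on \<open>{0..}\<close>.\<close>

lemma horizontal_lift_unique:
  assumes G: "spread_domain p G" and "S \<subseteq> G"
    and 1: "horizontal_lift p s S \<xi> \<gamma>" and 2: "horizontal_lift p s S \<xi> \<delta>" and "x \<ge> 0"
  shows "\<gamma> x = \<delta> x"
proof -
  let ?T = "{x\<in>{0..}. \<gamma> x = \<delta> x}"
  let ?X = "top_of_set {0::real..}"
  have c: "continuous_on {0..} \<gamma>" "continuous_on {0..} \<delta>"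
    using 1 2 unfolding horizontal_lift_def by blast+
  have p: "p (\<gamma> x) = p \<xi> - complex_of_real (s * x)" "p (\<delta> x) = p \<xi> - complex_of_real (s * x)"
    if "x \<ge> 0" for x
    using 1 2 that unfolding horizontal_lift_def by blast+
  have z: "\<gamma> 0 = \<xi>" "\<delta> 0 = \<xi>"
    using 1 2 unfolding horizontal_lift_def by blast+
  have pre: "openin ?X ({0..} \<inter> \<gamma> -` V)" "openin ?X ({0..} \<inter> \<delta> -` V)" if "open V" for V
    using continuous_openin_preimage_gen[OF c(1) that] continuous_openin_preimage_gen[OF c(2) that]
    by auto
  have "openin ?X ?T"
  proof (subst openin_subopen, intro ballI)
    fix y assume "y \<in> ?T"
    then have y: "y \<in> {0..}" "\<gamma> y = \<delta> y" by auto
    have "\<gamma> ` {0..} \<subseteq> G" using 1 \<open>S \<subseteq> G\<close> by (meson horizontal_lift_def order_trans)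
    then have "\<gamma> y \<in> G" using y(1) by blast
    then obtain V g where V: "open V" "\<gamma> y \<in> V" "homeomorphism V (p ` V) p g"
      using G unfolding spread_domain_def by blast
    let ?N = "({0..} \<inter> \<gamma> -` V) \<inter> ({0..} \<inter> \<delta> -` V)"
    have "?N \<subseteq> ?T"
    proof
      fix z assume z: "z \<in> ?N"
      have "p (\<gamma> z) = p (\<delta> z)" using p[of z] z by simp
      then have "g (p (\<gamma> z)) = g (p (\<delta> z))" by simp
      moreover have "g (p (\<gamma> z)) = \<gamma> z" "g (p (\<delta> z)) = \<delta> z"
        using z V(3) by (auto simp: homeomorphism_def)
      ultimately show "z \<in> ?T" using z by auto
    qed
    moreover have "openin ?X ?N" using pre[OF V(1)] by (rule openin_Int)
    moreover have "y \<in> ?N" using y V(2) by auto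
    ultimately show "\<exists>N. openin ?X N \<and> y \<in> N \<and> N \<subseteq> ?T" by blast
  qed
  moreover have "openin ?X ({0..} - ?T)"
  proof (subst openin_subopen, intro ballI)
    fix y assume "y \<in> {0..} - ?T"
    then have y: "y \<in> {0..}" "\<gamma> y \<noteq> \<delta> y" by auto
    then obtain U V where UV: "open U" "open V" "\<gamma> y \<in> U" "\<delta> y \<in> V" "U \<inter> V = {}"
      using hausdorff by metis
    let ?N = "({0..} \<inter> \<gamma> -` U) \<inter> ({0..} \<inter> \<delta> -` V)"
    have "openin ?X ?N" using pre(1)[OF UV(1)] pre(2)[OF UV(2)] by (rule openin_Int)
    moreover have "y \<in> ?N" using y UV by auto
    moreover have "?N \<subseteq> {0..} - ?T" using UV by auto
    ultimately show "\<exists>N. openin ?X N \<and> y \<in> N \<and> N \<subseteq> {0..} - ?T" by blast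
  qed
  then have "closedin ?X ?T" unfolding closedin_def by auto
  moreover have "connected {0::real..}" by simp
  moreover have "0 \<in> ?T" using z by simp
  ultimately have "?T = {0..}" unfolding connected_clopen by blast
  with \<open>x \<ge> 0\<close> show ?thesis by auto
qed

text \<open>
  The domain \<open>\<Gamma>\<^sup>\<plusminus>(d)\<close>. The open disc of radius \<open>d\<close> about a point of the surface is an open set
  containing that point which \<open>p\<close> maps homeomorphically onto a disc of radius \<open>d\<close>.
\<close>

definition Gamma_domain ::
    "('a::t2_space \<Rightarrow> complex) \<Rightarrow> real \<Rightarrow> 'a set \<Rightarrow> real \<Rightarrow> 'a set \<Rightarrow> bool" where
  "Gamma_domain p s \<Delta> d \<Gamma> \<longleftrightarrow> domain_in \<Delta> \<Gamma> \<and>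
     (\<forall>\<xi>\<in>\<Gamma>. \<exists>V g. open V \<and> \<xi> \<in> V \<and> V \<subseteq> \<Delta> \<and> homeomorphism V (ball (p \<xi>) d) p g) \<and>
     (\<forall>\<xi>\<in>\<Gamma>. \<exists>\<gamma>. horizontal_lift p s \<Gamma> \<xi> \<gamma>)"

text \<open>
  The integral over the half-line running from \<open>\<mp>\<infinity> + i Im \<xi>\<close> to \<open>\<xi>\<close>, with \<open>t = \<xi> \<mp> x\<close>, where \<open>x\<close>
  decreases from infinity to \<open>0\<close>; hence the factor \<open>s\<close>.
\<close>

definition ray_integral ::
    "('a::t2_space \<Rightarrow> complex) \<Rightarrow> real \<Rightarrow> 'a set \<Rightarrow> ('a \<Rightarrow> complex) \<Rightarrow> 'a \<Rightarrow> complex" where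
  "ray_integral p s S f \<xi> =
     complex_of_real s * integral {0..} (\<lambda>x. f (horizontal_ray p s S \<xi> x))"

primrec A_coeff ::
    "('a::t2_space \<Rightarrow> complex) \<Rightarrow> ('a \<Rightarrow> complex) \<Rightarrow> ('a \<Rightarrow> complex) \<Rightarrow> real \<Rightarrow> 'a set \<Rightarrow> nat \<Rightarrow> 'a \<Rightarrow> complex"
  where
    "A_coeff p \<phi> \<psi> s \<Gamma> 0 = (\<lambda>\<xi>. 1)"
  | "A_coeff p \<phi> \<psi> s \<Gamma> (Suc n) = (\<lambda>\<xi>.
       - (1/2) * \<phi> \<xi> * A_coeff p \<phi> \<psi> s \<Gamma> n \<xi>
       - complex_of_real s * (1/2) * spread_deriv p (A_coeff p \<phi> \<psi> s \<Gamma> n) \<xi>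
       - complex_of_real s * (1/2) * ray_integral p s \<Gamma>
           (\<lambda>t. ((1/4) * (\<phi> t)^2 - complex_of_real s * (1/2) * spread_deriv p \<phi> t - \<psi> t)
                * A_coeff p \<phi> \<psi> s \<Gamma> n t) \<xi>)"


section \<open>The integral in the exponent\<close>

text \<open>
  \<open>contour_value p G \<phi> \<alpha> \<xi> z\<close>: \<open>z\<close> is the value of the integral of \<open>\<phi>\<close> along some contour in \<open>G\<close>
  from the base point \<open>\<alpha>\<close> to \<open>\<xi>\<close>. Here \<open>Some a\<close> is a base point \<open>a \<in> G\<close>, while \<open>None\<close> stands for an
  infinite contour, coming from infinity, whose (improper) integral converges.
\<close>

definition contour_value ::
    "('a::t2_space \<Rightarrow> complex) \<Rightarrow> 'a set \<Rightarrow> ('a \<Rightarrow> complex) \<Rightarrow> 'a option \<Rightarrow> 'a \<Rightarrow> complex \<Rightarrow> bool" where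
  "contour_value p G \<phi> \<alpha> \<xi> z \<longleftrightarrow> (\<exists>\<gamma>::real \<Rightarrow> 'a.
     continuous_on {0<..1} \<gamma> \<and> \<gamma> ` {0<..1} \<subseteq> G \<and> \<gamma> 1 = \<xi> \<and>
     (case \<alpha> of Some a \<Rightarrow> a \<in> G \<and> (\<gamma> \<longlongrightarrow> a) (at_right 0)
              | None \<Rightarrow> filterlim (\<lambda>x. p (\<gamma> x)) at_infinity (at_right 0)) \<and>
     (\<forall>\<epsilon>\<in>{0<..<1}. (\<lambda>x. p (\<gamma> x)) piecewise_C1_differentiable_on {\<epsilon>..1}) \<and>
     ((\<lambda>\<epsilon>. integral {\<epsilon>..1} (\<lambda>x. \<phi> (\<gamma> x) * vector_derivative (\<lambda>x. p (\<gamma> x)) (at x)))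
        \<longlongrightarrow> z) (at_right 0))"

text \<open>
  If \<open>G\<close> is not simply connected the integral depends on the contour, so the contours for the various
  \<open>\<xi> \<in> S\<close> have to be chosen consistently: \<open>\<Phi>\<close> is a single-valued holomorphic branch on \<open>S\<close> of the
  integral from \<open>\<alpha>\<close> to \<open>\<xi>\<close>.
\<close>

definition integral_branch ::
    "('a::t2_space \<Rightarrow> complex) \<Rightarrow> 'a set \<Rightarrow> ('a \<Rightarrow> complex) \<Rightarrow> 'a option \<Rightarrow> 'a set \<Rightarrow> ('a \<Rightarrow> complex) \<Rightarrow> bool" where
  "integral_branch p G \<phi> \<alpha> S \<Phi> \<longleftrightarrow>
     (\<forall>\<xi>\<in>S. contour_value p G \<phi> \<alpha> \<xi> (\<Phi> \<xi>) \<and> has_spread_deriv p \<Phi> (\<phi> \<xi>) \<xi>)"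


section \<open>Solutions, Borel plane regions and asymptotics\<close>

definition solves_ode ::
    "('a::t2_space \<Rightarrow> complex) \<Rightarrow> ('a \<Rightarrow> complex) \<Rightarrow> ('a \<Rightarrow> complex) \<Rightarrow> 'a set \<Rightarrow> complex
     \<Rightarrow> ('a \<Rightarrow> complex) \<Rightarrow> bool" where
  "solves_ode p \<phi> \<psi> S u w \<longleftrightarrow>
     spread_holomorphic p w S \<and> spread_holomorphic p (spread_deriv p w) S \<and>
     (\<forall>\<xi>\<in>S. spread_deriv p (spread_deriv p w) \<xi> = (u^2 + u * \<phi> \<xi> + \<psi> \<xi>) * w \<xi>)"

definition U_region :: "real \<Rightarrow> complex set" where
  "U_region r = {t. Re t > 0 \<and> \<bar>Im t\<bar> < r} \<union> ball 0 r"

definition uniform_expansion ::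
    "complex set \<Rightarrow> 'a set \<Rightarrow> (complex \<Rightarrow> 'a \<Rightarrow> complex) \<Rightarrow> (nat \<Rightarrow> 'a \<Rightarrow> complex) \<Rightarrow> bool" where
  "uniform_expansion T S f a \<longleftrightarrow> (\<forall>N\<ge>1. \<exists>C R. \<forall>u\<in>T. norm u \<ge> R \<longrightarrow>
     (\<forall>\<xi>\<in>S. norm (f u \<xi> - (\<Sum>n = 1..N-1. a n \<xi> / u ^ n)) \<le> C / norm u ^ N))"

end

theory Submission
  imports Defs "HOL-Complex_Analysis.Complex_Analysis" "HOL-Real_Asymp.Real_Asymp"
begin

text \<open>
  In the coordinate \<open>z = q \<xi> = - s p \<xi>\<close> the factor \<open>1 + \<eta>\<close> has to satisfy
  \<open>\<eta>'' = (2 u + \<phi>) \<eta>' - g (1 + \<eta>)\<close> with \<open>g = \<phi>\<^sup>2/4 - \<phi>'/2 - \<psi>\<close>. Its Borel transform, written as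
  \<open>F t = f (t/2, z)\<close>, then solves the hyperbolic equation \<open>f\<^sub>z\<^sub>z = f\<^sub>\<tau>\<^sub>z + \<phi> f\<^sub>z - g f\<close>. On the
  characteristics \<open>z + \<tau> = const\<close> this is a Volterra equation for \<open>f\<^sub>z\<close>, and \<open>f\<close> is minus the integral of
  \<open>f\<^sub>z\<close> from \<open>z\<close> to \<open>+\<infinity>\<close>. If \<open>g\<close> is dominated by \<open>\<gamma> = - G'\<close> with \<open>G \<rightarrow> 0\<close>, the \<open>n\<close>-th Picard correction is at
  most \<open>e\<^sup>\<sigma>\<^sup>|\<^sup>\<tau>\<^sup>|\<close>, from the integrating factor, times \<open>c\<^sup>n |\<tau>|\<^sup>n G\<^sup>n\<^sup>+\<^sup>1 / (n! (n+1)!)\<close>: one factorial comes from the \<open>\<tau>\<close>-integrations, the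
  other from the \<open>z\<close>-integrations. The double factorial makes the remaining sum subexponential in \<open>\<tau>\<close>, which gives the
  bound with \<open>e\<^sup>\<sigma>\<^sup>t\<close> for every \<open>\<sigma> > 0\<close>. The Laplace transform of the hyperbolic equation is the equation for
  \<open>\<eta>\<close>; its Taylor coefficients at \<open>\<tau> = 0\<close>, integrated once from \<open>+\<infinity>\<close>, give the recursion for the \<open>A\<^sub>n\<close>;
  Cauchy's estimates on the half-strip and repeated integration by parts give the expansion.
\<close>

text \<open>With \<open>tau = t/2\<close> the operator is \<open>f_zz - f_(tau z)\<close>: a point
  (\<open>tau\<close>, \<open>z\<close>) sees the data on the straight segment from \<open>z\<close>
  to \<open>z + tau\<close> and on the horizontal rays going right from it. Convex sets invariant
  under translation to the right contain all of this, so the charts are half-strips about single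
  rays; the discs of radius \<open>d\<close> granted by the definition of \<Gamma> glue to exactly
  such a strip. The obstacle is that \<open>tau\<close> may have negative real part. The segment
  then runs to the left of \<open>z\<close>, and the decaying majorant must be read at one and the
  same leftmost point for the kernel and for the previous iterate; only then is their product an
  exact derivative that integrates to the second factorial. The bounds hold on strips of radius
  \<open>r < d\<close>. Their constants depend on \<open>r\<close> but not on the chart, whence
  uniformity on \<Gamma>; the function constructed does not depend on \<open>r\<close>, so all
  \<open>r < d\<close> together reach \<open>U(2d)\<close>. Joint holomorphy passes through
  integrals and limits by Osgood's lemma, so an integral over a half-line only needs locally
  uniformly small tails.\<close>

section \<open>Improper integrals with an explicit tail\<close>

text \<open>The majorant \<open>m'\<close> is integrable because its primitive has a limit;
  dominated convergence then applies to \<open>k\<close>. The tail bound \<open>m N\<close> is what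
  later makes convergence locally uniform in parameters, and the limit along the naturals fits the
  theorems on sequences of holomorphic functions.\<close>

lemma improper_integral_dominated:
  fixes k :: "real \<Rightarrow> complex" and m m' :: "real \<Rightarrow> real"
  assumes cont: "continuous_on {0..} k"
    and m: "\<And>x. x \<ge> 0 \<Longrightarrow> (m has_real_derivative - m' x) (at x)"
    and bnd: "\<And>x. x \<ge> 0 \<Longrightarrow> norm (k x) \<le> m' x"
    and lim: "(m \<longlongrightarrow> 0) at_top"
  shows "k integrable_on {0..}"
    and "N \<ge> 0 \<Longrightarrow> norm (integral {0..} k - integral {0..N} k) \<le> m N"
    and "norm (integral {0..} k) \<le> m 0"
    and "(\<lambda>n. integral {0..real n} k) \<longlonglongrightarrow> integral {0..} k"
proof -
  have int_m': "(m' has_integral (m a - m b)) {a..b}" if "0 \<le> a" "a \<le> b" for a b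
  proof -
    have "((\<lambda>x. - m' x) has_integral (m b - m a)) {a..b}"
      by (rule fundamental_theorem_of_calculus)
        (use that m in \<open>auto simp: has_real_derivative_iff_has_vector_derivative[symmetric]
          intro: has_field_derivative_at_within\<close>)
    from has_integral_neg[OF this] show ?thesis by simp
  qed
  have m'_nonneg: "m' x \<ge> 0" if "x \<ge> 0" for x
    using bnd[OF that] norm_ge_zero[of "k x"] by linarith
  have mono: "m b \<le> m a" if "0 \<le> a" "a \<le> b" for a b
    using has_integral_nonneg[OF int_m'[OF that]] m'_nonneg that by simp
  have m_nonneg: "m a \<ge> 0" if "a \<ge> 0" for a
  proof (rule tendsto_upperbound[OF lim])
    show "\<forall>\<^sub>F x in at_top. m x \<le> m a"
      using eventually_ge_at_top[of a] by eventually_elim (use that mono in auto)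
  qed simp
  have m'_int: "m' integrable_on {0..}"
  proof -
    have "m' integrable_on {0..y}" for y
      using int_m'[of 0 y] by (cases "y \<ge> 0") (auto simp: integrable_on_def)
    moreover have "((\<lambda>y. integral {0..y} m') \<longlongrightarrow> m 0) at_top"
    proof (rule Lim_transform_eventually)
      show "((\<lambda>y. m 0 - m y) \<longlongrightarrow> m 0) at_top"
        using tendsto_diff[OF tendsto_const lim, of "m 0"] by simp
      show "\<forall>\<^sub>F y in at_top. m 0 - m y = integral {0..y} m'"
        using eventually_ge_at_top[of 0]
        by eventually_elim (use int_m'[of 0] in \<open>auto intro!: integral_unique[symmetric]\<close>)
    qed
    ultimately have "(m' has_integral m 0) {0..}"
      using m'_nonneg by (rule has_integral_to_inf)
    then show ?thesis by blast
  qed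
  have kint: "k integrable_on {a..b}" if "0 \<le> a" for a b
    using continuous_on_subset[OF cont] that by (intro integrable_continuous_interval) auto
  define f where "f = (\<lambda>(n::nat) x. if x \<in> {0..real n} then k x else 0)"
  have hf: "(f n has_integral integral {0..real n} k) {0..}" for n
    unfolding f_def using integrable_integral[OF kint[of 0 "real n"]]
    by (subst has_integral_restrict) auto
  have c1: "f n integrable_on {0..}" for n
    using hf by blast
  have c2: "norm (f n x) \<le> m' x" if "x \<in> {0..}" for n x
    using that bnd m'_nonneg by (auto simp: f_def)
  have c3: "(\<lambda>n. f n x) \<longlonglongrightarrow> k x" if "x \<in> {0..}" for x
  proof (rule tendsto_eventually)
    have "eventually (\<lambda>n. real n \<ge> x) at_top"
      by (meson eventually_sequentiallyI nat_ceiling_le_eq)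
    then show "\<forall>\<^sub>F n in sequentially. f n x = k x"
      by eventually_elim (use that in \<open>auto simp: f_def\<close>)
  qed
  have conv: "k integrable_on {0..}" "(\<lambda>n. integral {0..} (f n)) \<longlonglongrightarrow> integral {0..} k"
    using dominated_convergence[OF c1 m'_int c2 c3] by blast+
  then show 1: "k integrable_on {0..}" and 2: "(\<lambda>n. integral {0..real n} k) \<longlonglongrightarrow> integral {0..} k"
    by (auto simp: integral_unique[OF hf])
  show 3: "norm (integral {0..} k - integral {0..N} k) \<le> m N" if N: "N \<ge> 0" for N
  proof (rule tendsto_upperbound)
    show "((\<lambda>n. norm (integral {0..real n} k - integral {0..N} k))
      \<longlongrightarrow> norm (integral {0..} k - integral {0..N} k)) sequentially"
      by (intro tendsto_intros 2)
    have "eventually (\<lambda>n. real n \<ge> N) sequentially"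
      by (meson eventually_sequentiallyI nat_ceiling_le_eq)
    then show "\<forall>\<^sub>F n in sequentially. norm (integral {0..real n} k - integral {0..N} k) \<le> m N"
    proof eventually_elim
      case (elim n)
      have "integral {0..N} k + integral {N..real n} k = integral {0..real n} k"
        using elim N kint by (intro Henstock_Kurzweil_Integration.integral_combine) auto
      then have "integral {0..real n} k - integral {0..N} k = integral {N..real n} k"
        by (simp add: algebra_simps)
      moreover have "norm (integral {N..real n} k) \<le> integral {N..real n} m'"
        using N bnd int_m'[OF N elim] kint by (intro integral_norm_bound_integral) auto
      moreover have "integral {N..real n} m' = m N - m (real n)"
        using int_m'[OF N elim] by (rule integral_unique)
      ultimately show ?case using m_nonneg[of "real n"] by simp
    qed
  qed (simp add: holomorphic_on_def)
  show "norm (integral {0..} k) \<le> m 0"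
    using 3[of 0] by simp
qed

section \<open>Holomorphic functions of two variables\<close>

text \<open>The plane counterpart of \<open>jointly_analytic\<close>: a complex-linear Frechet
  derivative. It is taken in a full neighbourhood, so the notion is meant for open sets.\<close>

definition hol2 :: "(complex \<times> complex \<Rightarrow> complex) \<Rightarrow> (complex \<times> complex) set \<Rightarrow> bool" where
  "hol2 f \<Omega> \<longleftrightarrow> (\<forall>x\<in>\<Omega>. \<exists>a b. (f has_derivative (\<lambda>v. a * fst v + b * snd v)) (at x))"

lemma hol2_subset: "hol2 f \<Omega> \<Longrightarrow> \<Omega>' \<subseteq> \<Omega> \<Longrightarrow> hol2 f \<Omega>'"
  unfolding hol2_def by blast

lemma hol2_imp_continuous_on: "hol2 f \<Omega> \<Longrightarrow> continuous_on \<Omega> f"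
  unfolding hol2_def
  by (meson continuous_at_imp_continuous_on has_derivative_continuous)

lemma hol2_const: "hol2 (\<lambda>x. c) \<Omega>"
  unfolding hol2_def by (auto intro!: exI[of _ 0] derivative_eq_intros)

lemma hol2_fst: "hol2 fst \<Omega>"
  unfolding hol2_def by (intro ballI exI[of _ 1] exI[of _ 0]) (auto intro!: derivative_eq_intros)

lemma hol2_snd: "hol2 snd \<Omega>"
  unfolding hol2_def by (intro ballI exI[of _ 0] exI[of _ 1]) (auto intro!: derivative_eq_intros)

lemma hol2_add:
  assumes "hol2 f \<Omega>" "hol2 g \<Omega>"
  shows "hol2 (\<lambda>x. f x + g x) \<Omega>"
  unfolding hol2_def
proof
  fix x assume "x \<in> \<Omega>"
  then obtain a b c d where "(f has_derivative (\<lambda>v. a * fst v + b * snd v)) (at x)"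
    "(g has_derivative (\<lambda>v. c * fst v + d * snd v)) (at x)"
    using assms unfolding hol2_def by meson
  from has_derivative_add[OF this]
  show "\<exists>a b. ((\<lambda>x. f x + g x) has_derivative (\<lambda>v. a * fst v + b * snd v)) (at x)"
    by (intro exI[of _ "a + c"] exI[of _ "b + d"]) (simp add: algebra_simps)
qed

lemma hol2_mult:
  assumes "hol2 f \<Omega>" "hol2 g \<Omega>"
  shows "hol2 (\<lambda>x. f x * g x) \<Omega>"
  unfolding hol2_def
proof
  fix x assume "x \<in> \<Omega>"
  then obtain a b c d where "(f has_derivative (\<lambda>v. a * fst v + b * snd v)) (at x)"
    "(g has_derivative (\<lambda>v. c * fst v + d * snd v)) (at x)"
    using assms unfolding hol2_def by meson
  from has_derivative_mult[OF this]
  show "\<exists>a b. ((\<lambda>x. f x * g x) has_derivative (\<lambda>v. a * fst v + b * snd v)) (at x)"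
    by (intro exI[of _ "f x * c + a * g x"] exI[of _ "f x * d + b * g x"]) (simp add: algebra_simps)
qed

lemma hol2_cmult: "hol2 f \<Omega> \<Longrightarrow> hol2 (\<lambda>x. c * f x) \<Omega>"
  by (intro hol2_mult hol2_const)

lemma hol2_minus: "hol2 f \<Omega> \<Longrightarrow> hol2 (\<lambda>x. - f x) \<Omega>"
  using hol2_cmult[of f \<Omega> "-1"] by simp

lemma hol2_diff: "hol2 f \<Omega> \<Longrightarrow> hol2 g \<Omega> \<Longrightarrow> hol2 (\<lambda>x. f x - g x) \<Omega>"
  using hol2_add[OF _ hol2_minus, of f \<Omega> g] by simp

lemma hol2_sum: "(\<And>i. i \<in> I \<Longrightarrow> hol2 (f i) \<Omega>) \<Longrightarrow> hol2 (\<lambda>x. \<Sum>i\<in>I. f i x) \<Omega>"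
  by (induction I rule: infinite_finite_induct) (auto intro: hol2_const hol2_add)

lemma hol2_compose_holomorphic:
  assumes "f holomorphic_on S" "open S" "hol2 g \<Omega>" "\<And>x. x \<in> \<Omega> \<Longrightarrow> g x \<in> S"
  shows "hol2 (\<lambda>x. f (g x)) \<Omega>"
  unfolding hol2_def
proof
  fix x assume x: "x \<in> \<Omega>"
  then obtain a b where g: "(g has_derivative (\<lambda>v. a * fst v + b * snd v)) (at x)"
    using assms unfolding hol2_def by meson
  have "(f has_field_derivative deriv f (g x)) (at (g x))"
    using assms x by (simp add: holomorphic_derivI)
  then have "(f has_derivative (\<lambda>h. deriv f (g x) * h)) (at (g x))"
    by (simp add: has_field_derivative_def)
  from has_derivative_compose[OF g this]
  show "\<exists>a b. ((\<lambda>x. f (g x)) has_derivative (\<lambda>v. a * fst v + b * snd v)) (at x)"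
    by (intro exI[of _ "deriv f (g x) * a"] exI[of _ "deriv f (g x) * b"]) (simp add: algebra_simps)
qed

lemma hol2_compose:
  assumes "hol2 f \<Omega>'" "hol2 g \<Omega>" "hol2 h \<Omega>" "\<And>x. x \<in> \<Omega> \<Longrightarrow> (g x, h x) \<in> \<Omega>'"
  shows "hol2 (\<lambda>x. f (g x, h x)) \<Omega>"
  unfolding hol2_def
proof
  fix x assume x: "x \<in> \<Omega>"
  obtain a b where g: "(g has_derivative (\<lambda>v. a * fst v + b * snd v)) (at x)"
    using assms x unfolding hol2_def by meson
  obtain c d where h: "(h has_derivative (\<lambda>v. c * fst v + d * snd v)) (at x)"
    using assms x unfolding hol2_def by meson
  obtain p q where f: "(f has_derivative (\<lambda>v. p * fst v + q * snd v)) (at (g x, h x))"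
    using assms x unfolding hol2_def by meson
  from has_derivative_compose[OF has_derivative_Pair[OF g h] f]
  show "\<exists>a b. ((\<lambda>x. f (g x, h x)) has_derivative (\<lambda>v. a * fst v + b * snd v)) (at x)"
    by (intro exI[of _ "p * a + q * c"] exI[of _ "p * b + q * d"]) (simp add: algebra_simps)
qed

lemmas hol2_intros = hol2_const hol2_fst hol2_snd hol2_add hol2_mult hol2_minus hol2_diff hol2_sum

lemma hol2_slice:
  assumes "hol2 f \<Omega>" "(a, b) \<in> \<Omega>"
  shows "(\<lambda>t. f (t, b)) field_differentiable (at a)"
    and "(\<lambda>z. f (a, z)) field_differentiable (at b)"
proof -
  obtain p q where f: "(f has_derivative (\<lambda>v. p * fst v + q * snd v)) (at (a, b))"
    using assms unfolding hol2_def by meson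
  have "((\<lambda>t. (t, b)) has_derivative (\<lambda>h. (h, 0))) (at a)"
    by (auto intro!: derivative_eq_intros)
  from has_derivative_compose[OF this f]
  show "(\<lambda>t. f (t, b)) field_differentiable (at a)"
    by (auto simp: field_differentiable_def has_field_derivative_def intro!: exI[of _ p])
  have "((\<lambda>z. (a, z)) has_derivative (\<lambda>h. (0, h))) (at b)"
    by (auto intro!: derivative_eq_intros)
  from has_derivative_compose[OF this f]
  show "(\<lambda>z. f (a, z)) field_differentiable (at b)"
    by (auto simp: field_differentiable_def has_field_derivative_def intro!: exI[of _ q])
qed

section \<open>Cauchy integrals depending on a parameter\<close>

text \<open>Cauchy's formula as an ordinary integral over \<open>{0..1}\<close>, the form in which
  theorems on parameter integrals apply.\<close>

lemma higher_deriv_circle_integral: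
  assumes "continuous_on (cball z r) f" "f holomorphic_on ball z r" "w \<in> ball z r"
  shows "(deriv ^^ k) f w = integral {0..1} (\<lambda>s. f (z + of_real r * exp (2 * of_real pi * \<i> * of_real s)) *
     (fact k * of_real r * exp (2 * of_real pi * \<i> * of_real s)
      / (z + of_real r * exp (2 * of_real pi * \<i> * of_real s) - w) ^ Suc k))"
proof -
  have "(deriv ^^ k) f w = (fact k) / (2 * pi * \<i>) * integral {0..1}
      (\<lambda>s. f (circlepath z r s) / (circlepath z r s - w)^(Suc k) * vector_derivative (circlepath z r) (at s))"
    using Cauchy_higher_derivative_integral_circlepath(2)[OF assms, of k]
    by (simp add: contour_integral_integral)
  also have "\<dots> = integral {0..1}
      (\<lambda>s. (fact k) / (2 * pi * \<i>) * (f (circlepath z r s) / (circlepath z r s - w)^(Suc k) * vector_derivative (circlepath z r) (at s)))"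
    by (rule integral_mult_right[symmetric])
  also have "\<dots> = integral {0..1} (\<lambda>s. f (z + of_real r * exp (2 * of_real pi * \<i> * of_real s)) *
     (fact k * of_real r * exp (2 * of_real pi * \<i> * of_real s)
      / (z + of_real r * exp (2 * of_real pi * \<i> * of_real s) - w) ^ Suc k))"
    by (rule integral_cong, subst vector_derivative_circlepath) (simp add: circlepath mult_ac del: power_Suc)
  finally show ?thesis .
qed


lemma continuous_on_local_snd:
  assumes "\<And>z. z \<in> U \<Longrightarrow> \<exists>V. open V \<and> z \<in> V \<and> V \<subseteq> U \<and> continuous_on (P \<times> V) f"
  shows "continuous_on (P \<times> U) f"
  unfolding continuous_on_def
proof
  fix p assume p: "p \<in> P \<times> U"
  then obtain V where V: "open V" "snd p \<in> V" "V \<subseteq> U" "continuous_on (P \<times> V) f"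
    using assms[of "snd p"] by auto
  have "(f \<longlongrightarrow> f p) (at p within P \<times> V)"
    using V p by (auto simp: continuous_on_def)
  moreover have "at p within P \<times> V = at p within P \<times> U"
    by (rule at_within_nhd[where S="UNIV \<times> V"]) (use V p in \<open>auto intro!: open_Times\<close>)
  ultimately show "(f \<longlongrightarrow> f p) (at p within P \<times> U)" by simp
qed

text \<open>On a small disc the derivative is an integral of \<open>f\<close> over a fixed circle
  against a continuous kernel, so joint continuity of \<open>f\<close> is inherited.\<close>

lemma continuous_on_higher_deriv_param:
  fixes f :: "'a::topological_space \<Rightarrow> complex \<Rightarrow> complex"
  assumes U: "open U" and cont: "continuous_on (P \<times> U) (\<lambda>(x, z). f x z)"
    and hol: "\<And>x. x \<in> P \<Longrightarrow> f x holomorphic_on U"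
  shows "continuous_on (P \<times> U) (\<lambda>(x, z). (deriv ^^ k) (f x) z)"
proof (rule continuous_on_local_snd)
  fix z0 assume "z0 \<in> U"
  then obtain r where r: "r > 0" "cball z0 r \<subseteq> U"
    using U open_contains_cball by blast
  define e where "e = (\<lambda>s::real. z0 + of_real r * exp (2 * of_real pi * \<i> * of_real s))"
  have e: "e s \<in> U" "dist z0 (e s) = r" for s
  proof -
    show "dist z0 (e s) = r"
      using r by (simp add: e_def dist_norm norm_mult)
    then show "e s \<in> U" using r by auto
  qed
  have ce: "continuous_on A (\<lambda>x. e (g x))" if "continuous_on A g" for A :: "'c::topological_space set" and g
    unfolding e_def by (intro continuous_intros that)
  define G where "G = (\<lambda>(x, z) s. f x (e s) * (fact k * (e s - z0) / (e s - z) ^ Suc k))"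
  have "continuous_on ((P \<times> ball z0 r) \<times> cbox 0 1) (\<lambda>(p, s). G p s)"
  proof -
    have "continuous_on ((P \<times> ball z0 r) \<times> cbox 0 1) (\<lambda>q. f (fst (fst q)) (e (snd q)))"
      by (rule continuous_on_compose2[OF cont, where f="\<lambda>q. (fst (fst q), e (snd q))", unfolded split_beta fst_conv snd_conv])
        (auto intro!: continuous_intros ce e)
    moreover have "continuous_on ((P \<times> ball z0 r) \<times> cbox 0 1)
        (\<lambda>q. fact k * (e (snd q) - z0) / (e (snd q) - snd (fst q)) ^ Suc k)"
    proof (intro continuous_intros ce ballI)
      fix q assume "q \<in> (P \<times> ball z0 r) \<times> cbox (0::real) 1"
      then have "dist z0 (snd (fst q)) < r" by auto
      then have "e (snd q) \<noteq> snd (fst q)" using e(2)[of "snd q"] by auto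
      then show "(e (snd q) - snd (fst q)) ^ Suc k \<noteq> 0" by simp
    qed
    ultimately show ?thesis
      unfolding G_def split_beta by (rule continuous_on_mult)
  qed
  from integral_continuous_on_param[OF this]
  have "continuous_on (P \<times> ball z0 r) (\<lambda>p. integral (cbox 0 1) (G p))" .
  also have "?this \<longleftrightarrow> continuous_on (P \<times> ball z0 r) (\<lambda>(x, z). (deriv ^^ k) (f x) z)"
  proof (rule continuous_on_cong)
    fix p assume p: "p \<in> P \<times> ball z0 r"
    have "(deriv ^^ k) (f (fst p)) (snd p) = integral {0..1} (G p)"
    proof (subst higher_deriv_circle_integral)
      show "continuous_on (cball z0 r) (f (fst p))" "f (fst p) holomorphic_on ball z0 r"
        using r p holomorphic_on_subset[OF hol] ball_subset_cball[of z0 r]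
        by (auto intro!: holomorphic_on_imp_continuous_on simp: subset_iff)
    qed (use p in \<open>auto simp: G_def e_def split_beta mult_ac\<close>)
    then show "integral (cbox 0 1) (G p) = (case p of (x, z) \<Rightarrow> (deriv ^^ k) (f x) z)"
      by (simp add: split_beta)
  qed simp
  finally show "\<exists>V. open V \<and> z0 \<in> V \<and> V \<subseteq> U \<and> continuous_on (P \<times> V) (\<lambda>(x, z). (deriv ^^ k) (f x) z)"
    using r by (intro exI[of _ "ball z0 r"]) auto
qed

lemma continuous_on_swap_args:
  assumes "continuous_on (A \<times> B) (\<lambda>(x, y). f x y)"
  shows "continuous_on (B \<times> A) (\<lambda>(y, x). f x y)"
  unfolding split_beta
  by (rule continuous_on_compose2[OF assms, where f="\<lambda>q. (snd q, fst q)", unfolded split_beta fst_conv snd_conv])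
    (auto intro!: continuous_intros)

text \<open>Leibniz's rule asks for a jointly continuous derivative; for holomorphic integrands this
  is automatic by \<open>continuous_on_higher_deriv_param\<close>.\<close>

lemma has_field_derivative_param_integral:
  fixes g :: "complex \<Rightarrow> real \<Rightarrow> complex"
  assumes U: "open U" and cont: "continuous_on (U \<times> {a..b}) (\<lambda>(z, s). g z s)"
    and hol: "\<And>s. s \<in> {a..b} \<Longrightarrow> (\<lambda>z. g z s) holomorphic_on U" and z: "z \<in> U"
  shows "((\<lambda>z. integral {a..b} (g z)) has_field_derivative
           integral {a..b} (\<lambda>s. deriv (\<lambda>z. g z s) z)) (at z)"
proof -
  obtain r where r: "r > 0" "ball z r \<subseteq> U"
    using U z open_contains_ball by blast
  have sub: "ball z r \<times> cbox a b \<subseteq> U \<times> {a..b}" using r by auto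
  have "continuous_on ({a..b} \<times> U) (\<lambda>(s, z). (deriv ^^ 1) (\<lambda>z. g z s) z)"
    by (intro continuous_on_higher_deriv_param U continuous_on_swap_args[OF cont] hol)
  from continuous_on_swap_args[OF this]
  have "continuous_on (U \<times> {a..b}) (\<lambda>(z, s). deriv (\<lambda>z. g z s) z)" by simp
  then have cd: "continuous_on (ball z r \<times> cbox a b) (\<lambda>(z, s). deriv (\<lambda>z. g z s) z)"
    using sub continuous_on_subset by blast
  have "((\<lambda>z. integral (cbox a b) (g z)) has_field_derivative
           integral (cbox a b) (\<lambda>s. deriv (\<lambda>z. g z s) z)) (at z within ball z r)"
  proof (rule leibniz_rule_field_derivative[OF _ _ cd])
    fix x s assume x: "x \<in> ball z r" "s \<in> cbox a b"
    then show "((\<lambda>z. g z s) has_field_derivative deriv (\<lambda>z. g z s) x) (at x within ball z r)"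
      using hol[of s] r U by (auto intro!: has_field_derivative_at_within[OF holomorphic_derivI[of _ U]])
  next
    fix x assume x: "x \<in> ball z r"
    have "continuous_on {a..b} (\<lambda>s. g x s)"
      by (rule continuous_on_compose2[OF cont, where f="\<lambda>s. (x, s)", unfolded split_beta fst_conv snd_conv])
         (use x r in \<open>auto intro!: continuous_intros\<close>)
    then show "g x integrable_on cbox a b"
      by (simp add: integrable_continuous_interval)
  qed (use r in auto)
  then show ?thesis
    using r at_within_open[of z "ball z r"] by simp
qed

text \<open>Commutation of \<open>t\<close>- and \<open>z\<close>-derivatives: each claim is a
  Cauchy integral in one variable differentiated under the integral sign in the other.\<close>

lemma higher_deriv_param_derivative:
  fixes f :: "complex \<Rightarrow> complex \<Rightarrow> complex"
  assumes T: "open T" and Z: "open Z" and cont: "continuous_on (T \<times> Z) (\<lambda>(t, z). f t z)"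
    and hol1: "\<And>z. z \<in> Z \<Longrightarrow> (\<lambda>t. f t z) holomorphic_on T"
    and hol2: "\<And>t. t \<in> T \<Longrightarrow> f t holomorphic_on Z"
    and z: "z \<in> Z"
  shows "(\<lambda>t. deriv (f t) z) holomorphic_on T"
    and "a \<in> T \<Longrightarrow> ((\<lambda>z. (deriv ^^ k) (\<lambda>t. f t z) a) has_field_derivative
           (deriv ^^ k) (\<lambda>t. deriv (f t) z) a) (at z)"
proof -
  \<comment> \<open>The second derivative is left as a circle integral here; reading it as an
    iterated \<open>t\<close>-derivative uses the holomorphy in \<open>t\<close> that is the first
    half of the claim.\<close>
  have *: "(\<lambda>t. deriv (f t) z) holomorphic_on T \<and>
     (a \<in> T \<longrightarrow> ((\<lambda>z. (deriv ^^ k) (\<lambda>t. f t z) a) has_field_derivative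
           integral {0..1} (\<lambda>s. deriv (f (a + of_real r * exp (2 * of_real pi * \<i> * of_real s))) z *
             (fact k * of_real r * exp (2 * of_real pi * \<i> * of_real s)
      / (a + of_real r * exp (2 * of_real pi * \<i> * of_real s) - a) ^ Suc k))) (at z))"
    if T: "open T" and Z: "open Z" and cont: "continuous_on (T \<times> Z) (\<lambda>(t, z). f t z)"
    and hol1: "\<And>z. z \<in> Z \<Longrightarrow> (\<lambda>t. f t z) holomorphic_on T"
    and hol2: "\<And>t. t \<in> T \<Longrightarrow> f t holomorphic_on Z"
    and z: "z \<in> Z" and r: "r > 0" "cball a r \<subseteq> T"
    for f :: "complex \<Rightarrow> complex \<Rightarrow> complex" and T Z a z k and r :: real
  proof
    obtain R where R: "R > 0" "cball z R \<subseteq> Z"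
      using Z z open_contains_cball by blast
    define e where "e = (\<lambda>s::real. z + of_real R * exp (2 * of_real pi * \<i> * of_real s))"
    have e: "e s \<in> Z" "e s \<noteq> z" for s
    proof -
      have *: "dist z (e s) = R"
        using R by (simp add: e_def dist_norm norm_mult)
      then show "e s \<in> Z" using R by auto
      show "e s \<noteq> z" using * R by auto
    qed
    have ce: "continuous_on A (\<lambda>x. e (g x))" if "continuous_on A g" for A :: "'c::topological_space set" and g
      unfolding e_def by (intro continuous_intros that)
    have "(\<lambda>t. integral {0..1} (\<lambda>s. f t (e s) * ((e s - z) / (e s - z) ^ 2))) holomorphic_on T"
      unfolding holomorphic_on_open[OF T]
    proof (intro ballI exI, rule has_field_derivative_param_integral[OF T])
      have "continuous_on (T \<times> {0..1}) (\<lambda>q. f (fst q) (e (snd q)))"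
        by (rule continuous_on_compose2[OF cont, where f="\<lambda>q. (fst q, e (snd q))", unfolded split_beta fst_conv snd_conv])
          (auto intro!: continuous_intros ce e)
      then show "continuous_on (T \<times> {0..1}) (\<lambda>(t, s). f t (e s) * ((e s - z) / (e s - z)\<^sup>2))"
        unfolding split_beta by (intro continuous_intros ce) (use e in auto)
      show "(\<lambda>t. f t (e s) * ((e s - z) / (e s - z)\<^sup>2)) holomorphic_on T" for s
        using e hol1 by (intro holomorphic_intros) auto
    qed
    also have "?this \<longleftrightarrow> (\<lambda>t. deriv (f t) z) holomorphic_on T"
    proof (rule holomorphic_cong)
      fix t assume t: "t \<in> T"
      have "(deriv ^^ 1) (f t) z = integral {0..1} (\<lambda>s. f t (e s) * ((e s - z) / (e s - z)\<^sup>2))"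
        using holomorphic_on_subset[OF hol2[OF t] R(2)] R(1)
        by (subst higher_deriv_circle_integral[of z R])
          (auto intro!: holomorphic_on_imp_continuous_on intro: holomorphic_on_subset[OF _ ball_subset_cball]
            simp: e_def power2_eq_square)
      then show "integral {0..1} (\<lambda>s. f t (e s) * ((e s - z) / (e s - z)\<^sup>2)) = deriv (f t) z"
        by simp
    qed simp
    finally show "(\<lambda>t. deriv (f t) z) holomorphic_on T" .
  next
    define e where "e = (\<lambda>s::real. a + of_real r * exp (2 * of_real pi * \<i> * of_real s))"
    have e: "e s \<in> T" "e s \<noteq> a" for s
    proof -
      have *: "dist a (e s) = r"
        using r by (simp add: e_def dist_norm norm_mult)
      then show "e s \<in> T" using r by auto
      show "e s \<noteq> a" using * r by auto
    qed
    have ce: "continuous_on A (\<lambda>x. e (g x))" if "continuous_on A g" for A :: "'c::topological_space set" and g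
      unfolding e_def by (intro continuous_intros that)
    define c where "c = (\<lambda>s. fact k * (e s - a) / (e s - a) ^ Suc k)"
    have cc: "continuous_on A (\<lambda>x. c (g x))" if "continuous_on A g" for A :: "'c::topological_space set" and g
      unfolding c_def by (intro continuous_intros that ce) (use e in auto)
    have D: "((\<lambda>z. integral {0..1} (\<lambda>s. f (e s) z * c s)) has_field_derivative
       integral {0..1} (\<lambda>s. deriv (\<lambda>z. f (e s) z * c s) z)) (at z)"
    proof (rule has_field_derivative_param_integral[OF Z])
      have "continuous_on (Z \<times> {0..1}) (\<lambda>q. f (e (snd q)) (fst q))"
        by (rule continuous_on_compose2[OF cont, where f="\<lambda>q. (e (snd q), fst q)", unfolded split_beta fst_conv snd_conv])
          (auto intro!: continuous_intros ce e)
      then show "continuous_on (Z \<times> {0..1}) (\<lambda>(z, s). f (e s) z * c s)"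
        unfolding split_beta by (intro continuous_intros cc)
      show "(\<lambda>z. f (e s) z * c s) holomorphic_on Z" for s
        by (intro holomorphic_intros hol2 e)
    qed fact
    have "((\<lambda>z. (deriv ^^ k) (\<lambda>t. f t z) a) has_field_derivative
        integral {0..1} (\<lambda>s. deriv (\<lambda>z. f (e s) z * c s) z)) (at z)"
    proof (rule has_field_derivative_transform_within_open[OF D Z z])
      fix z assume z: "z \<in> Z"
      show "integral {0..1} (\<lambda>s. f (e s) z * c s) = (deriv ^^ k) (\<lambda>t. f t z) a"
        using holomorphic_on_subset[OF hol1[OF z] r(2)] r(1)
        by (subst higher_deriv_circle_integral[of a r])
          (auto intro!: holomorphic_on_imp_continuous_on intro: holomorphic_on_subset[OF _ ball_subset_cball]
            simp: e_def c_def)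
    qed
    also have "(\<lambda>s. deriv (\<lambda>z. f (e s) z * c s) z) = (\<lambda>s. deriv (f (e s)) z * c s)"
    proof
      fix s
      have "(f (e s) has_field_derivative deriv (f (e s)) z) (at z)"
        using hol2[OF e(1)] Z z by (rule holomorphic_derivI)
      then have "((\<lambda>z. f (e s) z * c s) has_field_derivative deriv (f (e s)) z * c s) (at z)"
        by (auto intro!: derivative_eq_intros)
      then show "deriv (\<lambda>z. f (e s) z * c s) z = deriv (f (e s)) z * c s"
        by (rule DERIV_imp_deriv)
    qed
    finally show "a \<in> T \<longrightarrow> ((\<lambda>z. (deriv ^^ k) (\<lambda>t. f t z) a) has_field_derivative
           integral {0..1} (\<lambda>s. deriv (f (a + of_real r * exp (2 * of_real pi * \<i> * of_real s))) z *
             (fact k * of_real r * exp (2 * of_real pi * \<i> * of_real s)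
      / (a + of_real r * exp (2 * of_real pi * \<i> * of_real s) - a) ^ Suc k))) (at z)"
      by (simp add: e_def c_def)
  qed
  show 1: "(\<lambda>t. deriv (f t) z) holomorphic_on T"
  proof (cases "T = {}")
    case False
    then obtain a r where "r > 0" "cball a r \<subseteq> T"
      using T open_contains_cball by blast
    then show ?thesis using *[OF T Z cont hol1 hol2 z] by blast
  qed (simp add: holomorphic_on_def)
  assume a: "a \<in> T"
  then obtain r where r: "r > 0" "cball a r \<subseteq> T"
    using T open_contains_cball by blast
  have "(deriv ^^ k) (\<lambda>t. deriv (f t) z) a = integral {0..1} (\<lambda>s. deriv (f (a + of_real r * exp (2 * of_real pi * \<i> * of_real s))) z *
             (fact k * of_real r * exp (2 * of_real pi * \<i> * of_real s)
      / (a + of_real r * exp (2 * of_real pi * \<i> * of_real s) - a) ^ Suc k))"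
    by (rule higher_deriv_circle_integral)
      (use holomorphic_on_subset[OF 1 r(2)] r(1) in
        \<open>auto intro!: holomorphic_on_imp_continuous_on intro: holomorphic_on_subset[OF _ ball_subset_cball]\<close>)
  with *[OF T Z cont hol1 hol2 z r, of k] a
  show "((\<lambda>z. (deriv ^^ k) (\<lambda>t. f t z) a) has_field_derivative
           (deriv ^^ k) (\<lambda>t. deriv (f t) z) a) (at z)" by simp
qed

lemma field_differentiable_imp_holomorphic_on:
  "(\<And>z. z \<in> S \<Longrightarrow> f field_differentiable (at z)) \<Longrightarrow> f holomorphic_on S"
  by (simp add: holomorphic_on_def field_differentiable_at_within)

lemma hol2_slice_holomorphic:
  assumes "hol2 f \<Omega>"
  shows "(\<And>t. t \<in> U \<Longrightarrow> (t, b) \<in> \<Omega>) \<Longrightarrow> (\<lambda>t. f (t, b)) holomorphic_on U"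
    and "(\<And>z. z \<in> U \<Longrightarrow> (a, z) \<in> \<Omega>) \<Longrightarrow> (\<lambda>z. f (a, z)) holomorphic_on U"
  by (auto intro!: field_differentiable_imp_holomorphic_on hol2_slice[OF assms])

section \<open>Osgood's lemma, limits and integrals\<close>

text \<open>Osgood's lemma. Continuity together with holomorphy in \<open>z\<close> makes the
  \<open>z\<close>-derivative jointly continuous, and existence of both partial derivatives with one
  of them continuous gives total differentiability.\<close>

lemma hol2_osgood:
  assumes \<Omega>: "open \<Omega>" and cont: "continuous_on \<Omega> f"
    and d1: "\<And>a b. (a, b) \<in> \<Omega> \<Longrightarrow> (\<lambda>t. f (t, b)) field_differentiable (at a)"
    and d2: "\<And>a b. (a, b) \<in> \<Omega> \<Longrightarrow> (\<lambda>z. f (a, z)) field_differentiable (at b)"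
  shows "hol2 f \<Omega>"
  unfolding hol2_def
proof
  fix x assume x: "x \<in> \<Omega>"
  obtain a b where ab: "x = (a, b)" by force
  from open_prod_elim[OF \<Omega> x] obtain A B0 where A: "open A" "open B0" "x \<in> A \<times> B0" "A \<times> B0 \<subseteq> \<Omega>"
    by blast
  then obtain r where r: "r > 0" "ball b r \<subseteq> B0"
    using open_contains_ball[of B0] ab by auto
  define B where "B = ball b r"
  have B: "open B" "convex B" "b \<in> B" "a \<in> A" "A \<times> B \<subseteq> \<Omega>"
    using r A ab by (auto simp: B_def)
  have "continuous_on (A \<times> B) (\<lambda>(a, z). (deriv ^^ 1) (\<lambda>z. f (a, z)) z)"
  proof (rule continuous_on_higher_deriv_param)
    show "continuous_on (A \<times> B) (\<lambda>(a, z). f (a, z))"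
      using continuous_on_subset[OF cont B(5)] by simp
    show "(\<lambda>z. f (a, z)) holomorphic_on B" if "a \<in> A" for a
      using that B by (intro field_differentiable_imp_holomorphic_on d2) auto
  qed (rule B)
  then have c: "continuous_on (A \<times> B) (\<lambda>(a, z). deriv (\<lambda>z. f (a, z)) z)" by simp
  have "((\<lambda>(x, y). f (x, y)) has_derivative
      (\<lambda>(tx, ty). deriv (\<lambda>t. f (t, b)) a * tx + blinfun_mult_right (deriv (\<lambda>z. f (a, z)) b) ty)) (at (a, b) within A \<times> B)"
  proof (rule has_derivative_partialsI)
    have "(a, b) \<in> \<Omega>" using B by auto
    from field_differentiable_derivI[OF d1[OF this]]
    show "((\<lambda>x. f (x, b)) has_derivative (*) (deriv (\<lambda>t. f (t, b)) a)) (at a within A)"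
      by (auto simp: has_field_derivative_def intro: has_derivative_at_withinI)
    show "((\<lambda>y. f (x, y)) has_derivative blinfun_apply (blinfun_mult_right (deriv (\<lambda>z. f (x, z)) y))) (at y within B)"
      if "x \<in> A" "y \<in> B" for x y
    proof -
      have "(x, y) \<in> \<Omega>" using B that by auto
      from field_differentiable_derivI[OF d2[OF this]]
      show ?thesis
        by (auto simp: has_field_derivative_def intro: has_derivative_at_withinI)
    qed
    have "continuous_on (A \<times> B) (\<lambda>p. blinfun_mult_right (deriv (\<lambda>z. f (fst p, z)) (snd p)))"
      using c by (intro bounded_linear.continuous_on[OF bounded_linear_blinfun_mult_right]) (simp add: split_beta)
    then show "continuous (at (a, b) within A \<times> B) (\<lambda>(x, y). blinfun_mult_right (deriv (\<lambda>z. f (x, z)) y))"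
      using B unfolding split_beta by (auto simp: continuous_on_eq_continuous_within)
  qed (use B in auto)
  moreover have "at (a, b) within A \<times> B = at (a, b)"
    using A B by (intro at_within_open) (auto intro!: open_Times)
  ultimately have "(f has_derivative
      (\<lambda>v. deriv (\<lambda>t. f (t, b)) a * fst v + deriv (\<lambda>z. f (a, z)) b * snd v)) (at x)"
    by (simp add: ab case_prod_unfold)
  then show "\<exists>a b. (f has_derivative (\<lambda>v. a * fst v + b * snd v)) (at x)" by blast
qed

text \<open>Weierstrass' theorem in each variable separately, continuity of uniform limits, and
  Osgood's lemma.\<close>

lemma hol2_uniform_limit:
  assumes \<Omega>: "open \<Omega>" and f: "\<And>n::nat. hol2 (f n) \<Omega>"
    and lim: "\<And>x. x \<in> \<Omega> \<Longrightarrow> \<exists>A. open A \<and> x \<in> A \<and> A \<subseteq> \<Omega> \<and> uniform_limit A f g sequentially"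
  shows "hol2 g \<Omega>"
proof (rule hol2_osgood[OF \<Omega>])
  have cA: "continuous_on A g" if "A \<subseteq> \<Omega>" "uniform_limit A f g sequentially" for A
    using that by (intro uniform_limit_theorem[OF _ that(2)])
      (auto intro!: always_eventually continuous_on_subset[OF hol2_imp_continuous_on[OF f]])
  show "continuous_on \<Omega> g"
  proof (rule continuous_at_imp_continuous_on, rule ballI)
    fix x assume "x \<in> \<Omega>"
    then obtain A where "open A" "x \<in> A" "A \<subseteq> \<Omega>" "uniform_limit A f g sequentially"
      using lim by blast
    then show "continuous (at x) g"
      using cA continuous_on_eq_continuous_at by blast
  qed
  fix a b assume ab: "(a, b) \<in> \<Omega>"
  then obtain A where A: "open A" "(a, b) \<in> A" "A \<subseteq> \<Omega>" "uniform_limit A f g sequentially"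
    using lim by blast
  obtain U V where UV: "open U" "open V" "a \<in> U" "b \<in> V" "U \<times> V \<subseteq> A"
    using open_prod_elim[OF A(1,2)] by (metis mem_Sigma_iff)
  have u: "uniform_limit S (\<lambda>n x. f n (h x)) (\<lambda>x. g (h x)) sequentially" if "h ` S \<subseteq> A" for h and S :: "complex set"
    using A(4) that unfolding uniform_limit_iff by (fast elim: eventually_mono)
  have "(\<lambda>t. g (t, b)) holomorphic_on U"
  proof (rule holomorphic_uniform_sequence[OF UV(1)])
    show "(\<lambda>t. f n (t, b)) holomorphic_on U" for n
      by (rule hol2_slice_holomorphic(1)[OF f]) (use UV A(3) in auto)
    fix x assume "x \<in> U"
    then obtain d where d: "d > 0" "cball x d \<subseteq> U" using UV(1) open_contains_cball by blast
    then have "uniform_limit (cball x d) (\<lambda>n t. f n (t, b)) (\<lambda>t. g (t, b)) sequentially"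
      using UV by (intro u) auto
    with d show "\<exists>d>0. cball x d \<subseteq> U \<and> uniform_limit (cball x d) (\<lambda>n t. f n (t, b)) (\<lambda>t. g (t, b)) sequentially"
      by blast
  qed
  then show "(\<lambda>t. g (t, b)) field_differentiable at a"
    using UV holomorphic_on_imp_differentiable_at by blast
  have "(\<lambda>t. g (a, t)) holomorphic_on V"
  proof (rule holomorphic_uniform_sequence[OF UV(2)])
    show "(\<lambda>t. f n (a, t)) holomorphic_on V" for n
      by (rule hol2_slice_holomorphic(2)[OF f]) (use UV A(3) in auto)
    fix x assume "x \<in> V"
    then obtain d where d: "d > 0" "cball x d \<subseteq> V" using UV(2) open_contains_cball by blast
    then have "uniform_limit (cball x d) (\<lambda>n t. f n (a, t)) (\<lambda>t. g (a, t)) sequentially"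
      using UV by (intro u) auto
    with d show "\<exists>d>0. cball x d \<subseteq> V \<and> uniform_limit (cball x d) (\<lambda>n t. f n (a, t)) (\<lambda>t. g (a, t)) sequentially"
      by blast
  qed
  then show "(\<lambda>t. g (a, t)) field_differentiable at b"
    using UV holomorphic_on_imp_differentiable_at by blast
qed

lemma hol2_integral:
  fixes g :: "complex \<times> complex \<Rightarrow> real \<Rightarrow> complex"
  assumes \<Omega>: "open \<Omega>" and cont: "continuous_on (\<Omega> \<times> {a..b}) (\<lambda>(w, s). g w s)"
    and hol: "\<And>s. s \<in> {a..b} \<Longrightarrow> hol2 (\<lambda>w. g w s) \<Omega>"
  shows "hol2 (\<lambda>w. integral {a..b} (g w)) \<Omega>"
proof (rule hol2_osgood[OF \<Omega>])
  show "continuous_on \<Omega> (\<lambda>w. integral {a..b} (g w))"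
    using integral_continuous_on_param[of \<Omega> a b g] cont by simp
  fix x y assume xy: "(x, y) \<in> \<Omega>"
  obtain U V where UV: "open U" "open V" "x \<in> U" "y \<in> V" "U \<times> V \<subseteq> \<Omega>"
    using open_prod_elim[OF \<Omega> xy] by (metis mem_Sigma_iff)
  have "((\<lambda>t. integral {a..b} (g (t, y))) has_field_derivative
      integral {a..b} (\<lambda>s. deriv (\<lambda>t. g (t, y) s) x)) (at x)"
  proof (rule has_field_derivative_param_integral[OF UV(1)])
    show "continuous_on (U \<times> {a..b}) (\<lambda>(t, s). g (t, y) s)"
      unfolding split_beta
      by (rule continuous_on_compose2[OF cont, where f="\<lambda>q. ((fst q, y), snd q)", unfolded split_beta fst_conv snd_conv])
        (use UV in \<open>auto intro!: continuous_intros\<close>)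
    show "(\<lambda>t. g (t, y) s) holomorphic_on U" if "s \<in> {a..b}" for s
      by (rule hol2_slice_holomorphic(1)[OF hol[OF that]]) (use UV in auto)
  qed (use UV in auto)
  then show "(\<lambda>t. integral {a..b} (g (t, y))) field_differentiable at x"
    by (auto simp: field_differentiable_def)
  have "((\<lambda>t. integral {a..b} (g (x, t))) has_field_derivative
      integral {a..b} (\<lambda>s. deriv (\<lambda>t. g (x, t) s) y)) (at y)"
  proof (rule has_field_derivative_param_integral[OF UV(2)])
    show "continuous_on (V \<times> {a..b}) (\<lambda>(t, s). g (x, t) s)"
      unfolding split_beta
      by (rule continuous_on_compose2[OF cont, where f="\<lambda>q. ((x, fst q), snd q)", unfolded split_beta fst_conv snd_conv])
        (use UV in \<open>auto intro!: continuous_intros\<close>)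
    show "(\<lambda>t. g (x, t) s) holomorphic_on V" if "s \<in> {a..b}" for s
      by (rule hol2_slice_holomorphic(2)[OF hol[OF that]]) (use UV in auto)
  qed (use UV in auto)
  then show "(\<lambda>t. integral {a..b} (g (x, t))) field_differentiable at y"
    by (auto simp: field_differentiable_def)
qed

text \<open>The truncated integrals are holomorphic and converge locally uniformly. The tail
  hypothesis has the shape delivered by \<open>improper_integral_dominated\<close>.\<close>

lemma hol2_improper_integral:
  fixes k :: "complex \<times> complex \<Rightarrow> real \<Rightarrow> complex"
  assumes \<Omega>: "open \<Omega>" and cont: "continuous_on (\<Omega> \<times> {0..}) (\<lambda>(w, x). k w x)"
    and hol: "\<And>x. x \<ge> 0 \<Longrightarrow> hol2 (\<lambda>w. k w x) \<Omega>"
    and tail: "\<And>w. w \<in> \<Omega> \<Longrightarrow> \<exists>A e. open A \<and> w \<in> A \<and> A \<subseteq> \<Omega> \<and> e \<longlonglongrightarrow> 0 \<and>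
      (\<forall>v\<in>A. \<forall>n. norm (integral {0..} (k v) - integral {0..real n} (k v)) \<le> e n)"
  shows "hol2 (\<lambda>w. integral {0..} (k w)) \<Omega>"
proof (rule hol2_uniform_limit[OF \<Omega>])
  show "hol2 (\<lambda>w. integral {0..real n} (k w)) \<Omega>" for n
    by (intro hol2_integral \<Omega> continuous_on_subset[OF cont] hol) auto
  fix w assume "w \<in> \<Omega>"
  then obtain A e where A: "open A" "w \<in> A" "A \<subseteq> \<Omega>" "e \<longlonglongrightarrow> 0"
    "\<And>v n. v \<in> A \<Longrightarrow> norm (integral {0..} (k v) - integral {0..real n} (k v)) \<le> e n"
    using tail by meson
  have "uniform_limit A (\<lambda>n w. integral {0..real n} (k w)) (\<lambda>w. integral {0..} (k w)) sequentially"
    unfolding uniform_limit_iff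
  proof (intro allI impI)
    fix \<epsilon> :: real assume "\<epsilon> > 0"
    from order_tendstoD(2)[OF A(4) this]
    show "\<forall>\<^sub>F n in sequentially. \<forall>x\<in>A. dist (integral {0..real n} (k x)) (integral {0..} (k x)) < \<epsilon>"
    proof eventually_elim
      case (elim n)
      then show ?case
        using A(5)[of _ n] by (fastforce simp: dist_norm norm_minus_commute intro: le_less_trans)
    qed
  qed
  with A show "\<exists>A. open A \<and> w \<in> A \<and> A \<subseteq> \<Omega> \<and>
      uniform_limit A (\<lambda>n w. integral {0..real n} (k w)) (\<lambda>w. integral {0..} (k w)) sequentially"
    by blast
qed

section \<open>Laplace integrals\<close>

lemma laplace_bounds:
  fixes k :: "real \<Rightarrow> complex"
  assumes cont: "continuous_on {0..} k" and bnd: "\<And>t. t \<ge> 0 \<Longrightarrow> norm (k t) \<le> C * exp (\<delta> * t)"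
    and u: "Re u > \<delta>"
  defines "l \<equiv> \<lambda>t. exp (- u * of_real t) * k t"
  shows "l integrable_on {0..}"
    and "norm (integral {0..} l) \<le> C / (Re u - \<delta>)"
    and "N \<ge> 0 \<Longrightarrow> norm (integral {0..} l - integral {0..N} l) \<le> C / (Re u - \<delta>) * exp (- (Re u - \<delta>) * N)"
    and "(\<lambda>n. integral {0..real n} l) \<longlonglongrightarrow> integral {0..} l"
proof -
  \<comment> \<open>The integral over \<open>{t..}\<close> of the majorant of
    \<open>l\<close>.\<close>
  define m where "m = (\<lambda>t. C / (Re u - \<delta>) * exp (- (Re u - \<delta>) * t))"
  have c: "continuous_on {0..} l"
    unfolding l_def by (intro continuous_intros cont)
  have d: "(m has_real_derivative - (C * exp (- (Re u - \<delta>) * x))) (at x)" for x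
  proof -
    have "(m has_real_derivative C / (Re u - \<delta>) * (exp (- (Re u - \<delta>) * x) * (- (Re u - \<delta>)))) (at x)"
      unfolding m_def by (intro derivative_eq_intros refl | simp)+
    also have "C / (Re u - \<delta>) * (exp (- (Re u - \<delta>) * x) * (- (Re u - \<delta>))) = - (C * exp (- (Re u - \<delta>) * x))"
      using u by (simp add: divide_simps) (simp add: algebra_simps)
    finally show ?thesis .
  qed
  have b: "norm (l x) \<le> C * exp (- (Re u - \<delta>) * x)" if "x \<ge> 0" for x
    using mult_left_mono[OF bnd[OF that], of "exp (- (Re u * x))"]
    by (simp add: l_def norm_mult algebra_simps flip: exp_add)
  have "((\<lambda>x. exp (- (Re u - \<delta>) * x)) \<longlongrightarrow> 0) at_top"
    using u by real_asymp
  then have lim: "(m \<longlongrightarrow> 0) at_top"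
    unfolding m_def by (rule tendsto_mult_right_zero)
  note I = improper_integral_dominated[OF c d b lim]
  show "l integrable_on {0..}"
    by (rule I(1))
  show "(\<lambda>n. integral {0..real n} l) \<longlonglongrightarrow> integral {0..} l"
    by (rule I(4))
  show "norm (integral {0..} l) \<le> C / (Re u - \<delta>)"
    using I(3) by (simp add: m_def)
  show "norm (integral {0..} l - integral {0..N} l) \<le> C / (Re u - \<delta>) * exp (- (Re u - \<delta>) * N)" if "N \<ge> 0"
    using I(2)[OF _ that] by (simp add: m_def)
qed

lemma laplace_vector_derivative:
  fixes h h' :: "real \<Rightarrow> complex"
  assumes d: "\<And>t. t \<ge> 0 \<Longrightarrow> (h has_vector_derivative h' t) (at t)"
    and cont: "continuous_on {0..} h'"
    and bnd: "\<And>t. t \<ge> 0 \<Longrightarrow> norm (h t) \<le> C * exp (\<delta> * t)"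
    and bnd': "\<And>t. t \<ge> 0 \<Longrightarrow> norm (h' t) \<le> C' * exp (\<delta> * t)"
    and u: "Re u > \<delta>"
  shows "integral {0..} (\<lambda>t. exp (- u * of_real t) * h' t)
       = u * integral {0..} (\<lambda>t. exp (- u * of_real t) * h t) - h 0"
proof -
  have ch: "continuous_on {0..} h"
    using d by (auto intro!: continuous_at_imp_continuous_on has_vector_derivative_continuous)
  let ?l = "\<lambda>h t. exp (- u * of_real t) * h t :: complex"
  have L: "(\<lambda>n. integral {0..real n} (?l h')) \<longlonglongrightarrow> integral {0..} (?l h')"
    "(\<lambda>n. integral {0..real n} (?l h)) \<longlonglongrightarrow> integral {0..} (?l h)"
    by (rule laplace_bounds(4)[OF cont bnd' u], assumption, rule laplace_bounds(4)[OF ch bnd u])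
  have parts: "integral {0..real n} (?l h') = u * integral {0..real n} (?l h) + (?l h (real n) - h 0)" for n
  proof -
    have "((\<lambda>t. ?l h' t - u * ?l h t) has_integral (?l h (real n) - ?l h 0)) {0..real n}"
    proof (rule fundamental_theorem_of_calculus)
      fix x assume x: "x \<in> {0..real n}"
      have "((\<lambda>t. exp (- u * of_real t)) has_vector_derivative exp (- u * of_real x) * (- u)) (at x within {0..real n})"
        by (rule has_vector_derivative_real_field) (auto intro!: derivative_eq_intros)
      from has_vector_derivative_mult[OF this has_vector_derivative_at_within[OF d]] x
      show "(?l h has_vector_derivative (?l h' x - u * ?l h x)) (at x within {0..real n})"
        by (simp add: algebra_simps)
    qed auto
    moreover have "?l h' integrable_on {0..real n}" "?l h integrable_on {0..real n}"
      by (intro integrable_continuous_interval continuous_intros continuous_on_subset[OF cont] continuous_on_subset[OF ch]; auto)+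
    then have "((\<lambda>t. ?l h' t - u * ?l h t) has_integral (integral {0..real n} (?l h') - u * integral {0..real n} (?l h))) {0..real n}"
      by (intro has_integral_diff has_integral_mult_right integrable_integral)
    ultimately have "?l h (real n) - ?l h 0 = integral {0..real n} (?l h') - u * integral {0..real n} (?l h)"
      by (rule has_integral_unique)
    then show ?thesis by (simp add: algebra_simps)
  qed
  have "(\<lambda>n. ?l h (real n)) \<longlonglongrightarrow> 0"
  proof (rule Lim_null_comparison)
    have "norm (?l h (real n)) \<le> C * exp (- (Re u - \<delta>) * real n)" for n
      using mult_left_mono[OF bnd[of "real n"], of "exp (- (Re u * real n))"]
      by (simp add: norm_mult algebra_simps flip: exp_add)
    then show "\<forall>\<^sub>F n in sequentially. norm (?l h (real n)) \<le> C * exp (- (Re u - \<delta>) * real n)"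
      by (intro always_eventually) blast
    have "(\<lambda>n. exp (- (Re u - \<delta>) * real n)) \<longlonglongrightarrow> 0"
      using u by real_asymp
    then show "(\<lambda>n. C * exp (- (Re u - \<delta>) * real n)) \<longlonglongrightarrow> 0"
      by (rule tendsto_mult_right_zero)
  qed
  then have "(\<lambda>n. integral {0..real n} (?l h')) \<longlonglongrightarrow> u * integral {0..} (?l h) + (0 - h 0)"
    unfolding parts by (intro tendsto_intros L)
  from LIMSEQ_unique[OF L(1) this] show ?thesis by simp
qed

text \<open>Only \<open>q\<close> is assumed bounded. Differentiability of the limit comes from
  locally uniform convergence of the truncated integrals; the derivative is identified
  afterwards.\<close>

lemma laplace_field_derivative:
  fixes q :: "real \<Rightarrow> complex \<Rightarrow> complex"
  assumes Z: "open Z" and cont: "continuous_on ({0..} \<times> Z) (\<lambda>(t, z). q t z)"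
    and hol: "\<And>t. t \<ge> 0 \<Longrightarrow> q t holomorphic_on Z"
    and bnd: "\<And>t z. t \<ge> 0 \<Longrightarrow> z \<in> Z \<Longrightarrow> norm (q t z) \<le> C * exp (\<delta> * t)"
    and u: "Re u > \<delta>" and z: "z \<in> Z"
  shows "((\<lambda>z. integral {0..} (\<lambda>t. exp (- u * of_real t) * q t z)) has_field_derivative
          integral {0..} (\<lambda>t. exp (- u * of_real t) * deriv (q t) z)) (at z)"
proof -
  let ?I = "\<lambda>N z. integral {0..N} (\<lambda>t. exp (- u * of_real t) * q t z)"
  let ?J = "\<lambda>N z. integral {0..N} (\<lambda>t. exp (- u * of_real t) * deriv (q t) z)"
  have cz: "continuous_on {0..} (\<lambda>t. q t z)" if "z \<in> Z" for z
    by (rule continuous_on_compose2[OF cont, where f="\<lambda>t. (t, z)", unfolded split_beta fst_conv snd_conv])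
       (use that in \<open>auto intro!: continuous_intros\<close>)
  have fin: "(?I (real n) has_field_derivative ?J (real n) z) (at z)" if z: "z \<in> Z" for n z
  proof -
    have "(?I (real n) has_field_derivative
        integral {0..real n} (\<lambda>t. deriv (\<lambda>z. exp (- u * of_real t) * q t z) z)) (at z)"
    proof (rule has_field_derivative_param_integral[OF Z])
      have "continuous_on (Z \<times> {0..real n}) (\<lambda>p. q (snd p) (fst p))"
        by (rule continuous_on_compose2[OF cont, where f="\<lambda>q. (snd q, fst q)", unfolded split_beta fst_conv snd_conv])
          (auto intro!: continuous_intros)
      then show "continuous_on (Z \<times> {0..real n}) (\<lambda>(z, t). exp (- u * of_real t) * q t z)"
        unfolding split_beta by (intro continuous_intros)
      show "(\<lambda>z. exp (- u * of_real t) * q t z) holomorphic_on Z" if "t \<in> {0..real n}" for t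
        using that by (intro holomorphic_intros hol) auto
    qed fact
    also have "integral {0..real n} (\<lambda>t. deriv (\<lambda>z. exp (- u * of_real t) * q t z) z) = ?J (real n) z"
    proof (rule integral_cong)
      fix t assume t: "t \<in> {0..real n}"
      have "q t field_differentiable at z"
        using hol[of t] t z Z holomorphic_on_imp_differentiable_at by auto
      then show "deriv (\<lambda>z. exp (- u * of_real t) * q t z) z = exp (- u * of_real t) * deriv (q t) z"
        by (rule deriv_cmult)
    qed
    finally show ?thesis .
  qed
  have "\<exists>g'. \<forall>x\<in>Z. ((\<lambda>z. integral {0..} (\<lambda>t. exp (- u * of_real t) * q t z)) has_field_derivative g' x) (at x)
      \<and> ((\<lambda>n. ?J (real n) x) \<longlongrightarrow> g' x) sequentially"
  proof (rule has_complex_derivative_uniform_sequence[OF Z fin])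
    fix x assume "x \<in> Z"
    then obtain d where d: "d > 0" "cball x d \<subseteq> Z" using Z open_contains_cball by blast
    have "uniform_limit (cball x d) (\<lambda>n. ?I (real n)) (\<lambda>z. integral {0..} (\<lambda>t. exp (- u * of_real t) * q t z)) sequentially"
      unfolding uniform_limit_iff
    proof (intro allI impI)
      fix \<epsilon> :: real assume e: "\<epsilon> > 0"
      have "(\<lambda>n. exp (- (Re u - \<delta>) * real n)) \<longlonglongrightarrow> 0"
        using u by real_asymp
      from tendsto_mult_right_zero[OF this, of "C / (Re u - \<delta>)"]
      have "\<forall>\<^sub>F n in sequentially. C / (Re u - \<delta>) * exp (- (Re u - \<delta>) * real n) < \<epsilon>"
        using e by (rule order_tendstoD(2))
      then show "\<forall>\<^sub>F n in sequentially. \<forall>x\<in>cball x d. dist (?I (real n) x) (integral {0..} (\<lambda>t. exp (- u * of_real t) * q t x)) < \<epsilon>"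
      proof eventually_elim
        case (elim n)
        show ?case
        proof
          fix y assume "y \<in> cball x d"
          then have y: "y \<in> Z" using d by auto
          from laplace_bounds(3)[OF cz[OF y] bnd[OF _ y] u, of "real n"] elim
          show "dist (?I (real n) y) (integral {0..} (\<lambda>t. exp (- u * of_real t) * q t y)) < \<epsilon>"
            by (simp add: dist_norm norm_minus_commute)
        qed
      qed
    qed
    with d show "\<exists>d>0. cball x d \<subseteq> Z \<and> uniform_limit (cball x d) (\<lambda>n. ?I (real n)) (\<lambda>z. integral {0..} (\<lambda>t. exp (- u * of_real t) * q t z)) sequentially"
      by blast
  qed
  then obtain g' where g': "((\<lambda>z. integral {0..} (\<lambda>t. exp (- u * of_real t) * q t z)) has_field_derivative g') (at z)"
    "(\<lambda>n. ?J (real n) z) \<longlonglongrightarrow> g'"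
    using z by blast
  obtain r where r: "r > 0" "cball z r \<subseteq> Z" using Z z open_contains_cball by blast
  \<comment> \<open>Cauchy's inequality on a fixed disc gives the \<open>z\<close>-derivative the
    same exponential rate as \<open>q\<close>, so its truncated Laplace integrals converge to the
    full one.\<close>
  have "(\<lambda>n. ?J (real n) z) \<longlonglongrightarrow> integral {0..} (\<lambda>t. exp (- u * of_real t) * deriv (q t) z)"
  proof (rule laplace_bounds(4)[OF _ _ u])
    have "continuous_on ({0..} \<times> Z) (\<lambda>(t, z). (deriv ^^ 1) (q t) z)"
      using hol by (intro continuous_on_higher_deriv_param[OF Z cont]) auto
    then have c: "continuous_on ({0..} \<times> Z) (\<lambda>(t, z). deriv (q t) z)" by simp
    show "continuous_on {0..} (\<lambda>t. deriv (q t) z)"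
      by (rule continuous_on_compose2[OF c, where f="\<lambda>t. (t, z)", unfolded split_beta fst_conv snd_conv])
       (use z in \<open>auto intro!: continuous_intros\<close>)
    show "norm (deriv (q t) z) \<le> C / r * exp (\<delta> * t)" if "t \<ge> 0" for t
    proof -
      have "norm ((deriv ^^ 1) (q t) z) \<le> fact 1 * (C * exp (\<delta> * t)) / r ^ 1"
      proof (rule Cauchy_inequality)
        show "q t holomorphic_on ball z r" "continuous_on (cball z r) (q t)"
          using holomorphic_on_subset[OF hol[OF that] r(2)] ball_subset_cball[of z r]
          by (auto intro: holomorphic_on_imp_continuous_on holomorphic_on_subset)
        show "norm (q t x) \<le> C * exp (\<delta> * t)" if "norm (z - x) = r" for x
          using that \<open>t \<ge> 0\<close> r by (intro bnd) (auto simp: dist_norm)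
      qed (use r in auto)
      then show ?thesis by simp
    qed
  qed
  from LIMSEQ_unique[OF g'(2) this] g'(1) show ?thesis by simp
qed

text \<open>Cauchy's inequality on discs of fixed radius about the points of the half-line gives
  every derivative the growth rate of \<open>h\<close>; then \<open>N\<close> integrations by parts,
  whose boundary terms are the Taylor data at \<open>0\<close>. The error constant sees
  \<open>h\<close> only through \<open>K\<close>, hence its later uniformity in \<xi>.\<close>

lemma watson:
  fixes h :: "complex \<Rightarrow> complex"
  assumes T: "open T" and hol: "h holomorphic_on T" and r: "r > 0"
    and sub: "\<And>x. x \<ge> 0 \<Longrightarrow> cball (of_real x) r \<subseteq> T"
    and bnd: "\<And>t. t \<in> T \<Longrightarrow> norm (h t) \<le> K * exp (\<sigma> * Re t)" and \<sigma>: "\<sigma> > 0"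
    and u: "Re u > \<sigma>"
  shows "norm (integral {0..} (\<lambda>t. exp (- u * of_real t) * h (of_real t))
      - (\<Sum>n<N. (deriv ^^ n) h 0 / u ^ (n + 1))) \<le> fact N * K * exp (\<sigma> * r) / r ^ N / (Re u - \<sigma>) / norm u ^ N"
proof -
  let ?L = "\<lambda>n. integral {0..} (\<lambda>t. exp (- u * of_real t) * (deriv ^^ n) h (of_real t))"
  have u0: "u \<noteq> 0" using u \<sigma> by auto
  have inT: "of_real x \<in> T" if "x \<ge> 0" for x using sub[OF that] r by auto
  have holn: "(deriv ^^ n) h holomorphic_on T" for n
    by (intro holomorphic_higher_deriv hol T)
  have contn: "continuous_on {0..} (\<lambda>t::real. (deriv ^^ n) h (of_real t))" for n
    by (rule continuous_on_compose2[OF holomorphic_on_imp_continuous_on[OF holn]])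
      (use inT in \<open>auto intro!: continuous_intros\<close>)
  have K: "K \<ge> 0"
    using order_trans[OF norm_ge_zero bnd[OF inT[of 0]]] by simp
  have bndn: "norm ((deriv ^^ n) h (of_real t)) \<le> fact n * K * exp (\<sigma> * r) / r ^ n * exp (\<sigma> * t)"
    if t: "t \<ge> 0" for n t
  proof -
    have "norm ((deriv ^^ n) h (of_real t)) \<le> fact n * (K * exp (\<sigma> * (t + r))) / r ^ n"
    proof (rule Cauchy_inequality)
      show "h holomorphic_on ball (of_real t) r" "continuous_on (cball (of_real t) r) h"
        using holomorphic_on_subset[OF hol sub[OF t]] ball_subset_cball[of "of_real t" r]
        by (auto intro: holomorphic_on_imp_continuous_on holomorphic_on_subset)
      fix x :: complex assume x: "norm (of_real t - x) = r"
      then have "x \<in> T" using sub[OF t] by (auto simp: dist_norm)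
      then have "norm (h x) \<le> K * exp (\<sigma> * Re x)" by (rule bnd)
      also have "Re x \<le> t + r"
        using abs_Re_le_cmod[of "of_real t - x"] x by simp
      finally show "norm (h x) \<le> K * exp (\<sigma> * (t + r))"
        using K \<sigma> by (simp add: mult_left_mono)
    qed (use r in auto)
    then show ?thesis by (simp add: algebra_simps exp_add)
  qed
  have step: "?L n = (deriv ^^ n) h 0 / u + ?L (Suc n) / u" for n
  proof -
    have "?L (Suc n) = u * ?L n - (deriv ^^ n) h (of_real 0)"
    proof (rule laplace_vector_derivative[OF _ contn bndn bndn u])
      fix t :: real assume t: "t \<ge> 0"
      have "((deriv ^^ n) h has_field_derivative deriv ((deriv ^^ n) h) (of_real t)) (at (of_real t))"
        using holn T inT[OF t] by (rule holomorphic_derivI)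
      then show "((\<lambda>t. (deriv ^^ n) h (of_real t)) has_vector_derivative (deriv ^^ Suc n) h (of_real t)) (at t)"
        by (intro has_vector_derivative_real_field) simp
    qed
    then show ?thesis using u0 by (simp add: field_simps)
  qed
  have "?L 0 = (\<Sum>n<N. (deriv ^^ n) h 0 / u ^ (n + 1)) + ?L N / u ^ N"
  proof (induction N)
    case (Suc N)
    then show ?case using step[of N] u0 by (simp add: field_simps)
  qed simp
  then have "norm (integral {0..} (\<lambda>t. exp (- u * of_real t) * h (of_real t))
      - (\<Sum>n<N. (deriv ^^ n) h 0 / u ^ (n + 1))) = norm (?L N) / norm u ^ N"
    by (simp add: norm_divide norm_power)
  also have "norm (?L N) \<le> fact N * K * exp (\<sigma> * r) / r ^ N / (Re u - \<sigma>)"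
    by (rule laplace_bounds(2)[OF contn bndn u])
  finally show ?thesis
    by (simp add: divide_right_mono)
qed

text \<open>Moving the starting point of a tail integral changes it by an integral over a bounded
  interval, which can be differentiated in \<open>h\<close>.\<close>

lemma improper_integral_shift:
  fixes k :: "real \<Rightarrow> complex" and m m' :: "real \<Rightarrow> real"
  assumes cont: "continuous_on {0..} k"
    and m: "\<And>x. x \<ge> 0 \<Longrightarrow> (m has_real_derivative - m' x) (at x)"
    and bnd: "\<And>x. x \<ge> 0 \<Longrightarrow> norm (k x) \<le> m' x"
    and lim: "(m \<longlongrightarrow> 0) at_top" and h: "h \<ge> 0"
  shows "integral {0..} (\<lambda>x. k (h + x)) = integral {0..} k - integral {0..h} k"
proof -
  have c: "continuous_on {0..} (\<lambda>x. k (h + x))"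
    by (rule continuous_on_compose2[OF cont]) (use h in \<open>auto intro!: continuous_intros\<close>)
  have d: "((\<lambda>x. m (h + x)) has_real_derivative - m' (h + x)) (at x)" if "x \<ge> 0" for x
    using DERIV_shift[of m "- m' (h + x)" x h] m[of "h + x"] h that by (simp add: add.commute)
  have b: "norm (k (h + x)) \<le> m' (h + x)" if "x \<ge> 0" for x
    using bnd h that by simp
  have l: "((\<lambda>x. m (h + x)) \<longlongrightarrow> 0) at_top"
    by (rule filterlim_compose[OF lim]) real_asymp
  have L1: "(\<lambda>n. integral {0..real n} (\<lambda>x. k (h + x))) \<longlonglongrightarrow> integral {0..} (\<lambda>x. k (h + x))"
    by (rule improper_integral_dominated(4)[OF c d b l])
  have kint: "k integrable_on {a..b}" if "0 \<le> a" for a b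
    using continuous_on_subset[OF cont] that by (intro integrable_continuous_interval) auto
  have eq: "integral {0..real n} (\<lambda>x. k (h + x)) = integral {0..h + real n} k - integral {0..h} k" for n
  proof -
    have "integral {0..real n} (k \<circ> (\<lambda>x. x + h)) = integral {0 + h..real n + h} k"
      using h by (intro integral_shift continuous_on_subset[OF cont]) auto
    then have "integral {0..real n} (\<lambda>x. k (h + x)) = integral {h..h + real n} k"
      by (simp add: o_def add.commute)
    moreover have "integral {0..h} k + integral {h..h + real n} k = integral {0..h + real n} k"
      using h kint by (intro Henstock_Kurzweil_Integration.integral_combine) auto
    ultimately show ?thesis by (simp add: algebra_simps)
  qed
  \<comment> \<open>The endpoints \<open>h + real n\<close> need not be naturals, so the tail bound
    replaces the limit along the naturals.\<close>
  have "(\<lambda>n. integral {0..h + real n} k - integral {0..} k) \<longlonglongrightarrow> 0"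
  proof (rule Lim_null_comparison)
    show "\<forall>\<^sub>F n in sequentially. norm (integral {0..h + real n} k - integral {0..} k) \<le> m (h + real n)"
      using improper_integral_dominated(2)[OF cont m bnd lim] h
      by (intro always_eventually allI) (simp add: norm_minus_commute)
    show "(\<lambda>n. m (h + real n)) \<longlonglongrightarrow> 0"
      by (rule filterlim_compose[OF lim]) real_asymp
  qed
  then have "(\<lambda>n. integral {0..h + real n} k) \<longlonglongrightarrow> integral {0..} k"
    by (rule LIM_zero_cancel)
  then have "(\<lambda>n. integral {0..real n} (\<lambda>x. k (h + x))) \<longlonglongrightarrow> integral {0..} k - integral {0..h} k"
    unfolding eq by (intro tendsto_intros)
  from LIMSEQ_unique[OF L1 this] show ?thesis .
qed

text \<open>The chain rule in the characteristic direction \<open>(1, -1)\<close>.\<close>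

lemma hol2_antidiagonal_derivative:
  assumes "hol2 S \<Omega>" "(a, w - a) \<in> \<Omega>"
  shows "((\<lambda>t. S (t, w - t)) has_field_derivative
           (deriv (\<lambda>t. S (t, w - a)) a - deriv (\<lambda>z. S (a, z)) (w - a))) (at a)"
proof -
  obtain p q where S: "(S has_derivative (\<lambda>v. p * fst v + q * snd v)) (at (a, w - a))"
    using assms unfolding hol2_def by meson
  have "((\<lambda>t. (t, w - a)) has_derivative (\<lambda>h. (h, 0))) (at a)"
    by (auto intro!: derivative_eq_intros)
  from has_derivative_compose[OF this S]
  have "((\<lambda>t. S (t, w - a)) has_field_derivative p) (at a)"
    by (simp add: has_field_derivative_def)
  then have p: "deriv (\<lambda>t. S (t, w - a)) a = p" by (rule DERIV_imp_deriv)
  have "((\<lambda>z. (a, z)) has_derivative (\<lambda>h. (0, h))) (at (w - a))"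
    by (auto intro!: derivative_eq_intros)
  from has_derivative_compose[OF this S]
  have "((\<lambda>z. S (a, z)) has_field_derivative q) (at (w - a))"
    by (simp add: has_field_derivative_def)
  then have q: "deriv (\<lambda>z. S (a, z)) (w - a) = q" by (rule DERIV_imp_deriv)
  have "((\<lambda>t. (t, w - t)) has_derivative (\<lambda>h. (h, - h))) (at a)"
    by (auto intro!: derivative_eq_intros)
  from has_derivative_compose[OF this S]
  have "((\<lambda>t. S (t, w - t)) has_derivative (\<lambda>h. p * h + q * (- h))) (at a)"
    by simp
  also have "(\<lambda>h. p * h + q * (- h)) = (*) (p - q)"
    by (auto simp: algebra_simps)
  finally show ?thesis
    by (simp add: has_field_derivative_def p q)
qed

lemma convex_segment_mem:
  fixes K :: "complex set"
  assumes "convex K" "z \<in> K" "z + y \<in> K" "0 \<le> t" "t \<le> 1"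
  shows "z + of_real t * y \<in> K"
proof -
  have "(1 - t) *\<^sub>R z + t *\<^sub>R (z + y) \<in> K"
    using assms by (auto simp: convex_def)
  then show ?thesis by (simp add: algebra_simps scaleR_conv_of_real)
qed

section \<open>Picard iteration for the Borel transform in a half-strip\<close>

text \<open>
  In the pairs below the first component is \<open>\<tau> = t/2\<close> and the second the coordinate \<open>z = q \<xi>\<close>.
  On a line \<open>z + \<tau> = const\<close> the equation for the Borel transform \<open>f\<close> is a linear first-order equation for
  \<open>f\<^sub>z\<close>; \<open>kern\<close> is its integrating factor times \<open>g\<close>, and \<open>slope n\<close> is the \<open>z\<close>-derivative of the \<open>n\<close>-th
  Picard correction, which \<open>tail_integral\<close> recovers as the antiderivative vanishing at \<open>z = +\<infinity>\<close>.
\<close>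

definition kern :: "(complex \<Rightarrow> complex) \<Rightarrow> (complex \<Rightarrow> complex) \<Rightarrow> complex \<Rightarrow> complex \<Rightarrow> complex" where
  "kern \<phi> g y z = exp (- (y * integral {0..1} (\<lambda>t. \<phi> (z + of_real t * y)))) * g (z + y)"

text \<open>The Duhamel integral over the characteristic segment from (\<tau>, \<open>z\<close>) to
  (\<open>0\<close>, \<open>z + \<tau>\<close>). Scaling it to \<open>{0..1}\<close> allows complex
  \<tau> and puts the dependence on \<tau> under the integral sign.\<close>

definition volterra :: "(complex \<Rightarrow> complex) \<Rightarrow> (complex \<Rightarrow> complex) \<Rightarrow> (complex \<times> complex \<Rightarrow> complex)
    \<Rightarrow> complex \<times> complex \<Rightarrow> complex" where
  "volterra \<phi> g f w = fst w * integral {0..1} (\<lambda>\<theta>. kern \<phi> g (of_real \<theta> * fst w) (snd w)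
     * f (of_real (1 - \<theta>) * fst w, snd w + of_real \<theta> * fst w))"

definition tail_integral :: "(complex \<times> complex \<Rightarrow> complex) \<Rightarrow> complex \<times> complex \<Rightarrow> complex" where
  "tail_integral S w = - integral {0..} (\<lambda>x. S (fst w, snd w + of_real x))"

text \<open>The factor \<open>1/2\<close> encodes the initial value \<open>g/2\<close> at \<tau> =
  0; doubled by the \<open>2 u\<close> of the transformed equation, it becomes the inhomogeneous
  term \<open>- g\<close>.\<close>

primrec slope :: "(complex \<Rightarrow> complex) \<Rightarrow> (complex \<Rightarrow> complex) \<Rightarrow> nat \<Rightarrow> complex \<times> complex \<Rightarrow> complex" where
  "slope \<phi> g 0 = (\<lambda>w. (1/2) * kern \<phi> g (fst w) (snd w))"
| "slope \<phi> g (Suc n) = volterra \<phi> g (tail_integral (slope \<phi> g n))"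

definition borel_sum :: "(complex \<Rightarrow> complex) \<Rightarrow> (complex \<Rightarrow> complex) \<Rightarrow> complex \<times> complex \<Rightarrow> complex" where
  "borel_sum \<phi> g w = (\<Sum>n. tail_integral (slope \<phi> g n) w)"

text \<open>The right-hand side of the integrated equation, not the sum of the slopes: the
  differential equation can then be read off directly, and \<open>borel_sum_derivative\<close>
  closes the fixed point.\<close>

definition borel_slope :: "(complex \<Rightarrow> complex) \<Rightarrow> (complex \<Rightarrow> complex) \<Rightarrow> complex \<times> complex \<Rightarrow> complex" where
  "borel_slope \<phi> g w = (1/2) * kern \<phi> g (fst w) (snd w) + volterra \<phi> g (borel_sum \<phi> g) w"

text \<open>
  The slack \<open>b\<close> in \<open>g_bound\<close> absorbs the shift of \<open>z\<close> by at most \<open>R\<close> to the left that occurs when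
  \<open>Re \<tau> < 0\<close>. The bound on \<open>\<phi>\<close> is not integrable; splitting it into \<open>\<sigma>\<close> and an integrable part is
  what makes the integrating factor grow more slowly than every exponential.
\<close>

locale right_strip =
  fixes D :: "complex set" and \<phi> g :: "complex \<Rightarrow> complex"
    and \<gamma> G \<kappa> :: "real \<Rightarrow> real" and R M W :: real
  assumes open_D: "open D" and convex_D: "convex D"
    and right_D: "\<And>z x. z \<in> D \<Longrightarrow> x \<ge> 0 \<Longrightarrow> z + of_real x \<in> D"
    and width_D: "\<And>z z'. z \<in> D \<Longrightarrow> z' \<in> D \<Longrightarrow> \<bar>Im z - Im z'\<bar> \<le> W"
    and hol_\<phi>: "\<phi> holomorphic_on D" and hol_g: "g holomorphic_on D"
    and G_deriv: "\<And>x. (G has_real_derivative - \<gamma> x) (at x)"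
    and \<gamma>_cont: "continuous_on UNIV \<gamma>" and \<gamma>_nonneg: "\<And>x. \<gamma> x \<ge> 0" and \<gamma>_le: "\<And>x. \<gamma> x \<le> M"
    and G_lim: "(G \<longlongrightarrow> 0) at_top" and G_le: "\<And>x. G x \<le> M"
    and R_pos: "R > 0"
    and g_bound: "\<And>z b. z \<in> D \<Longrightarrow> 0 \<le> b \<Longrightarrow> b \<le> R \<Longrightarrow> norm (g z) \<le> \<gamma> (Re z - b)"
    and \<phi>_bound: "\<And>z \<sigma>. z \<in> D \<Longrightarrow> \<sigma> > 0 \<Longrightarrow> norm (\<phi> z) \<le> \<sigma> + \<kappa> \<sigma> * \<gamma> (Re z)"
    and \<kappa>_nonneg: "\<And>\<sigma>. \<kappa> \<sigma> \<ge> 0"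
begin

section \<open>The strip geometry and the kernel\<close>

text \<open>The part of the integrating factor not growing with \<tau>: \<open>W * M\<close> comes
  from imaginary displacement, the other \<open>M\<close> from the integral of \<gamma> along real
  displacement.\<close>

definition B :: "real \<Rightarrow> real" where "B \<sigma> = exp (\<kappa> \<sigma> * (W * M + M))"

text \<open>Both ends of the characteristic segment lie in \<open>D\<close>, hence by convexity all
  of it; the condition on the real part keeps leftward shifts within the slack of
  \<open>g_bound\<close>.\<close>

definition \<Omega> :: "(complex \<times> complex) set" where
  "\<Omega> = {w. snd w \<in> D \<and> snd w + fst w \<in> D \<and> Re (fst w) > - R}"

text \<open>The least real part on the segment from \<open>z\<close> to \<open>z + \<tau>\<close>,
  the worst argument for the decreasing \<open>G\<close>.\<close>

definition m :: "complex \<times> complex \<Rightarrow> real" where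
  "m w = Re (snd w) + min 0 (Re (fst w))"

lemma B_pos: "B \<sigma> > 0" by (simp add: B_def)

lemma G_antimono: "x \<le> y \<Longrightarrow> G y \<le> G x"
  using DERIV_nonpos_imp_nonincreasing[of x y G] G_deriv \<gamma>_nonneg
  by (metis neg_le_0_iff_le)

lemma G_nonneg: "G x \<ge> 0"
proof (rule tendsto_upperbound[OF G_lim])
  show "\<forall>\<^sub>F y in at_top. G y \<le> G x"
    using eventually_ge_at_top[of x] by eventually_elim (rule G_antimono)
qed simp

lemma M_nonneg: "M \<ge> 0"
  using G_nonneg G_le order_trans by blast

lemmas seg_D = convex_segment_mem[OF convex_D]

lemma \<Omega>_iff: "(\<tau>, z) \<in> \<Omega> \<longleftrightarrow> z \<in> D \<and> z + \<tau> \<in> D \<and> Re \<tau> > - R"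
  by (simp add: \<Omega>_def)

lemma open_\<Omega>: "open \<Omega>"
proof -
  have "open ((snd -` D) \<inter> ((\<lambda>w. snd w + fst w) -` D) \<inter> {w :: complex \<times> complex. Re (fst w) > - R})"
    by (intro open_Int open_vimage open_Collect_less continuous_intros open_D)
  also have "\<dots> = \<Omega>" by (auto simp: \<Omega>_def)
  finally show ?thesis .
qed

text \<open>The sum of the two components is constant along a characteristic, so only the new base
  point has to be placed in \<open>D\<close>.\<close>

lemma \<Omega>_segment:
  assumes "w \<in> \<Omega>" "0 \<le> \<theta>" "\<theta> \<le> 1"
  shows "(of_real (1 - \<theta>) * fst w, snd w + of_real \<theta> * fst w) \<in> \<Omega>"
    and "snd w + of_real \<theta> * fst w \<in> D"
proof -
  show 1: "snd w + of_real \<theta> * fst w \<in> D"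
    using assms by (intro seg_D) (auto simp: \<Omega>_def)
  have "(1 - \<theta>) * Re (fst w) > - R"
  proof (cases "Re (fst w) \<ge> 0")
    case True
    then show ?thesis using R_pos assms by (smt (verit) mult_nonneg_nonneg)
  next
    case False
    then have "(1 - \<theta>) * Re (fst w) \<ge> Re (fst w)"
      using assms by (simp add: algebra_simps mult_nonneg_nonpos)
    then show ?thesis using assms by (simp add: \<Omega>_def)
  qed
  then show "(of_real (1 - \<theta>) * fst w, snd w + of_real \<theta> * fst w) \<in> \<Omega>"
    using 1 assms by (simp add: \<Omega>_iff algebra_simps) (simp add: \<Omega>_def add.commute)
qed

lemma \<Omega>_right: "w \<in> \<Omega> \<Longrightarrow> x \<ge> 0 \<Longrightarrow> (fst w, snd w + of_real x) \<in> \<Omega>"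
  using right_D[of "snd w" x] right_D[of "snd w + fst w" x] by (simp add: \<Omega>_def add_ac)

text \<open>On the convex \<open>D\<close> a primitive of \<phi> turns the integrating factor into a
  quotient of values of one function, which makes \<open>kern\<close> visibly holomorphic and splits
  off its dependence on \<open>z\<close>.\<close>

lemma primitive:
  obtains \<Phi> where "\<And>z. z \<in> D \<Longrightarrow> (\<Phi> has_field_derivative \<phi> z) (at z)" "\<Phi> holomorphic_on D"
    "\<And>y z. z \<in> D \<Longrightarrow> z + y \<in> D \<Longrightarrow> kern \<phi> g y z = exp (\<Phi> z - \<Phi> (z + y)) * g (z + y)"
proof -
  obtain \<Phi> where \<Phi>': "\<And>z. z \<in> D \<Longrightarrow> (\<Phi> has_field_derivative \<phi> z) (at z within D)"
    using holomorphic_convex_primitive'[OF convex_D open_D hol_\<phi>] by blast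
  then have \<Phi>: "\<And>z. z \<in> D \<Longrightarrow> (\<Phi> has_field_derivative \<phi> z) (at z)"
    using at_within_open[OF _ open_D] by simp
  have "kern \<phi> g y z = exp (\<Phi> z - \<Phi> (z + y)) * g (z + y)" if D: "z \<in> D" "z + y \<in> D" for y z
  proof -
    have "((\<lambda>t. y * \<phi> (z + of_real t * y)) has_integral (\<Phi> (z + of_real 1 * y) - \<Phi> (z + of_real 0 * y))) {0..1}"
    proof (rule fundamental_theorem_of_calculus)
      fix t :: real assume t: "t \<in> {0..1}"
      have "((\<lambda>s. \<Phi> (z + s * y)) has_field_derivative \<phi> (z + of_real t * y) * y) (at (of_real t))"
        by (rule DERIV_chain2[OF \<Phi>]) (use t D in \<open>auto intro!: derivative_eq_intros seg_D\<close>)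
      then show "((\<lambda>t. \<Phi> (z + of_real t * y)) has_vector_derivative y * \<phi> (z + of_real t * y)) (at t within {0..1})"
        using has_vector_derivative_real_field[of "\<lambda>s. \<Phi> (z + s * y)"] by (simp add: mult.commute)
    qed auto
    from integral_unique[OF this]
    have "y * integral {0..1} (\<lambda>t. \<phi> (z + of_real t * y)) = \<Phi> (z + y) - \<Phi> z"
      by simp
    then show ?thesis by (simp add: kern_def)
  qed
  moreover have "\<Phi> holomorphic_on D"
    using \<Phi>' by (auto simp: holomorphic_on_def field_differentiable_def)
  ultimately show ?thesis using that \<Phi> by blast
qed

lemma kern_hol2: "hol2 (\<lambda>w. kern \<phi> g (fst w) (snd w)) {w. snd w \<in> D \<and> snd w + fst w \<in> D}"
proof -
  obtain \<Phi> where \<Phi>: "\<Phi> holomorphic_on D"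
    "\<And>y z. z \<in> D \<Longrightarrow> z + y \<in> D \<Longrightarrow> kern \<phi> g y z = exp (\<Phi> z - \<Phi> (z + y)) * g (z + y)"
    using primitive by metis
  let ?U = "{w. snd w \<in> D \<and> snd w + fst w \<in> D}"
  have oU: "open ?U"
  proof -
    have "open ((snd -` D) \<inter> ((\<lambda>w :: complex \<times> complex. snd w + fst w) -` D))"
      by (intro open_Int open_vimage continuous_intros open_D)
    then show ?thesis by (simp add: vimage_def Collect_conj_eq)
  qed
  have h: "hol2 (\<lambda>w. exp (\<Phi> (snd w) - \<Phi> (snd w + fst w)) * g (snd w + fst w)) ?U"
    by (intro hol2_mult hol2_compose_holomorphic[OF holomorphic_on_exp open_UNIV] hol2_diff
        hol2_compose_holomorphic[OF \<Phi>(1) open_D] hol2_compose_holomorphic[OF hol_g open_D]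
        hol2_add hol2_fst hol2_snd) auto
  show ?thesis unfolding hol2_def
  proof
    fix x assume x: "x \<in> ?U"
    then obtain a b where "((\<lambda>w. exp (\<Phi> (snd w) - \<Phi> (snd w + fst w)) * g (snd w + fst w)) has_derivative (\<lambda>v. a * fst v + b * snd v)) (at x)"
      using h unfolding hol2_def by meson
    then have "((\<lambda>w. kern \<phi> g (fst w) (snd w)) has_derivative (\<lambda>v. a * fst v + b * snd v)) (at x)"
      by (rule has_derivative_transform_within_open[OF _ oU x]) (use \<Phi>(2) in auto)
    then show "\<exists>a b. ((\<lambda>w. kern \<phi> g (fst w) (snd w)) has_derivative (\<lambda>v. a * fst v + b * snd v)) (at x)"
      by blast
  qed
qed

text \<open>In the bound for \<phi> the \<sigma>-part yields the exponential. The \<gamma>-part is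
  integrated along the segment and stays bounded however long the segment is.\<close>

lemma kern_bound:
  assumes "z \<in> D" "z + y \<in> D" "\<sigma> > 0" "0 \<le> b" "b \<le> R"
  shows "norm (kern \<phi> g y z) \<le> B \<sigma> * exp (\<sigma> * norm y) * \<gamma> (Re z + Re y - b)"
proof -
  have cont: "continuous_on {0..1} (\<lambda>t. \<phi> (z + of_real t * y))"
    by (rule continuous_on_compose2[OF holomorphic_on_imp_continuous_on[OF hol_\<phi>]])
      (use assms in \<open>auto intro!: continuous_intros seg_D\<close>)
  have Iy: "\<bar>Im y\<bar> \<le> W" using width_D[OF assms(2,1)] by simp
  have cg: "continuous_on {0..1} (\<lambda>t. \<gamma> (Re z + t * Re y))"
    by (intro continuous_on_compose2[OF \<gamma>_cont] continuous_intros) auto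
  have I: "((\<lambda>t. \<gamma> (Re z + t * Re y) * Re y) has_integral (- G (Re z + 1 * Re y) - - G (Re z + 0 * Re y))) {0..1}"
  proof (rule fundamental_theorem_of_calculus)
    fix t :: real
    have "((\<lambda>t. - G (Re z + t * Re y)) has_real_derivative - (- \<gamma> (Re z + t * Re y) * Re y)) (at t)"
      by (rule DERIV_minus, rule DERIV_chain2[OF G_deriv]) (auto intro!: derivative_eq_intros)
    then show "((\<lambda>t. - G (Re z + t * Re y)) has_vector_derivative \<gamma> (Re z + t * Re y) * Re y) (at t within {0..1})"
      by (auto simp: has_real_derivative_iff_has_vector_derivative intro: has_vector_derivative_at_within)
  qed auto
  have I2: "integral {0..1} (\<lambda>t. \<gamma> (Re z + t * Re y) * \<bar>Re y\<bar>) \<le> M"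
  proof -
    have "integral {0..1} (\<lambda>t. \<gamma> (Re z + t * Re y) * \<bar>Re y\<bar>)
        = integral {0..1} (\<lambda>t. sgn (Re y) * (\<gamma> (Re z + t * Re y) * Re y))"
      by (intro integral_cong) (auto simp: sgn_if)
    also have "\<dots> = sgn (Re y) * integral {0..1} (\<lambda>t. \<gamma> (Re z + t * Re y) * Re y)"
      by (rule integral_mult_right)
    also have "\<dots> = sgn (Re y) * (G (Re z) - G (Re z + Re y))"
      unfolding integral_unique[OF I] by simp
    also have "\<dots> \<le> M"
      using G_nonneg[of "Re z"] G_nonneg[of "Re z + Re y"] G_le[of "Re z"] G_le[of "Re z + Re y"] M_nonneg
      by (auto simp: sgn_if)
    finally show ?thesis .
  qed
  have "norm (y * integral {0..1} (\<lambda>t. \<phi> (z + of_real t * y)))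
      = norm (integral {0..1} (\<lambda>t. y * \<phi> (z + of_real t * y)))" by simp
  also have "\<dots> \<le> integral {0..1} (\<lambda>t. \<sigma> * norm y + \<kappa> \<sigma> * (\<bar>Im y\<bar> * M + \<gamma> (Re z + t * Re y) * \<bar>Re y\<bar>))"
  proof (rule integral_norm_bound_integral)
    fix t :: real assume t: "t \<in> {0..1}"
    have "norm (y * \<phi> (z + of_real t * y)) \<le> norm y * (\<sigma> + \<kappa> \<sigma> * \<gamma> (Re (z + of_real t * y)))"
      unfolding norm_mult using t assms by (intro mult_left_mono \<phi>_bound seg_D) auto
    also have "\<dots> = \<sigma> * norm y + \<kappa> \<sigma> * (\<gamma> (Re z + t * Re y) * norm y)"
      by (simp add: algebra_simps)
    \<comment> \<open>Against \<open>Re y\<close> the weight integrates exactly to a difference of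
      values of \<open>G\<close>; against \<open>Im y\<close> only \<open>\<gamma> \<le> M\<close>
      is available, but that displacement is at most \<open>W\<close>.\<close>
    also have "\<gamma> (Re z + t * Re y) * norm y \<le> \<gamma> (Re z + t * Re y) * (\<bar>Im y\<bar> + \<bar>Re y\<bar>)"
      using cmod_le[of y] \<gamma>_nonneg by (intro mult_left_mono) auto
    also have "\<dots> \<le> \<bar>Im y\<bar> * M + \<gamma> (Re z + t * Re y) * \<bar>Re y\<bar>"
      using mult_left_mono[OF \<gamma>_le[of "Re z + t * Re y"], of "\<bar>Im y\<bar>"] by (simp add: algebra_simps)
    finally show "norm (y * \<phi> (z + of_real t * y)) \<le> \<sigma> * norm y + \<kappa> \<sigma> * (\<bar>Im y\<bar> * M + \<gamma> (Re z + t * Re y) * \<bar>Re y\<bar>)"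
      using \<kappa>_nonneg[of \<sigma>] by (simp add: mult_left_mono)
  qed (intro integrable_continuous_interval continuous_intros cont cg)+
  also have "\<dots> = \<sigma> * norm y + \<kappa> \<sigma> * (\<bar>Im y\<bar> * M + integral {0..1} (\<lambda>t. \<gamma> (Re z + t * Re y) * \<bar>Re y\<bar>))"
  proof -
    have "(\<lambda>t. \<gamma> (Re z + t * Re y) * \<bar>Re y\<bar>) integrable_on {0..1}"
      by (intro integrable_continuous_interval continuous_intros cg)
    then have "((\<lambda>t. \<sigma> * norm y + \<kappa> \<sigma> * (\<bar>Im y\<bar> * M + \<gamma> (Re z + t * Re y) * \<bar>Re y\<bar>)) has_integral
       (1 - 0) *\<^sub>R (\<sigma> * norm y) + \<kappa> \<sigma> * ((1 - 0) *\<^sub>R (\<bar>Im y\<bar> * M) + integral {0..1} (\<lambda>t. \<gamma> (Re z + t * Re y) * \<bar>Re y\<bar>))) {0..1}"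
      by (intro has_integral_add has_integral_mult_right integrable_integral has_integral_const_real[of _ 0 1, simplified content_real]) auto
    then show ?thesis by (simp add: integral_unique)
  qed
  also have "\<dots> \<le> \<sigma> * norm y + \<kappa> \<sigma> * (W * M + M)"
    using I2 Iy M_nonneg \<kappa>_nonneg by (intro add_left_mono mult_left_mono add_mono mult_right_mono) auto
  finally have e: "norm (y * integral {0..1} (\<lambda>t. \<phi> (z + of_real t * y))) \<le> \<sigma> * norm y + \<kappa> \<sigma> * (W * M + M)" .
  have "norm (exp (- (y * integral {0..1} (\<lambda>t. \<phi> (z + of_real t * y))))) \<le> B \<sigma> * exp (\<sigma> * norm y)"
  proof -
    have "norm (exp (- (y * integral {0..1} (\<lambda>t. \<phi> (z + of_real t * y))))) \<le> exp (norm (- (y * integral {0..1} (\<lambda>t. \<phi> (z + of_real t * y)))))"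
      by (rule norm_exp)
    also have "\<dots> \<le> exp (\<sigma> * norm y + \<kappa> \<sigma> * (W * M + M))"
      using e by simp
    finally show ?thesis by (simp add: B_def exp_add mult.commute)
  qed
  moreover have "norm (g (z + y)) \<le> \<gamma> (Re z + Re y - b)"
    using g_bound[OF assms(2,4,5)] by simp
  ultimately show ?thesis
    unfolding kern_def norm_mult using B_pos[of \<sigma>] by (intro mult_mono) auto
qed

text \<open>
  The majorant is handed over as a primitive \<open>\<mu>\<close> of a pointwise bound \<open>\<mu>'\<close>, so that the integral over
  \<open>x\<close> can be estimated without interchanging it with the integral over \<open>\<theta>\<close> inside \<open>volterra\<close>.
\<close>

lemma tail_integral_majorant:
  fixes \<mu> \<mu>' :: "complex \<times> complex \<Rightarrow> real \<Rightarrow> real" and C :: "real \<Rightarrow> real"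
  assumes S: "hol2 S \<Omega>"
    and \<mu>: "\<And>w x. w \<in> \<Omega> \<Longrightarrow> x \<ge> 0 \<Longrightarrow> (\<mu> w has_real_derivative - \<mu>' w x) (at x)"
    and S_le: "\<And>w x. w \<in> \<Omega> \<Longrightarrow> x \<ge> 0 \<Longrightarrow> norm (S (fst w, snd w + of_real x)) \<le> \<mu>' w x"
    and \<mu>_nonneg: "\<And>w x. w \<in> \<Omega> \<Longrightarrow> x \<ge> 0 \<Longrightarrow> 0 \<le> \<mu> w x"
    and \<mu>_le: "\<And>w x. w \<in> \<Omega> \<Longrightarrow> x \<ge> 0 \<Longrightarrow> \<mu> w x \<le> C (norm (fst w)) * G (m w + x) ^ Suc k"
    and C: "\<And>x y. 0 \<le> x \<Longrightarrow> x \<le> y \<Longrightarrow> C x \<le> C y" "\<And>x. 0 \<le> x \<Longrightarrow> C x \<ge> 0"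
  shows "hol2 (tail_integral S) \<Omega>"
    and "\<And>w. w \<in> \<Omega> \<Longrightarrow> norm (tail_integral S w) \<le> C (norm (fst w)) * G (m w) ^ Suc k"
    and "\<And>w. w \<in> \<Omega> \<Longrightarrow> ((\<lambda>z. tail_integral S (fst w, z)) has_field_derivative S w) (at (snd w))"
proof -
  have cont: "continuous_on (\<Omega> \<times> {0..}) (\<lambda>(w, x). S (fst w, snd w + of_real x))"
    unfolding split_beta
    by (rule continuous_on_compose2[OF hol2_imp_continuous_on[OF S]])
      (auto intro!: continuous_intros \<Omega>_right[of "(_, _)", simplified])
  have contw: "continuous_on {0..} (\<lambda>x. S (fst w, snd w + of_real x))" if "w \<in> \<Omega>" for w
    by (rule continuous_on_compose2[OF hol2_imp_continuous_on[OF S]])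
      (use that in \<open>auto intro!: continuous_intros \<Omega>_right\<close>)
  have Gn: "(\<lambda>n. G (a + real n) ^ Suc k) \<longlonglongrightarrow> 0" for a
  proof -
    have "(\<lambda>n. G (a + real n)) \<longlonglongrightarrow> 0"
      by (rule filterlim_compose[OF G_lim]) real_asymp
    from tendsto_power[OF this, of "Suc k"] show ?thesis by simp
  qed
  have \<mu>_lim: "(\<mu> w \<longlongrightarrow> 0) at_top" if w: "w \<in> \<Omega>" for w
  proof (rule tendsto_sandwich[of "\<lambda>_. 0"])
    show "\<forall>\<^sub>F x in at_top. 0 \<le> \<mu> w x"
      using eventually_ge_at_top[of 0] by eventually_elim (rule \<mu>_nonneg[OF w])
    show "\<forall>\<^sub>F x in at_top. \<mu> w x \<le> C (norm (fst w)) * G (m w + x) ^ Suc k"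
      using eventually_ge_at_top[of 0] by eventually_elim (rule \<mu>_le[OF w])
    have "((\<lambda>x. G (m w + x)) \<longlongrightarrow> 0) at_top"
      by (rule filterlim_compose[OF G_lim]) real_asymp
    from tendsto_mult_right_zero[OF tendsto_power[OF this, of "Suc k", simplified]]
    show "((\<lambda>x. C (norm (fst w)) * G (m w + x) ^ Suc k) \<longlongrightarrow> 0) at_top" by simp
  qed simp
  show "norm (tail_integral S w) \<le> C (norm (fst w)) * G (m w) ^ Suc k" if w: "w \<in> \<Omega>" for w
  proof -
    have "norm (integral {0..} (\<lambda>x. S (fst w, snd w + of_real x))) \<le> \<mu> w 0"
      by (rule improper_integral_dominated(3)[OF contw[OF w] \<mu>[OF w] S_le[OF w] \<mu>_lim[OF w]])
    also have "\<dots> \<le> C (norm (fst w)) * G (m w + 0) ^ Suc k"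
      by (rule \<mu>_le[OF w]) simp
    finally show ?thesis by (simp add: tail_integral_def)
  qed
  have "hol2 (\<lambda>w. integral {0..} (\<lambda>x. S (fst w, snd w + of_real x))) \<Omega>"
  proof (rule hol2_improper_integral[OF open_\<Omega> cont])
    show "hol2 (\<lambda>w. S (fst w, snd w + of_real x)) \<Omega>" if "x \<ge> 0" for x
      using that by (intro hol2_compose[OF S] hol2_intros \<Omega>_right)
  next
    fix w assume w: "w \<in> \<Omega>"
    \<comment> \<open>On this neighbourhood both factors of the majorant are controlled by their
      values at \<open>w\<close> with a margin of one, so a single null sequence bounds all
      tails.\<close>
    define A where "A = \<Omega> \<inter> {v. norm (fst v) < norm (fst w) + 1 \<and> m v > m w - 1}"
    define e where "e = (\<lambda>n. C (norm (fst w) + 1) * G (m w - 1 + real n) ^ Suc k)"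
    have "open A"
      unfolding A_def m_def Collect_conj_eq
      by (intro open_Int open_\<Omega> open_Collect_less continuous_intros)
    moreover have "w \<in> A" "A \<subseteq> \<Omega>" using w by (auto simp: A_def)
    moreover have "e \<longlonglongrightarrow> 0"
      unfolding e_def by (intro tendsto_mult_right_zero Gn)
    moreover have "norm (integral {0..} (\<lambda>x. S (fst v, snd v + of_real x))
        - integral {0..real n} (\<lambda>x. S (fst v, snd v + of_real x))) \<le> e n" if v: "v \<in> A" for v n
    proof -
      have v': "v \<in> \<Omega>" using v by (simp add: A_def)
      have "norm (integral {0..} (\<lambda>x. S (fst v, snd v + of_real x))
        - integral {0..real n} (\<lambda>x. S (fst v, snd v + of_real x))) \<le> \<mu> v (real n)"
        by (rule improper_integral_dominated(2)[OF contw[OF v'] \<mu>[OF v'] S_le[OF v'] \<mu>_lim[OF v']]) auto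
      also have "\<dots> \<le> C (norm (fst v)) * G (m v + real n) ^ Suc k"
        by (rule \<mu>_le[OF v']) simp
      also have "\<dots> \<le> e n"
        unfolding e_def using v by (intro mult_mono C power_mono G_antimono G_nonneg zero_le_power) (auto simp: A_def)
      finally show ?thesis .
    qed
    ultimately show "\<exists>A e. open A \<and> w \<in> A \<and> A \<subseteq> \<Omega> \<and> e \<longlonglongrightarrow> 0 \<and>
        (\<forall>v\<in>A. \<forall>n. norm (integral {0..} (\<lambda>x. S (fst v, snd v + of_real x))
           - integral {0..real n} (\<lambda>x. S (fst v, snd v + of_real x))) \<le> e n)"
      by blast
  qed
  from hol2_minus[OF this] show hol: "hol2 (tail_integral S) \<Omega>"
    by (simp add: tail_integral_def[abs_def])
  show "((\<lambda>z. tail_integral S (fst w, z)) has_field_derivative S w) (at (snd w))" if w: "w \<in> \<Omega>" for w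
  proof -
    \<comment> \<open>Complex differentiability is already known from joint holomorphy, so the
      derivative may be computed from real increments to the right alone.\<close>
    let ?F = "\<lambda>z. tail_integral S (fst w, z)"
    have "(?F has_field_derivative deriv ?F (snd w)) (at (snd w))"
      using hol2_slice(2)[OF hol, of "fst w" "snd w"] w by (simp add: field_differentiable_derivI)
    then have "((\<lambda>h. ?F (snd w + h)) has_field_derivative deriv ?F (snd w)) (at (of_real 0))"
      using DERIV_shift[of ?F "deriv ?F (snd w)" 0 "snd w"] by (simp add: add.commute)
    then have d1: "((\<lambda>h. ?F (snd w + of_real h)) has_vector_derivative deriv ?F (snd w)) (at 0 within {0..1})"
      using has_vector_derivative_real_field[of "\<lambda>h. ?F (snd w + h)"] by simp
    have eq: "?F (snd w + of_real h) = ?F (snd w) + integral {0..h} (\<lambda>x. S (fst w, snd w + of_real x))"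
      if h: "h \<in> {0..1}" for h
      using improper_integral_shift[OF contw[OF w] \<mu>[OF w] S_le[OF w] \<mu>_lim[OF w], of h] h
      by (simp add: tail_integral_def add.assoc)
    have "((\<lambda>h. integral {0..h} (\<lambda>x. S (fst w, snd w + of_real x))) has_vector_derivative
        S (fst w, snd w + of_real 0)) (at 0 within {0..1})"
      by (rule integral_has_vector_derivative[OF continuous_on_subset[OF contw[OF w]]]) auto
    from has_vector_derivative_add[OF has_vector_derivative_const this]
    have "((\<lambda>h. ?F (snd w) + integral {0..h} (\<lambda>x. S (fst w, snd w + of_real x))) has_vector_derivative S w) (at 0 within {0..1})"
      by simp
    then have d2: "((\<lambda>h. ?F (snd w + of_real h)) has_vector_derivative S w) (at 0 within {0..1})"
      by (rule has_vector_derivative_transform[rotated 2]) (use eq in auto)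
    have "deriv ?F (snd w) = S w"
      using vector_derivative_unique_within[OF _ d1 d2] by (simp add: trivial_limit_within)
    then show ?thesis using hol2_slice(2)[OF hol, of "fst w" "snd w"] w
      by (metis field_differentiable_derivI prod.collapse)
  qed
qed

lemma volterra_integrand_continuous:
  assumes f: "hol2 f \<Omega>"
  shows "continuous_on (\<Omega> \<times> {0..1}) (\<lambda>(w, \<theta>). kern \<phi> g (of_real \<theta> * fst w) (snd w)
     * f (of_real (1 - \<theta>) * fst w, snd w + of_real \<theta> * fst w))"
proof -
  have 1: "continuous_on (\<Omega> \<times> {0..1}) (\<lambda>q. (\<lambda>w. kern \<phi> g (fst w) (snd w)) (of_real (snd q) * fst (fst q), snd (fst q)))"
    by (rule continuous_on_compose2[OF hol2_imp_continuous_on[OF kern_hol2]])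
      (auto intro!: continuous_intros \<Omega>_segment(2)[of "(_, _)", simplified] simp: \<Omega>_iff)
  have 2: "continuous_on (\<Omega> \<times> {0..1}) (\<lambda>q. f (of_real (1 - snd q) * fst (fst q), snd (fst q) + of_real (snd q) * fst (fst q)))"
    by (rule continuous_on_compose2[OF hol2_imp_continuous_on[OF f]])
      (auto intro!: continuous_intros simp del: of_real_diff intro: \<Omega>_segment(1)[of "(_, _)", simplified])
  show ?thesis
    using continuous_on_mult[OF 1 2] by (simp add: split_beta)
qed

lemma volterra_hol2:
  assumes f: "hol2 f \<Omega>"
  shows "hol2 (volterra \<phi> g f) \<Omega>"
proof -
  have "hol2 (\<lambda>w. integral {0..1} (\<lambda>\<theta>. kern \<phi> g (of_real \<theta> * fst w) (snd w)
     * f (of_real (1 - \<theta>) * fst w, snd w + of_real \<theta> * fst w))) \<Omega>"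
  proof (rule hol2_integral[OF open_\<Omega> volterra_integrand_continuous[OF f]])
    fix \<theta> :: real assume \<theta>: "\<theta> \<in> {0..1}"
    have "hol2 (\<lambda>w. (\<lambda>w. kern \<phi> g (fst w) (snd w)) (of_real \<theta> * fst w, snd w)) \<Omega>"
      by (intro hol2_compose[OF kern_hol2] hol2_intros) (use \<theta> \<Omega>_segment(2) in \<open>auto simp: \<Omega>_iff\<close>)
    moreover have "hol2 (\<lambda>w. f (of_real (1 - \<theta>) * fst w, snd w + of_real \<theta> * fst w)) \<Omega>"
      by (intro hol2_compose[OF f] hol2_intros) (use \<theta> \<Omega>_segment(1) in auto)
    ultimately show "hol2 (\<lambda>w. kern \<phi> g (of_real \<theta> * fst w) (snd w)
     * f (of_real (1 - \<theta>) * fst w, snd w + of_real \<theta> * fst w)) \<Omega>"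
      using hol2_mult by fastforce
  qed
  from hol2_mult[OF hol2_fst this] show ?thesis
    by (simp add: volterra_def[abs_def])
qed

end

section \<open>Factorial bounds for the iterates\<close>

text \<open>The source of the first factorial: the \<open>n\<close>-th iterate contributes
  \<open>(1 - \<theta>) ^ n\<close> on the characteristic.\<close>

lemma integral_one_minus_power: "integral {0..1} (\<lambda>\<theta>::real. (1 - \<theta>) ^ n) = 1 / (real n + 1)"
proof -
  have "((\<lambda>\<theta>::real. (1 - \<theta>) ^ n) has_integral
      (- ((1 - 1) ^ Suc n / (real n + 1)) - - ((1 - 0) ^ Suc n / (real n + 1)))) {0..1}"
  proof (rule fundamental_theorem_of_calculus)
    fix \<theta> :: real
    have "((\<lambda>\<theta>. - ((1 - \<theta>) ^ Suc n / (real n + 1))) has_real_derivative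
        - (real (Suc n) * (1 - \<theta>) ^ n * (0 - 1) / (real n + 1))) (at \<theta>)"
      by (rule derivative_eq_intros refl | simp)+
    also have "- (real (Suc n) * (1 - \<theta>) ^ n * (0 - 1) / (real n + 1)) = (1 - \<theta>) ^ n"
      by (simp add: field_simps)
    finally show "((\<lambda>\<theta>. - ((1 - \<theta>) ^ Suc n / (real n + 1))) has_vector_derivative (1 - \<theta>) ^ n) (at \<theta> within {0..1})"
      unfolding has_real_derivative_iff_has_vector_derivative by (rule has_vector_derivative_at_within)
  qed simp
  from integral_unique[OF this] show ?thesis by simp
qed

context right_strip
begin

text \<open>Admissibility of the slack \<open>b\<close> that \<open>segment_bound\<close> passes to
  \<open>kern_bound\<close>.\<close>

lemma \<Omega>_segment_Re:
  assumes "w \<in> \<Omega>" "0 \<le> \<theta>" "\<theta> \<le> 1"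
  shows "- min 0 ((1 - \<theta>) * Re (fst w)) \<le> R"
  using \<Omega>_segment(1)[OF assms] R_pos by (auto simp: \<Omega>_def)

definition C :: "real \<Rightarrow> nat \<Rightarrow> real \<Rightarrow> real" where
  "C \<sigma> n x = 1/2 * B \<sigma> ^ Suc n * exp (\<sigma> * x) * x ^ n / (fact n * fact (Suc n))"

lemma C_mono: "\<sigma> > 0 \<Longrightarrow> 0 \<le> x \<Longrightarrow> x \<le> y \<Longrightarrow> C \<sigma> n x \<le> C \<sigma> n y"
  unfolding C_def using B_pos[of \<sigma>]
  by (intro divide_right_mono mult_mono power_mono) (auto intro!: mult_nonneg_nonneg)

lemma C_nonneg: "0 \<le> x \<Longrightarrow> C \<sigma> n x \<ge> 0"
  unfolding C_def using B_pos[of \<sigma>] by simp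

text \<open>\<open>y\<close> is the least real part on the remaining piece of the segment. The slack
  moves the bound of \<open>g\<close> to this point, where the iterate is bounded as well, so the
  product \<open>\<gamma> y * G y ^ Suc n\<close> is, up to sign and a factor \<open>n + 2\<close>,
  the derivative of \<open>G ^ (n + 2)\<close>. The exponentials for \<theta> and
  \<open>1 - \<theta>\<close> combine to \<open>exp (\<sigma> * norm (fst w))\<close>, so the rate
  does not accumulate with \<open>n\<close>.\<close>

lemma segment_bound:
  assumes \<sigma>: "\<sigma> > 0" and w: "w \<in> \<Omega>" and \<theta>: "0 \<le> \<theta>" "\<theta> \<le> 1"
    and f: "\<And>w. w \<in> \<Omega> \<Longrightarrow> norm (f w) \<le> C \<sigma> n (norm (fst w)) * G (m w) ^ Suc n"
  defines "y \<equiv> Re (snd w) + \<theta> * Re (fst w) + min 0 ((1 - \<theta>) * Re (fst w))"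
  shows "norm (fst w * (kern \<phi> g (of_real \<theta> * fst w) (snd w) * f (of_real (1 - \<theta>) * fst w, snd w + of_real \<theta> * fst w)))
     \<le> 1/2 * B \<sigma> ^ Suc (Suc n) * exp (\<sigma> * norm (fst w)) * norm (fst w) ^ Suc n / (fact n * fact (Suc n))
        * (1 - \<theta>) ^ n * \<gamma> y * G y ^ Suc n"
proof -
  let ?r = "norm (fst w)"
  have k: "norm (kern \<phi> g (of_real \<theta> * fst w) (snd w)) \<le> B \<sigma> * exp (\<sigma> * (\<theta> * ?r)) * \<gamma> y"
    using kern_bound[of "snd w" "of_real \<theta> * fst w" \<sigma> "- min 0 ((1 - \<theta>) * Re (fst w))"]
      \<Omega>_segment(2)[OF w \<theta>] \<Omega>_segment_Re[OF w \<theta>] w \<sigma> \<theta>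
    by (simp add: \<Omega>_def y_def norm_mult)
  have "norm (f (of_real (1 - \<theta>) * fst w, snd w + of_real \<theta> * fst w))
     \<le> C \<sigma> n (norm (of_real (1 - \<theta>) * fst w)) * G (m (of_real (1 - \<theta>) * fst w, snd w + of_real \<theta> * fst w)) ^ Suc n"
    using f[OF \<Omega>_segment(1)[OF w \<theta>]] by simp
  also have "norm (of_real (1 - \<theta>) * fst w) = (1 - \<theta>) * ?r"
    using \<theta> by (simp only: norm_mult norm_of_real)
  also have "m (of_real (1 - \<theta>) * fst w, snd w + of_real \<theta> * fst w) = y"
    by (simp add: m_def y_def)
  finally have f': "norm (f (of_real (1 - \<theta>) * fst w, snd w + of_real \<theta> * fst w)) \<le> C \<sigma> n ((1 - \<theta>) * ?r) * G y ^ Suc n" .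
  have e: "exp (\<sigma> * ?r) = exp (\<sigma> * (\<theta> * ?r)) * exp (\<sigma> * ((1 - \<theta>) * ?r))"
    by (simp add: algebra_simps flip: exp_add)
  have "norm (fst w * (kern \<phi> g (of_real \<theta> * fst w) (snd w) * f (of_real (1 - \<theta>) * fst w, snd w + of_real \<theta> * fst w)))
     \<le> ?r * ((B \<sigma> * exp (\<sigma> * (\<theta> * ?r)) * \<gamma> y) * (C \<sigma> n ((1 - \<theta>) * ?r) * G y ^ Suc n))"
    unfolding norm_mult by (intro mult_left_mono mult_mono k f' mult_nonneg_nonneg \<gamma>_nonneg) (use B_pos[of \<sigma>] in auto)
  also have "\<dots> = 1/2 * B \<sigma> ^ Suc (Suc n) * exp (\<sigma> * ?r) * ?r ^ Suc n / (fact n * fact (Suc n))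
        * (1 - \<theta>) ^ n * \<gamma> y * G y ^ Suc n"
    unfolding C_def power_mult_distrib e by (simp del: fact_Suc)
  finally show ?thesis .
qed

lemma iterates:
  assumes \<sigma>: "\<sigma> > 0"
  shows "hol2 (slope \<phi> g n) \<Omega>" "hol2 (tail_integral (slope \<phi> g n)) \<Omega>"
    "\<And>w. w \<in> \<Omega> \<Longrightarrow> norm (tail_integral (slope \<phi> g n) w) \<le> C \<sigma> n (norm (fst w)) * G (m w) ^ Suc n"
    "\<And>w. w \<in> \<Omega> \<Longrightarrow> ((\<lambda>z. tail_integral (slope \<phi> g n) (fst w, z)) has_field_derivative slope \<phi> g n w) (at (snd w))"
proof -
  have G_cont: "continuous_on UNIV G"
    using G_deriv by (auto intro!: continuous_at_imp_continuous_on DERIV_isCont)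
  have "hol2 (slope \<phi> g n) \<Omega> \<and> hol2 (tail_integral (slope \<phi> g n)) \<Omega> \<and>
    (\<forall>w\<in>\<Omega>. norm (tail_integral (slope \<phi> g n) w) \<le> C \<sigma> n (norm (fst w)) * G (m w) ^ Suc n) \<and>
    (\<forall>w\<in>\<Omega>. ((\<lambda>z. tail_integral (slope \<phi> g n) (fst w, z)) has_field_derivative slope \<phi> g n w) (at (snd w)))"
  proof (induction n)
    case 0
    have S: "hol2 (slope \<phi> g 0) \<Omega>"
      unfolding slope.simps by (intro hol2_cmult hol2_subset[OF kern_hol2]) (auto simp: \<Omega>_iff)
    \<comment> \<open>The first iterate evaluates \<open>g\<close> only at
      \<open>z + \<tau>\<close>; hence \<open>b = 0\<close>, and \<open>m\<close> enters through
      monotonicity of \<open>G\<close>.\<close>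
    define \<mu> where "\<mu> = (\<lambda>w x. 1/2 * B \<sigma> * exp (\<sigma> * norm (fst w)) * G (Re (snd w) + Re (fst w) + x) :: real)"
    define \<mu>' where "\<mu>' = (\<lambda>w x. 1/2 * B \<sigma> * exp (\<sigma> * norm (fst w)) * \<gamma> (Re (snd w) + Re (fst w) + x) :: real)"
    have 1: "(\<mu> w has_real_derivative - \<mu>' w x) (at x)" for w :: "complex \<times> complex" and x
    proof -
      have "((\<lambda>x. G (Re (snd w) + Re (fst w) + x)) has_real_derivative - \<gamma> (Re (snd w) + Re (fst w) + x) * 1) (at x)"
        by (rule DERIV_chain2[OF G_deriv]) (auto intro!: derivative_eq_intros)
      from DERIV_cmult[OF this, of "1/2 * B \<sigma> * exp (\<sigma> * norm (fst w))"]
      show ?thesis by (simp add: \<mu>_def \<mu>'_def)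
    qed
    have 2: "norm (slope \<phi> g 0 (fst w, snd w + of_real x)) \<le> \<mu>' w x" if "w \<in> \<Omega>" "x \<ge> 0" for w x
      using kern_bound[of "snd w + of_real x" "fst w" \<sigma> 0] \<Omega>_right[OF that] R_pos \<sigma>
      by (simp add: \<Omega>_iff \<mu>'_def norm_mult algebra_simps)
    have 3: "0 \<le> \<mu> w x" for w x
      using B_pos[of \<sigma>] G_nonneg by (simp add: \<mu>_def)
    have 4: "\<mu> w x \<le> C \<sigma> 0 (norm (fst w)) * G (m w + x) ^ Suc 0" for w x
      using B_pos[of \<sigma>] by (simp add: \<mu>_def C_def m_def G_antimono mult_left_mono)
    from tail_integral_majorant[OF S 1 2 3 4 C_mono[OF \<sigma>] C_nonneg] S show ?case by auto
  next
    case (Suc n)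
    define f where "f = tail_integral (slope \<phi> g n)"
    have f: "hol2 f \<Omega>" "\<And>w. w \<in> \<Omega> \<Longrightarrow> norm (f w) \<le> C \<sigma> n (norm (fst w)) * G (m w) ^ Suc n"
      using Suc by (auto simp: f_def)
    have S: "hol2 (slope \<phi> g (Suc n)) \<Omega>"
      using volterra_hol2[OF f(1)] by (simp add: f_def)
    define c where "c = (\<lambda>w :: complex \<times> complex. 1/2 * B \<sigma> ^ Suc (Suc n) * exp (\<sigma> * norm (fst w)) * norm (fst w) ^ Suc n / (fact n * fact (Suc n)))"
    have c: "c w \<ge> 0" for w
      using B_pos[of \<sigma>] by (simp add: c_def)
    define y where "y = (\<lambda>(w :: complex \<times> complex) \<theta>. Re (snd w) + \<theta> * Re (fst w) + min 0 ((1 - \<theta>) * Re (fst w)))"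
    have y_cont: "continuous_on A (\<lambda>p. y w (h p))" if "continuous_on A h" for w h and A :: "'x::topological_space set"
      unfolding y_def by (intro continuous_intros that)
    have y_ge: "y w \<theta> \<ge> m w" if "0 \<le> \<theta>" "\<theta> \<le> 1" for w \<theta>
    proof (cases "Re (fst w) \<ge> 0")
      case True
      then show ?thesis using that by (simp add: y_def m_def)
    next
      case False
      then have "(1 - \<theta>) * Re (fst w) \<le> 0" using that by (simp add: mult_nonneg_nonpos)
      then show ?thesis using False by (simp add: y_def m_def min_def algebra_simps)
    qed
    define \<mu> where "\<mu> = (\<lambda>w x. integral {0..1} (\<lambda>\<theta>. c w * (1 - \<theta>) ^ n * (G (y w \<theta> + x) ^ Suc (Suc n) / real (Suc (Suc n)))))"
    define \<mu>' where "\<mu>' = (\<lambda>w x. integral {0..1} (\<lambda>\<theta>. c w * (1 - \<theta>) ^ n * \<gamma> (y w \<theta> + x) * G (y w \<theta> + x) ^ Suc n))"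
    have cG: "continuous_on A (\<lambda>p. G (h p))" "continuous_on A (\<lambda>p. \<gamma> (h p))"
      if "continuous_on A h" for h and A :: "'x::topological_space set"
      by (rule continuous_on_compose2[OF G_cont that], simp, rule continuous_on_compose2[OF \<gamma>_cont that], simp)
    have 1: "(\<mu> w has_real_derivative - \<mu>' w x) (at x)" for w x
    proof -
      \<comment> \<open>Differentiating \<open>G ^ (n + 2) / (n + 2)\<close> under the
        \<theta>-integral reproduces the pointwise bound of \<open>segment_bound\<close>.\<close>
      let ?d = "\<lambda>x \<theta>. - (c w * (1 - \<theta>) ^ n * \<gamma> (y w \<theta> + x) * G (y w \<theta> + x) ^ Suc n)"
      have "((\<lambda>x. integral (cbox 0 1) (\<lambda>\<theta>. c w * (1 - \<theta>) ^ n * (G (y w \<theta> + x) ^ Suc (Suc n) / real (Suc (Suc n)))))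
          has_field_derivative integral (cbox 0 1) (?d x)) (at x within UNIV)"
      proof (rule leibniz_rule_field_derivative)
        fix x \<theta> :: real
        have 1: "((\<lambda>x. G (y w \<theta> + x)) has_real_derivative - \<gamma> (y w \<theta> + x) * 1) (at x)"
          by (rule DERIV_chain2[OF G_deriv]) (auto intro!: derivative_eq_intros)
        have "((\<lambda>x. c w * (1 - \<theta>) ^ n * (G (y w \<theta> + x) ^ Suc (Suc n) / real (Suc (Suc n)))) has_field_derivative
            c w * (1 - \<theta>) ^ n * (real (Suc (Suc n)) * G (y w \<theta> + x) ^ Suc n * (- \<gamma> (y w \<theta> + x) * 1) / real (Suc (Suc n)))) (at x)"
          using DERIV_cmult[OF DERIV_cdivide[OF DERIV_power[OF 1, of "Suc (Suc n)"], of "real (Suc (Suc n))"], of "c w * (1 - \<theta>) ^ n"]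
          by (simp only: diff_Suc_Suc diff_zero One_nat_def mult_ac)
        also have "c w * (1 - \<theta>) ^ n * (real (Suc (Suc n)) * G (y w \<theta> + x) ^ Suc n * (- \<gamma> (y w \<theta> + x) * 1) / real (Suc (Suc n))) = ?d x \<theta>"
          by (simp del: power_Suc of_nat_Suc)
        finally show "((\<lambda>x. c w * (1 - \<theta>) ^ n * (G (y w \<theta> + x) ^ Suc (Suc n) / real (Suc (Suc n)))) has_field_derivative ?d x \<theta>) (at x within UNIV)" .
      next
        show "(\<lambda>\<theta>. c w * (1 - \<theta>) ^ n * (G (y w \<theta> + x) ^ Suc (Suc n) / real (Suc (Suc n)))) integrable_on cbox 0 1" for x
          by (intro integrable_continuous continuous_intros cG y_cont) auto
        show "continuous_on (UNIV \<times> cbox 0 1) (\<lambda>(x, \<theta>). ?d x \<theta>)"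
          unfolding split_beta by (intro continuous_intros cG y_cont)
      qed auto
      then show ?thesis by (simp add: \<mu>_def \<mu>'_def)
    qed
    have 2: "norm (slope \<phi> g (Suc n) (fst w, snd w + of_real x)) \<le> \<mu>' w x" if w: "w \<in> \<Omega>" "x \<ge> 0" for w x
    proof -
      define v where "v = (fst w, snd w + of_real x)"
      have v: "v \<in> \<Omega>" using \<Omega>_right[OF w] by (simp add: v_def)
      have yv: "y v \<theta> = y w \<theta> + x" for \<theta> by (simp add: y_def v_def)
      have cv: "c v = c w" by (simp add: c_def v_def)
      have "slope \<phi> g (Suc n) v = integral {0..1} (\<lambda>\<theta>. fst v * (kern \<phi> g (of_real \<theta> * fst v) (snd v) * f (of_real (1 - \<theta>) * fst v, snd v + of_real \<theta> * fst v)))"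
        unfolding slope.simps volterra_def f_def by simp
      also have "norm \<dots> \<le> integral {0..1} (\<lambda>\<theta>. c w * (1 - \<theta>) ^ n * \<gamma> (y w \<theta> + x) * G (y w \<theta> + x) ^ Suc n)"
      proof (rule integral_norm_bound_integral)
        have "continuous_on {0..1} (\<lambda>\<theta>. kern \<phi> g (of_real \<theta> * fst v) (snd v) * f (of_real (1 - \<theta>) * fst v, snd v + of_real \<theta> * fst v))"
          by (rule continuous_on_compose2[OF volterra_integrand_continuous[OF f(1)], where f="\<lambda>\<theta>. (v, \<theta>)", unfolded split_beta fst_conv snd_conv])
            (use v in \<open>auto intro!: continuous_intros\<close>)
        then show "(\<lambda>\<theta>. fst v * (kern \<phi> g (of_real \<theta> * fst v) (snd v) * f (of_real (1 - \<theta>) * fst v, snd v + of_real \<theta> * fst v))) integrable_on {0..1}"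
          by (intro integrable_continuous_interval continuous_on_mult[OF continuous_on_const])
        show "(\<lambda>\<theta>. c w * (1 - \<theta>) ^ n * \<gamma> (y w \<theta> + x) * G (y w \<theta> + x) ^ Suc n) integrable_on {0..1}"
          by (intro integrable_continuous_interval continuous_intros cG y_cont)
        show "norm (fst v * (kern \<phi> g (of_real \<theta> * fst v) (snd v) * f (of_real (1 - \<theta>) * fst v, snd v + of_real \<theta> * fst v)))
            \<le> c w * (1 - \<theta>) ^ n * \<gamma> (y w \<theta> + x) * G (y w \<theta> + x) ^ Suc n" if "\<theta> \<in> {0..1}" for \<theta>
        proof -
          have "norm (fst v * (kern \<phi> g (of_real \<theta> * fst v) (snd v) * f (of_real (1 - \<theta>) * fst v, snd v + of_real \<theta> * fst v)))
            \<le> c v * (1 - \<theta>) ^ n * \<gamma> (y v \<theta>) * G (y v \<theta>) ^ Suc n"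
            unfolding c_def y_def by (rule segment_bound[OF \<sigma> v _ _ f(2)]) (use that in auto)
          then show ?thesis by (simp only: yv cv)
        qed
      qed
      finally show ?thesis by (simp add: \<mu>'_def v_def)
    qed
    have 3: "0 \<le> \<mu> w x" for w x
      unfolding \<mu>_def using c G_nonneg
      by (intro integral_nonneg integrable_continuous_interval continuous_intros cG y_cont mult_nonneg_nonneg divide_nonneg_nonneg) auto
    have 4: "\<mu> w x \<le> C \<sigma> (Suc n) (norm (fst w)) * G (m w + x) ^ Suc (Suc n)" for w x
    proof -
      have "\<mu> w x \<le> integral {0..1} (\<lambda>\<theta>. c w * (G (m w + x) ^ Suc (Suc n) / real (Suc (Suc n))) * (1 - \<theta>) ^ n)"
        unfolding \<mu>_def
      proof (rule integral_le)
        fix \<theta> :: real assume \<theta>: "\<theta> \<in> {0..1}"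
        have "c w * (1 - \<theta>) ^ n * (G (y w \<theta> + x) ^ Suc (Suc n) / real (Suc (Suc n)))
           \<le> c w * (1 - \<theta>) ^ n * (G (m w + x) ^ Suc (Suc n) / real (Suc (Suc n)))"
          using c \<theta> G_nonneg y_ge[of \<theta> w]
          by (intro mult_left_mono divide_right_mono power_mono G_antimono mult_nonneg_nonneg) auto
        then show "c w * (1 - \<theta>) ^ n * (G (y w \<theta> + x) ^ Suc (Suc n) / real (Suc (Suc n)))
           \<le> c w * (G (m w + x) ^ Suc (Suc n) / real (Suc (Suc n))) * (1 - \<theta>) ^ n"
          by (simp only: mult_ac)
      qed (intro integrable_continuous_interval continuous_intros cG y_cont; simp)+
      also have "\<dots> = c w * (G (m w + x) ^ Suc (Suc n) / real (Suc (Suc n))) * (1 / (real n + 1))"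
        by (simp only: integral_mult_right integral_one_minus_power)
      \<comment> \<open>\<open>1 / (n + 1)\<close> from the \<theta>-integral and
        \<open>1 / (n + 2)\<close> from the power of \<open>G\<close> raise both factorials by
        one.\<close>
      also have "\<dots> = C \<sigma> (Suc n) (norm (fst w)) * G (m w + x) ^ Suc (Suc n)"
        by (simp add: c_def C_def field_simps del: power_Suc)
      finally show ?thesis .
    qed
    from tail_integral_majorant[OF S 1 2 3 4 C_mono[OF \<sigma>] C_nonneg] S show ?case by auto
  qed
  then show "hol2 (slope \<phi> g n) \<Omega>" "hol2 (tail_integral (slope \<phi> g n)) \<Omega>"
    "\<And>w. w \<in> \<Omega> \<Longrightarrow> norm (tail_integral (slope \<phi> g n) w) \<le> C \<sigma> n (norm (fst w)) * G (m w) ^ Suc n"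
    "\<And>w. w \<in> \<Omega> \<Longrightarrow> ((\<lambda>z. tail_integral (slope \<phi> g n) (fst w, z)) has_field_derivative slope \<phi> g n w) (at (snd w))"
    by blast+
qed

section \<open>The sum of the series and the equation it solves\<close>

text \<open>One factorial and the decay are given away: the other factorial already makes the series
  of exponential type, which suffices for locally uniform convergence.\<close>

lemma iterate_le:
  assumes \<sigma>: "\<sigma> > 0" and w: "w \<in> \<Omega>" and T: "norm (fst w) \<le> T"
  shows "norm (tail_integral (slope \<phi> g n) w) \<le> 1/2 * B \<sigma> * M * exp (\<sigma> * T) * ((B \<sigma> * M * T) ^ n /\<^sub>R fact n)"
proof -
  have T0: "T \<ge> 0" using T norm_ge_zero order_trans by blast
  have "norm (tail_integral (slope \<phi> g n) w) \<le> C \<sigma> n (norm (fst w)) * G (m w) ^ Suc n"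
    by (rule iterates(3)[OF \<sigma> w])
  also have "\<dots> \<le> C \<sigma> n T * M ^ Suc n"
    using \<sigma> T T0 G_nonneg by (intro mult_mono C_mono power_mono G_le C_nonneg zero_le_power) auto
  also have "C \<sigma> n T \<le> 1/2 * B \<sigma> ^ Suc n * exp (\<sigma> * T) * T ^ n / (fact n * 1)"
    unfolding C_def using B_pos[of \<sigma>] T0
    by (intro divide_left_mono mult_left_mono fact_ge_1 mult_pos_pos mult_nonneg_nonneg) auto
  then have "C \<sigma> n T * M ^ Suc n \<le> 1/2 * B \<sigma> ^ Suc n * exp (\<sigma> * T) * T ^ n / (fact n * 1) * M ^ Suc n"
    using M_nonneg by (intro mult_right_mono) auto
  also have "\<dots> = 1/2 * B \<sigma> * M * exp (\<sigma> * T) * ((B \<sigma> * M * T) ^ n /\<^sub>R fact n)"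
    by (simp add: power_mult_distrib field_simps)
  finally show ?thesis .
qed

lemma iterate_uniform_limit:
  "uniform_limit {w \<in> \<Omega>. norm (fst w) \<le> T} (\<lambda>n w. \<Sum>i<n. tail_integral (slope \<phi> g i) w) (borel_sum \<phi> g) sequentially"
  unfolding borel_sum_def[abs_def]
proof (rule Weierstrass_m_test)
  show "norm (tail_integral (slope \<phi> g n) w) \<le> 1/2 * B 1 * M * exp (1 * T) * ((B 1 * M * T) ^ n /\<^sub>R fact n)"
    if "w \<in> {w \<in> \<Omega>. norm (fst w) \<le> T}" for n w
    using that by (intro iterate_le) auto
  show "summable (\<lambda>n. 1/2 * B 1 * M * exp (1 * T) * ((B 1 * M * T) ^ n /\<^sub>R fact n))"
    by (intro summable_mult summable_exp_generic)
qed

lemma borel_sum_hol2: "hol2 (borel_sum \<phi> g) \<Omega>"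
proof (rule hol2_uniform_limit[OF open_\<Omega>])
  show "hol2 (\<lambda>w. \<Sum>i<n. tail_integral (slope \<phi> g i) w) \<Omega>" for n
    by (intro hol2_sum iterates(2)[of 1]) simp
  fix w assume w: "w \<in> \<Omega>"
  let ?A = "\<Omega> \<inter> {v. norm (fst v) < norm (fst w) + 1}"
  have "open ?A" by (intro open_Int open_\<Omega> open_Collect_less continuous_intros)
  moreover have "uniform_limit ?A (\<lambda>n w. \<Sum>i<n. tail_integral (slope \<phi> g i) w) (borel_sum \<phi> g) sequentially"
    by (rule uniform_limit_on_subset[OF iterate_uniform_limit[of "norm (fst w) + 1"]]) auto
  ultimately show "\<exists>A. open A \<and> w \<in> A \<and> A \<subseteq> \<Omega> \<and>
      uniform_limit A (\<lambda>n w. \<Sum>i<n. tail_integral (slope \<phi> g i) w) (borel_sum \<phi> g) sequentially"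
    using w by (intro exI[of _ ?A]) auto
qed

lemma borel_slope_hol2: "hol2 (borel_slope \<phi> g) \<Omega>"
  unfolding borel_slope_def[abs_def]
  by (intro hol2_add hol2_cmult volterra_hol2 borel_sum_hol2 hol2_subset[OF kern_hol2]) (auto simp: \<Omega>_iff)

text \<open>Both factorials are used. With \<open>r = norm (fst w)\<close>,
  \<open>r^n / (n! (n+1)!)\<close> is distributed as \<open>(\<sigma> r)^n / n!\<close>, at most
  \<open>exp (\<sigma> r)\<close> for each \<open>n\<close>, and
  \<open>\<sigma>^(-n) / (n+1)!\<close>, which is summed against the powers of
  \<open>B \<sigma> * M\<close>. This costs a second \<open>exp (\<sigma> r)\<close>, hence the rate
  \<open>2 * \<sigma>\<close>; one factor \<open>G (m w)\<close> is kept for the decay.\<close>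

lemma borel_sum_bound:
  assumes \<sigma>: "\<sigma> > 0" and w: "w \<in> \<Omega>"
  shows "norm (borel_sum \<phi> g w) \<le> 1/2 * B \<sigma> * exp (B \<sigma> * M / \<sigma>) * G (m w) * exp (2 * \<sigma> * norm (fst w))"
proof -
  let ?r = "norm (fst w)"
  define c where "c = 1/2 * B \<sigma> * exp (2 * \<sigma> * ?r) * G (m w)"
  have c: "c \<ge> 0" using B_pos[of \<sigma>] G_nonneg by (simp add: c_def)
  have le: "norm (tail_integral (slope \<phi> g n) w) \<le> c * ((B \<sigma> * M / \<sigma>) ^ n /\<^sub>R fact n)" for n
  proof -
    have e: "(\<sigma> * ?r) ^ n / fact n \<le> exp (\<sigma> * ?r)"
    proof -
      have "(\<Sum>i\<in>{n}. (\<sigma> * ?r) ^ i /\<^sub>R fact i) \<le> (\<Sum>i. (\<sigma> * ?r) ^ i /\<^sub>R fact i)"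
        using \<sigma> by (intro sum_le_suminf summable_exp_generic) auto
      then show ?thesis by (simp add: exp_def field_simps)
    qed
    have "norm (tail_integral (slope \<phi> g n) w) \<le> C \<sigma> n ?r * G (m w) ^ Suc n"
      by (rule iterates(3)[OF \<sigma> w])
    also have "\<dots> = (1/2 * B \<sigma> * exp (\<sigma> * ?r) * G (m w)) * (((\<sigma> * ?r) ^ n / fact n) * ((B \<sigma> * G (m w) / \<sigma>) ^ n / fact (Suc n)))"
      using \<sigma> by (simp add: C_def power_mult_distrib power_divide del: fact_Suc)
    also have "\<dots> \<le> (1/2 * B \<sigma> * exp (\<sigma> * ?r) * G (m w)) * (exp (\<sigma> * ?r) * ((B \<sigma> * M / \<sigma>) ^ n / fact n))"
      using \<sigma> B_pos[of \<sigma>] G_nonneg G_le M_nonneg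
      by (intro mult_left_mono mult_mono e frac_le power_mono divide_right_mono mult_nonneg_nonneg
          divide_nonneg_nonneg zero_le_power fact_mono) auto
    also have "\<dots> = c * ((B \<sigma> * M / \<sigma>) ^ n /\<^sub>R fact n)"
      by (simp add: c_def field_simps flip: exp_add)
    finally show ?thesis .
  qed
  have s: "summable (\<lambda>n. c * ((B \<sigma> * M / \<sigma>) ^ n /\<^sub>R fact n))"
    by (intro summable_mult summable_exp_generic)
  have "norm (borel_sum \<phi> g w) \<le> (\<Sum>n. c * ((B \<sigma> * M / \<sigma>) ^ n /\<^sub>R fact n))"
    unfolding borel_sum_def by (rule norm_suminf_le[OF le s])
  also have "\<dots> = c * exp (B \<sigma> * M / \<sigma>)"
    unfolding exp_def by (intro suminf_mult summable_exp_generic)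
  finally show ?thesis by (simp add: c_def mult_ac)
qed

text \<open>Uniform convergence shows that the partial sums of the slopes tend to the derivative;
  dominated convergence in the Duhamel integral shows that they tend to
  \<open>borel_slope\<close>.\<close>

lemma borel_sum_derivative:
  assumes w: "w \<in> \<Omega>"
  shows "((\<lambda>z. borel_sum \<phi> g (fst w, z)) has_field_derivative borel_slope \<phi> g w) (at (snd w))"
proof -
  let ?S = "\<lambda>n w. \<Sum>i<n. tail_integral (slope \<phi> g i) w"
  define Z where "Z = {z. (fst w, z) \<in> \<Omega>}"
  have Z: "open Z"
  proof -
    have "open ((\<lambda>z. (fst w, z)) -` \<Omega>)"
      by (intro open_vimage open_\<Omega> continuous_intros)
    then show ?thesis by (simp add: Z_def vimage_def)
  qed
  have wZ: "snd w \<in> Z" using w by (simp add: Z_def)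
  have "\<exists>g'. \<forall>z\<in>Z. ((\<lambda>z. borel_sum \<phi> g (fst w, z)) has_field_derivative g' z) (at z) \<and>
      (\<lambda>n. \<Sum>i<n. slope \<phi> g i (fst w, z)) \<longlonglongrightarrow> g' z"
  proof (rule has_complex_derivative_uniform_sequence[OF Z])
    show "((\<lambda>z. ?S n (fst w, z)) has_field_derivative (\<Sum>i<n. slope \<phi> g i (fst w, z))) (at z)" if "z \<in> Z" for n z
      using that iterates(4)[of 1 "(fst w, z)"] by (intro DERIV_sum) (auto simp: Z_def)
    fix z assume "z \<in> Z"
    then obtain d where d: "d > 0" "cball z d \<subseteq> Z" using Z open_contains_cball by blast
    have "uniform_limit (cball z d) (\<lambda>n z. ?S n (fst w, z)) (\<lambda>z. borel_sum \<phi> g (fst w, z)) sequentially"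
      by (rule uniform_limit_compose'[OF iterate_uniform_limit[of "norm (fst w)"]]) (use d in \<open>auto simp: Z_def\<close>)
    with d show "\<exists>d>0. cball z d \<subseteq> Z \<and> uniform_limit (cball z d) (\<lambda>n z. ?S n (fst w, z)) (\<lambda>z. borel_sum \<phi> g (fst w, z)) sequentially"
      by blast
  qed
  then obtain g' where g': "((\<lambda>z. borel_sum \<phi> g (fst w, z)) has_field_derivative g') (at (snd w))"
    "(\<lambda>n. \<Sum>i<n. slope \<phi> g i w) \<longlonglongrightarrow> g'"
    using wZ by force
  let ?k = "\<lambda>\<theta>. kern \<phi> g (of_real \<theta> * fst w) (snd w)"
  let ?p = "\<lambda>\<theta>. (of_real (1 - \<theta>) * fst w, snd w + of_real \<theta> * fst w)"
  have vc: "continuous_on {0..1} (\<lambda>\<theta>. ?k \<theta> * f (?p \<theta>))" if "hol2 f \<Omega>" for f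
    by (rule continuous_on_compose2[OF volterra_integrand_continuous[OF that], where f="\<lambda>\<theta>. (w, \<theta>)", unfolded split_beta fst_conv snd_conv])
      (use w in \<open>auto intro!: continuous_intros\<close>)
  have pT: "?p \<theta> \<in> {w' \<in> \<Omega>. norm (fst w') \<le> norm (fst w)}" if "\<theta> \<in> {0..1}" for \<theta>
    using \<Omega>_segment(1)[OF w, of \<theta>] that by (auto simp: norm_mult mult_left_le_one_le simp del: of_real_diff)
  define A where "A = (\<Sum>n. 1/2 * B 1 * M * exp (1 * norm (fst w)) * ((B 1 * M * norm (fst w)) ^ n /\<^sub>R fact n))"
  have S_le: "norm (?S n v) \<le> A" if v: "v \<in> {w' \<in> \<Omega>. norm (fst w') \<le> norm (fst w)}" for n v
  proof -
    have "norm (?S n v) \<le> (\<Sum>i<n. 1/2 * B 1 * M * exp (1 * norm (fst w)) * ((B 1 * M * norm (fst w)) ^ i /\<^sub>R fact i))"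
      using v by (intro sum_norm_le iterate_le) auto
    also have "\<dots> \<le> A"
      unfolding A_def using B_pos[of 1] M_nonneg
      by (intro sum_le_suminf summable_mult summable_exp_generic) auto
    finally show ?thesis .
  qed
  have "(\<lambda>n. integral {0..1} (\<lambda>\<theta>. ?k \<theta> * ?S n (?p \<theta>))) \<longlonglongrightarrow> integral {0..1} (\<lambda>\<theta>. ?k \<theta> * borel_sum \<phi> g (?p \<theta>))"
  proof (rule dominated_convergence(2)[where h="\<lambda>\<theta>. norm (?k \<theta> * 1) * A"])
    show "(\<lambda>\<theta>. ?k \<theta> * ?S n (?p \<theta>)) integrable_on {0..1}" for n
      by (intro integrable_continuous_interval vc hol2_sum iterates(2)[of 1]) simp
    show "(\<lambda>\<theta>. norm (?k \<theta> * 1) * A) integrable_on {0..1}"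
      by (intro integrable_continuous_interval continuous_intros vc hol2_const)
    show "norm (?k \<theta> * ?S n (?p \<theta>)) \<le> norm (?k \<theta> * 1) * A" if "\<theta> \<in> {0..1}" for n \<theta>
      unfolding norm_mult norm_one mult_1_right by (intro mult_left_mono S_le pT that) auto
    show "(\<lambda>n. ?k \<theta> * ?S n (?p \<theta>)) \<longlonglongrightarrow> ?k \<theta> * borel_sum \<phi> g (?p \<theta>)" if "\<theta> \<in> {0..1}" for \<theta>
      by (intro tendsto_intros tendsto_uniform_limitI[OF iterate_uniform_limit[of "norm (fst w)"]] pT that)
  qed
  then have "(\<lambda>n. (1/2) * kern \<phi> g (fst w) (snd w) + volterra \<phi> g (?S n) w) \<longlonglongrightarrow> borel_slope \<phi> g w"
    unfolding borel_slope_def volterra_def by (intro tendsto_intros)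
  \<comment> \<open>Inserting \<open>n\<close> corrections on the right of the equation produces
    \<open>n + 1\<close> slopes: the inhomogeneous term is the slope of index
    \<open>0\<close>.\<close>
  also have "(\<lambda>n. (1/2) * kern \<phi> g (fst w) (snd w) + volterra \<phi> g (?S n) w) = (\<lambda>n. \<Sum>i<Suc n. slope \<phi> g i w)"
  proof
    fix n
    have "volterra \<phi> g (?S n) w = (\<Sum>i<n. volterra \<phi> g (tail_integral (slope \<phi> g i)) w)"
      unfolding volterra_def sum_distrib_left
      by (subst integral_sum) (auto intro!: integrable_continuous_interval vc iterates(2)[of 1] simp: sum_distrib_left simp del: of_real_diff)
    then show "(1/2) * kern \<phi> g (fst w) (snd w) + volterra \<phi> g (?S n) w = (\<Sum>i<Suc n. slope \<phi> g i w)"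
      by (subst sum.lessThan_Suc_shift) simp
  qed
  finally have "(\<lambda>n. \<Sum>i<Suc n. slope \<phi> g i w) \<longlonglongrightarrow> borel_slope \<phi> g w" .
  from LIMSEQ_unique[OF LIMSEQ_Suc[OF g'(2)] this] g'(1) show ?thesis by simp
qed

text \<open>
  With \<open>W = z + \<tau>\<close> fixed, \<open>borel_slope\<close> becomes \<open>exp (\<Phi> (W - t))\<close> times a primitive in \<open>t\<close>, so the
  partial differential equation is an ordinary derivative along the antidiagonal.
\<close>

lemma borel_slope_pde:
  assumes w: "(\<tau>, z) \<in> \<Omega>"
  shows "deriv (\<lambda>t. borel_slope \<phi> g (t, z)) \<tau> - deriv (\<lambda>z. borel_slope \<phi> g (\<tau>, z)) z
     = - \<phi> z * borel_slope \<phi> g (\<tau>, z) + g z * borel_sum \<phi> g (\<tau>, z)"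
proof -
  obtain \<Phi> where \<Phi>: "\<And>z. z \<in> D \<Longrightarrow> (\<Phi> has_field_derivative \<phi> z) (at z)" "\<Phi> holomorphic_on D"
    "\<And>y z. z \<in> D \<Longrightarrow> z + y \<in> D \<Longrightarrow> kern \<phi> g y z = exp (\<Phi> z - \<Phi> (z + y)) * g (z + y)"
    using primitive by metis
  define W where "W = z + \<tau>"
  define T where "T = {t. W - t \<in> D \<and> Re t > - R}"
  have W: "W \<in> D" and \<tau>: "\<tau> \<in> T" using w by (auto simp: W_def T_def \<Omega>_iff)
  have T\<Omega>: "(t, W - t) \<in> \<Omega>" if "t \<in> T" for t
    using that W by (simp add: T_def \<Omega>_iff)
  have oT: "open T"
  proof -
    have "open ((\<lambda>t. W - t) -` D \<inter> {t. Re t > - R})"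
      by (intro open_Int open_vimage open_D open_Collect_less continuous_intros)
    then show ?thesis by (simp add: T_def vimage_def Collect_conj_eq)
  qed
  have cT: "convex T"
  proof -
    have "T = (\<lambda>x. W - x) ` D \<inter> {t. Re t > - R}"
      by (auto simp: T_def image_iff intro!: bexI[of _ "W - _"])
    moreover have "convex ((\<lambda>x. W - x) ` D)"
      using convex_translation[OF convex_negations[OF convex_D], of W] by (simp add: image_image)
    moreover have "convex {t. Re t > - R}"
      using convex_halfspace_Re_gt[of "-R"] by simp
    ultimately show ?thesis by (simp add: convex_Int)
  qed
  \<comment> \<open>The integrand of variation of constants with \<open>W\<close> fixed; as
    \<open>T\<close> is convex and contains \<open>0\<close>, it has a primitive and the Duhamel
    integral becomes \<open>Q t - Q 0\<close>.\<close>
  define q where "q = (\<lambda>v. exp (- \<Phi> (W - v)) * g (W - v) * borel_sum \<phi> g (v, W - v))"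
  have q_hol: "q holomorphic_on T"
    unfolding q_def
  proof (intro holomorphic_intros holomorphic_on_compose_gen[OF _ \<Phi>(2), unfolded o_def] holomorphic_on_compose_gen[OF _ hol_g, unfolded o_def])
    show "(\<lambda>v. borel_sum \<phi> g (v, W - v)) holomorphic_on T"
      unfolding holomorphic_on_open[OF oT]
      using hol2_antidiagonal_derivative[OF borel_sum_hol2 T\<Omega>] by blast
  qed (auto simp: T_def)
  obtain Q where Q': "\<And>v. v \<in> T \<Longrightarrow> (Q has_field_derivative q v) (at v within T)"
    using holomorphic_convex_primitive'[OF cT oT q_hol] by blast
  then have Q: "\<And>v. v \<in> T \<Longrightarrow> (Q has_field_derivative q v) (at v)"
    using at_within_open[OF _ oT] by simp
  have T0: "0 \<in> T" using W R_pos by (simp add: T_def)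
  have formula: "borel_slope \<phi> g (t, W - t) = exp (\<Phi> (W - t)) * ((1/2) * (exp (- \<Phi> W) * g W) + (Q t - Q 0))"
    if t: "t \<in> T" for t
  proof -
    have tD: "W - t \<in> D" using t by (simp add: T_def)
    have seg: "of_real (1 - \<theta>) * t \<in> T" if "\<theta> \<in> {0..1}" for \<theta>
    proof -
      have "(1 - \<theta>) *\<^sub>R t + \<theta> *\<^sub>R 0 \<in> T"
        using cT T0 t that unfolding convex_def by (metis (no_types, lifting) add.commute add_diff_cancel atLeastAtMost_iff diff_add_cancel diff_ge_0_iff_ge)
      then show ?thesis by (simp add: scaleR_conv_of_real)
    qed
    \<comment> \<open>The segment is run through as \<open>v = (1 - \<theta>) t\<close>, from
      \<open>t\<close> down to \<open>0\<close>, hence the sign.\<close>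
    have "((\<lambda>\<theta>. - (t * q (of_real (1 - \<theta>) * t))) has_integral (Q (of_real (1 - 1) * t) - Q (of_real (1 - 0) * t))) {0..1}"
    proof (rule fundamental_theorem_of_calculus)
      fix \<theta> :: real assume \<theta>: "\<theta> \<in> {0..1}"
      have "((\<lambda>s. Q ((1 - s) * t)) has_field_derivative q ((1 - of_real \<theta>) * t) * (- t)) (at (of_real \<theta>))"
        by (rule DERIV_chain2[OF Q]) (use seg[OF \<theta>] in \<open>auto intro!: derivative_eq_intros\<close>)
      from has_vector_derivative_real_field[OF this]
      show "((\<lambda>\<theta>. Q (of_real (1 - \<theta>) * t)) has_vector_derivative - (t * q (of_real (1 - \<theta>) * t))) (at \<theta> within {0..1})"
        by (simp add: mult.commute)
    qed simp
    from integral_unique[OF this]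
    have I: "t * integral {0..1} (\<lambda>\<theta>. q (of_real (1 - \<theta>) * t)) = Q t - Q 0"
      by simp (simp add: algebra_simps)
    have "integral {0..1} (\<lambda>\<theta>. kern \<phi> g (of_real \<theta> * t) (W - t) * borel_sum \<phi> g (of_real (1 - \<theta>) * t, W - t + of_real \<theta> * t))
        = integral {0..1} (\<lambda>\<theta>. exp (\<Phi> (W - t)) * q (of_real (1 - \<theta>) * t))"
    proof (rule integral_cong)
      fix \<theta> :: real assume \<theta>: "\<theta> \<in> {0..1}"
      have e: "W - t + of_real \<theta> * t = W - of_real (1 - \<theta>) * t" by (simp add: algebra_simps)
      have "W - of_real (1 - \<theta>) * t \<in> D" using seg[OF \<theta>] by (simp add: T_def)
      then show "kern \<phi> g (of_real \<theta> * t) (W - t) * borel_sum \<phi> g (of_real (1 - \<theta>) * t, W - t + of_real \<theta> * t)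
          = exp (\<Phi> (W - t)) * q (of_real (1 - \<theta>) * t)"
        using \<Phi>(3)[OF tD, of "of_real \<theta> * t"] unfolding e q_def
        by (simp add: exp_diff exp_minus field_simps)
    qed
    then have "volterra \<phi> g (borel_sum \<phi> g) (t, W - t) = exp (\<Phi> (W - t)) * (t * integral {0..1} (\<lambda>\<theta>. q (of_real (1 - \<theta>) * t)))"
      unfolding volterra_def fst_conv snd_conv by simp
    moreover have "kern \<phi> g t (W - t) = exp (\<Phi> (W - t)) * (exp (- \<Phi> W) * g W)"
      using \<Phi>(3)[OF tD, of t] W by (simp add: exp_diff exp_minus field_simps)
    ultimately show ?thesis
      unfolding borel_slope_def fst_conv snd_conv I by (simp add: algebra_simps)
  qed
  have d: "((\<lambda>t. exp (\<Phi> (W - t)) * ((1/2) * (exp (- \<Phi> W) * g W) + (Q t - Q 0))) has_field_derivative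
       (exp (\<Phi> (W - \<tau>)) * (\<phi> (W - \<tau>) * (- 1))) * ((1/2) * (exp (- \<Phi> W) * g W) + (Q \<tau> - Q 0)) + exp (\<Phi> (W - \<tau>)) * q \<tau>) (at \<tau>)"
  proof -
    have "((\<lambda>t. \<Phi> (W - t)) has_field_derivative \<phi> (W - \<tau>) * (- 1)) (at \<tau>)"
      by (rule DERIV_chain2[OF \<Phi>(1)]) (use \<tau> in \<open>auto simp: T_def intro!: derivative_eq_intros\<close>)
    then show ?thesis
      using Q[OF \<tau>] by (auto intro!: derivative_eq_intros simp: algebra_simps)
  qed
  have "((\<lambda>t. borel_slope \<phi> g (t, W - t)) has_field_derivative
       (exp (\<Phi> (W - \<tau>)) * (\<phi> (W - \<tau>) * (- 1))) * ((1/2) * (exp (- \<Phi> W) * g W) + (Q \<tau> - Q 0)) + exp (\<Phi> (W - \<tau>)) * q \<tau>) (at \<tau>)"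
    by (rule has_field_derivative_transform_within_open[OF d oT \<tau>]) (simp add: formula)
  from DERIV_unique[OF hol2_antidiagonal_derivative[OF borel_slope_hol2 T\<Omega>[OF \<tau>]] this]
  have "deriv (\<lambda>t. borel_slope \<phi> g (t, W - \<tau>)) \<tau> - deriv (\<lambda>z. borel_slope \<phi> g (\<tau>, z)) (W - \<tau>)
     = (exp (\<Phi> (W - \<tau>)) * (\<phi> (W - \<tau>) * (- 1))) * ((1/2) * (exp (- \<Phi> W) * g W) + (Q \<tau> - Q 0)) + exp (\<Phi> (W - \<tau>)) * q \<tau>" .
  also have "\<dots> = - \<phi> (W - \<tau>) * borel_slope \<phi> g (\<tau>, W - \<tau>) + g (W - \<tau>) * borel_sum \<phi> g (\<tau>, W - \<tau>)"
    unfolding formula[OF \<tau>] q_def by (simp add: exp_minus field_simps)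
  finally show ?thesis by (simp add: W_def)
qed

end

text \<open>The iterates at \<open>(\<tau>, z)\<close> see the data only on the set of all \<open>z + \<theta> \<tau> + x\<close>; this is what
  makes the constructions in different charts agree.\<close>

lemma slope_cong:
  assumes K: "convex K" "\<And>z x. z \<in> K \<Longrightarrow> x \<ge> 0 \<Longrightarrow> z + of_real x \<in> K"
    and eq: "\<And>z. z \<in> K \<Longrightarrow> \<phi> z = \<phi>' z" "\<And>z. z \<in> K \<Longrightarrow> g z = g' z"
    and w: "snd w \<in> K" "snd w + fst w \<in> K"
  shows "slope \<phi> g n w = slope \<phi>' g' n w"
proof -
  have kern: "kern \<phi> g y z = kern \<phi>' g' y z" if "z \<in> K" "z + y \<in> K" for y z
  proof -
    have "integral {0..1} (\<lambda>t. \<phi> (z + of_real t * y)) = integral {0..1} (\<lambda>t. \<phi>' (z + of_real t * y))"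
      by (rule integral_cong) (use that in \<open>auto intro!: eq convex_segment_mem[OF K(1)]\<close>)
    then show ?thesis using that by (simp add: kern_def eq)
  qed
  show ?thesis using w
  proof (induction n arbitrary: w)
    case 0
    then show ?case by (simp add: kern)
  next
    case (Suc n)
    have "volterra \<phi> g (tail_integral (slope \<phi> g n)) w = volterra \<phi>' g' (tail_integral (slope \<phi>' g' n)) w"
      unfolding volterra_def
    proof (intro arg_cong2[where f="(*)"] refl integral_cong)
      fix \<theta> :: real assume \<theta>: "\<theta> \<in> {0..1}"
      have 1: "snd w + of_real \<theta> * fst w \<in> K"
        using \<theta> Suc.prems by (intro convex_segment_mem[OF K(1)]) auto
      show "kern \<phi> g (of_real \<theta> * fst w) (snd w) = kern \<phi>' g' (of_real \<theta> * fst w) (snd w)"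
        using 1 Suc.prems by (intro kern) auto
      have 2: "snd w + of_real \<theta> * fst w + of_real (1 - \<theta>) * fst w = snd w + fst w"
        by (simp add: algebra_simps)
      show "tail_integral (slope \<phi> g n) (of_real (1 - \<theta>) * fst w, snd w + of_real \<theta> * fst w)
          = tail_integral (slope \<phi>' g' n) (of_real (1 - \<theta>) * fst w, snd w + of_real \<theta> * fst w)"
        unfolding tail_integral_def fst_conv snd_conv
      proof (intro arg_cong[where f=uminus] integral_cong Suc.IH)
        fix x :: real assume x: "x \<in> {0..}"
        show "snd (of_real (1 - \<theta>) * fst w, snd w + of_real \<theta> * fst w + of_real x) \<in> K"
          using x K(2)[OF 1] by simp
        have "snd w + of_real \<theta> * fst w + of_real x + of_real (1 - \<theta>) * fst w = snd w + fst w + of_real x"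
          using 2 by (simp add: algebra_simps)
        then show "snd (of_real (1 - \<theta>) * fst w, snd w + of_real \<theta> * fst w + of_real x)
             + fst (of_real (1 - \<theta>) * fst w, snd w + of_real \<theta> * fst w + of_real x) \<in> K"
          using x K(2)[OF Suc.prems(2)] by (simp only: fst_conv snd_conv) simp
      qed
    qed
    then show ?case by simp
  qed
qed

lemma borel_sum_cong:
  assumes K: "convex K" "\<And>z x. z \<in> K \<Longrightarrow> x \<ge> 0 \<Longrightarrow> z + of_real x \<in> K"
    and eq: "\<And>z. z \<in> K \<Longrightarrow> \<phi> z = \<phi>' z" "\<And>z. z \<in> K \<Longrightarrow> g z = g' z"
    and w: "z \<in> K" "z + \<tau> \<in> K"
  shows "borel_sum \<phi> g (\<tau>, z) = borel_sum \<phi>' g' (\<tau>, z)"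
proof -
  have "tail_integral (slope \<phi> g n) (\<tau>, z) = tail_integral (slope \<phi>' g' n) (\<tau>, z)" for n
    unfolding tail_integral_def fst_conv snd_conv
  proof (intro arg_cong[where f=uminus] integral_cong slope_cong[OF K eq])
    fix x :: real assume x: "x \<in> {0..}"
    show "snd (\<tau>, z + of_real x) \<in> K" using x K(2)[OF w(1)] by simp
    show "snd (\<tau>, z + of_real x) + fst (\<tau>, z + of_real x) \<in> K"
      using x K(2)[OF w(2)] by (simp add: add_ac)
  qed
  then show ?thesis by (simp add: borel_sum_def)
qed

context right_strip
begin

lemma \<Omega>_real: "z \<in> D \<Longrightarrow> t \<ge> 0 \<Longrightarrow> (of_real t / 2, z) \<in> \<Omega>"
  using right_D[of z "t / 2"] R_pos by (simp add: \<Omega>_iff)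

definition K :: "real \<Rightarrow> real" where
  "K \<sigma> = 1/2 * B \<sigma> * exp (B \<sigma> * M / \<sigma>)"

lemma K_pos: "K \<sigma> > 0"
  using B_pos[of \<sigma>] by (simp add: K_def)

text \<open>The argument \<open>t / 2\<close> halves the rate \<open>2 * \<sigma>\<close> of
  \<open>borel_sum_bound\<close>.\<close>

lemma borel_sum_real_bound:
  assumes "z \<in> D" "t \<ge> 0" "\<sigma> > 0"
  shows "norm (borel_sum \<phi> g (of_real t / 2, z)) \<le> K \<sigma> * M * exp (\<sigma> * t)"
proof -
  have "norm (borel_sum \<phi> g (of_real t / 2, z)) \<le> K \<sigma> * G (m (of_real t / 2, z)) * exp (2 * \<sigma> * norm (of_real t / 2 :: complex))"
    using borel_sum_bound[OF assms(3) \<Omega>_real[OF assms(1,2)]] by (simp add: K_def)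
  also have "\<dots> \<le> K \<sigma> * M * exp (\<sigma> * t)"
    using assms K_pos[of \<sigma>] by (intro mult_mono mult_left_mono G_le) (auto intro!: mult_nonneg_nonneg M_nonneg simp: norm_divide)
  finally show ?thesis .
qed

section \<open>The Laplace transform of the Borel transform\<close>

definition lap :: "complex \<Rightarrow> complex \<Rightarrow> complex" where
  "lap u z = integral {0..} (\<lambda>t. exp (- u * of_real t) * borel_sum \<phi> g (of_real t / 2, z))"

definition lap' :: "complex \<Rightarrow> complex \<Rightarrow> complex" where
  "lap' u z = integral {0..} (\<lambda>t. exp (- u * of_real t) * borel_slope \<phi> g (of_real t / 2, z))"

lemma real_slice_continuous:
  assumes "hol2 f \<Omega>"
  shows "continuous_on ({0..} \<times> D) (\<lambda>(t, z). f (of_real t / 2, z))"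
  unfolding split_beta
  by (rule continuous_on_compose2[OF hol2_imp_continuous_on[OF assms]])
    (auto intro!: continuous_intros \<Omega>_real)

lemma real_slice_continuous':
  assumes "hol2 f \<Omega>" "z \<in> D"
  shows "continuous_on {0..} (\<lambda>t. f (of_real t / 2, z))"
  by (rule continuous_on_compose2[OF hol2_imp_continuous_on[OF assms(1)]])
    (use assms in \<open>auto intro!: continuous_intros \<Omega>_real\<close>)

lemma real_slice_holomorphic:
  assumes "hol2 f \<Omega>" "t \<ge> 0"
  shows "(\<lambda>z. f (of_real t / 2, z)) holomorphic_on D"
  using assms by (intro hol2_slice_holomorphic(2)[OF assms(1)] \<Omega>_real)

lemma borel_sum_deriv_eq: "(\<tau>, z) \<in> \<Omega> \<Longrightarrow> deriv (\<lambda>z. borel_sum \<phi> g (\<tau>, z)) z = borel_slope \<phi> g (\<tau>, z)"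
  using borel_sum_derivative[of "(\<tau>, z)"] by (simp add: DERIV_imp_deriv)

lemma lap_has_integral:
  assumes "z \<in> D" "Re u > 0"
  shows "((\<lambda>t. exp (- u * of_real t) * borel_sum \<phi> g (of_real t / 2, z)) has_integral lap u z) {0..}"
  unfolding lap_def
  using laplace_bounds(1)[OF real_slice_continuous'[OF borel_sum_hol2 assms(1)] borel_sum_real_bound[OF assms(1)], of "Re u / 2" u] assms
  by (intro integrable_integral) auto

lemma lap_hol2: "hol2 (\<lambda>w. lap (fst w) (snd w)) ({u. Re u > 0} \<times> D)"
  unfolding lap_def
proof (rule hol2_improper_integral)
  show "open ({u. Re u > 0} \<times> D)"
    by (intro open_Times open_D open_halfspace_Re_gt)
  have "continuous_on (({u. Re u > 0} \<times> D) \<times> {0..}) (\<lambda>q. borel_sum \<phi> g (of_real (snd q) / 2, snd (fst q)))"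
    by (rule continuous_on_compose2[OF hol2_imp_continuous_on[OF borel_sum_hol2]])
      (auto intro!: continuous_intros \<Omega>_real)
  then show "continuous_on (({u. Re u > 0} \<times> D) \<times> {0..})
      (\<lambda>(w, t). exp (- fst w * of_real t) * borel_sum \<phi> g (of_real t / 2, snd w))"
    unfolding split_beta by (intro continuous_intros)
  show "hol2 (\<lambda>w. exp (- fst w * of_real t) * borel_sum \<phi> g (of_real t / 2, snd w)) ({u. Re u > 0} \<times> D)"
    if "t \<ge> 0" for t
    using that by (intro hol2_mult hol2_compose_holomorphic[OF holomorphic_on_exp open_UNIV]
        hol2_compose[OF borel_sum_hol2] hol2_minus hol2_fst hol2_snd hol2_const) (auto intro: \<Omega>_real)
next
  fix w assume w: "w \<in> {u. Re u > 0} \<times> D"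
  \<comment> \<open>Growth rate \<delta> on the neighbourhood \<open>Re u > 2 * \<delta>\<close>
    leaves a gap of at least \<delta>, so all tails decay at a common rate.\<close>
  define \<delta> where "\<delta> = Re (fst w) / 4"
  have \<delta>: "\<delta> > 0" using w by (auto simp: \<delta>_def)
  define A where "A = {u. Re u > 2 * \<delta>} \<times> D"
  define e where "e = (\<lambda>n. K \<delta> * M / \<delta> * exp (- \<delta> * real n))"
  have "open A" unfolding A_def by (intro open_Times open_D open_halfspace_Re_gt)
  moreover have "w \<in> A" "A \<subseteq> {u. Re u > 0} \<times> D"
    using w \<delta> by (auto simp: A_def \<delta>_def)
  moreover have "e \<longlonglongrightarrow> 0"
  proof -
    have "(\<lambda>n. exp (- \<delta> * real n)) \<longlonglongrightarrow> 0" using \<delta> by real_asymp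
    then show ?thesis unfolding e_def by (rule tendsto_mult_right_zero)
  qed
  moreover have "norm (integral {0..} (\<lambda>t. exp (- fst v * of_real t) * borel_sum \<phi> g (of_real t / 2, snd v)) -
      integral {0..real n} (\<lambda>t. exp (- fst v * of_real t) * borel_sum \<phi> g (of_real t / 2, snd v))) \<le> e n"
    if v: "v \<in> A" for v n
  proof -
    have vD: "snd v \<in> D" and vu: "Re (fst v) > 2 * \<delta>" using v by (auto simp: A_def)
    then have u: "Re (fst v) > \<delta>" using \<delta> by simp
    have "norm (integral {0..} (\<lambda>t. exp (- fst v * of_real t) * borel_sum \<phi> g (of_real t / 2, snd v)) -
      integral {0..real n} (\<lambda>t. exp (- fst v * of_real t) * borel_sum \<phi> g (of_real t / 2, snd v)))
      \<le> K \<delta> * M / (Re (fst v) - \<delta>) * exp (- (Re (fst v) - \<delta>) * real n)"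
      by (rule laplace_bounds(3)[OF real_slice_continuous'[OF borel_sum_hol2 vD] borel_sum_real_bound[OF vD] u]) (use \<delta> in auto)
    also have "(\<delta> - Re (fst v)) * real n \<le> (- \<delta>) * real n"
      using vu by (intro mult_right_mono) auto
    then have "K \<delta> * M / (Re (fst v) - \<delta>) * exp (- (Re (fst v) - \<delta>) * real n) \<le> e n"
      unfolding e_def using \<delta> vu K_pos[of \<delta>] M_nonneg
      by (intro mult_mono divide_left_mono) (auto intro!: mult_nonneg_nonneg divide_nonneg_nonneg mult_pos_pos mult_right_mono)
    finally show ?thesis .
  qed
  ultimately show "\<exists>A e. open A \<and> w \<in> A \<and> A \<subseteq> {u. Re u > 0} \<times> D \<and> e \<longlonglongrightarrow> 0 \<and>
     (\<forall>v\<in>A. \<forall>n. norm (integral {0..} (\<lambda>t. exp (- fst v * of_real t) * borel_sum \<phi> g (of_real t / 2, snd v)) -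
      integral {0..real n} (\<lambda>t. exp (- fst v * of_real t) * borel_sum \<phi> g (of_real t / 2, snd v))) \<le> e n)"
    by blast
qed

lemma borel_slope_0: "z \<in> D \<Longrightarrow> borel_slope \<phi> g (0, z) = (1/2) * g z"
  by (simp add: borel_slope_def volterra_def kern_def)

lemma cauchy_derivative_bound:
  assumes "f holomorphic_on D" "cball z r \<subseteq> D" "r > 0" "\<And>x. x \<in> cball z r \<Longrightarrow> norm (f x) \<le> c"
  shows "norm (deriv f z) \<le> c / r"
proof -
  have "norm ((deriv ^^ 1) f z) \<le> fact 1 * c / r ^ 1"
  proof (rule Cauchy_inequality)
    show "f holomorphic_on ball z r" "continuous_on (cball z r) f"
      using holomorphic_on_subset[OF assms(1,2)] ball_subset_cball[of z r]
      by (auto intro: holomorphic_on_imp_continuous_on holomorphic_on_subset)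
    show "norm (f x) \<le> c" if "norm (z - x) = r" for x
      using that assms(4) by (simp add: dist_norm)
  qed (use assms in auto)
  then show ?thesis by simp
qed

text \<open>The second claim is the Laplace transform of \<open>borel_slope_pde\<close>: integration
  by parts turns the \<open>t\<close>-derivative into multiplication by \<open>u\<close>, and twice
  the boundary value \<open>g z / 2\<close> supplies the \<open>1\<close> in
  \<open>1 + lap u z\<close>.\<close>

lemma lap_derivatives:
  assumes z: "z \<in> D" and u: "Re u > 0"
  shows "(lap u has_field_derivative lap' u z) (at z)"
    and "(lap' u has_field_derivative ((2 * u + \<phi> z) * lap' u z - g z * (1 + lap u z))) (at z)"
proof -
  define \<sigma> where "\<sigma> = Re u / 2"
  have \<sigma>: "\<sigma> > 0" and u\<sigma>: "Re u > \<sigma>" using u by (auto simp: \<sigma>_def)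
  have "((\<lambda>z. integral {0..} (\<lambda>t. exp (- u * of_real t) * borel_sum \<phi> g (of_real t / 2, z))) has_field_derivative
      integral {0..} (\<lambda>t. exp (- u * of_real t) * deriv (\<lambda>z. borel_sum \<phi> g (of_real t / 2, z)) z)) (at z)"
    by (rule laplace_field_derivative[OF open_D real_slice_continuous[OF borel_sum_hol2] real_slice_holomorphic[OF borel_sum_hol2]
        borel_sum_real_bound[OF _ _ \<sigma>] u\<sigma> z])
  also have "integral {0..} (\<lambda>t. exp (- u * of_real t) * deriv (\<lambda>z. borel_sum \<phi> g (of_real t / 2, z)) z) = lap' u z"
    unfolding lap'_def by (rule integral_cong) (use z in \<open>auto simp: borel_sum_deriv_eq \<Omega>_real\<close>)
  finally show "(lap u has_field_derivative lap' u z) (at z)"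
    by (simp add: lap_def[abs_def])
  \<comment> \<open>Room for two successive Cauchy estimates with radius \<open>r / 2\<close>: for
    the slope on \<open>cball z r\<close>, then for its derivative at \<open>z\<close>.\<close>
  obtain r where r: "r > 0" "cball z (2 * r) \<subseteq> D"
  proof -
    obtain r where "r > 0" "cball z r \<subseteq> D" using open_D z open_contains_cball by blast
    then show ?thesis using that[of "r / 2"] by simp
  qed
  define Z where "Z = ball z (r / 2)"
  have Zz: "z \<in> Z" "open Z" "Z \<subseteq> D" using r by (auto simp: Z_def dest!: subsetD)
  have cb: "cball x (r / 2) \<subseteq> D" if "x \<in> cball z r" for x
  proof
    fix y assume "y \<in> cball x (r / 2)"
    then have "dist z y \<le> r + r / 2"
      using dist_triangle[of z y x] that by simp
    then show "y \<in> D" using r by auto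
  qed
  define c1 where "c1 = K \<sigma> * M / (r / 2)"
  have S_le: "norm (borel_slope \<phi> g (of_real t / 2, x)) \<le> c1 * exp (\<sigma> * t)" if t: "t \<ge> 0" and x: "x \<in> cball z r" for t x
  proof -
    have xD: "x \<in> D" using cb[OF x] r by auto
    have "norm (deriv (\<lambda>z. borel_sum \<phi> g (of_real t / 2, z)) x) \<le> K \<sigma> * M * exp (\<sigma> * t) / (r / 2)"
      using cb[OF x] r t by (intro cauchy_derivative_bound real_slice_holomorphic borel_sum_hol2 borel_sum_real_bound \<sigma>) auto
    then show ?thesis using xD t by (simp add: borel_sum_deriv_eq \<Omega>_real c1_def mult_ac)
  qed
  define c2 where "c2 = c1 / (r / 2)"
  have Sz_le: "norm (deriv (\<lambda>z. borel_slope \<phi> g (of_real t / 2, z)) z) \<le> c2 * exp (\<sigma> * t)" if t: "t \<ge> 0" for t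
  proof -
    have "norm (deriv (\<lambda>z. borel_slope \<phi> g (of_real t / 2, z)) z) \<le> c1 * exp (\<sigma> * t) / (r / 2)"
      using cb[of z] r t by (intro cauchy_derivative_bound real_slice_holomorphic borel_slope_hol2 S_le) auto
    then show ?thesis by (simp add: c2_def mult_ac)
  qed
  have D2: "(lap' u has_field_derivative integral {0..} (\<lambda>t. exp (- u * of_real t) * deriv (\<lambda>z. borel_slope \<phi> g (of_real t / 2, z)) z)) (at z)"
    unfolding lap'_def[abs_def]
  proof (rule laplace_field_derivative[OF Zz(2) _ _ _ u\<sigma> Zz(1)])
    show "continuous_on ({0..} \<times> Z) (\<lambda>(t, z). borel_slope \<phi> g (of_real t / 2, z))"
      using Zz by (intro continuous_on_subset[OF real_slice_continuous[OF borel_slope_hol2]]) auto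
    show "(\<lambda>z. borel_slope \<phi> g (of_real t / 2, z)) holomorphic_on Z" if "t \<ge> 0" for t :: real
      using that Zz by (intro holomorphic_on_subset[OF real_slice_holomorphic[OF borel_slope_hol2]]) auto
    show "norm (borel_slope \<phi> g (of_real t / 2, x)) \<le> c1 * exp (\<sigma> * t)" if "t \<ge> 0" "x \<in> Z" for t x
      using that r by (intro S_le) (auto simp: Z_def)
  qed
  define Sz where "Sz = (\<lambda>t::real. deriv (\<lambda>z. borel_slope \<phi> g (of_real t / 2, z)) z)"
  define S where "S = (\<lambda>t::real. borel_slope \<phi> g (of_real t / 2, z))"
  define f where "f = (\<lambda>t::real. borel_sum \<phi> g (of_real t / 2, z))"
  have Sz_cont: "continuous_on {0..} Sz"
  proof -
    have "continuous_on ({0..} \<times> D) (\<lambda>(t, z). (deriv ^^ 1) (\<lambda>z. borel_slope \<phi> g (of_real t / 2, z)) z)"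
      by (intro continuous_on_higher_deriv_param open_D real_slice_continuous[OF borel_slope_hol2] real_slice_holomorphic[OF borel_slope_hol2]) auto
    then have c: "continuous_on ({0..} \<times> D) (\<lambda>(t, z). deriv (\<lambda>z. borel_slope \<phi> g (of_real t / 2, z)) z)" by simp
    show ?thesis unfolding Sz_def
      by (rule continuous_on_compose2[OF c, where f="\<lambda>t. (t, z)", unfolded split_beta fst_conv snd_conv])
        (use z in \<open>auto intro!: continuous_intros\<close>)
  qed
  have S_cont: "continuous_on {0..} S" "continuous_on {0..} f"
    unfolding S_def f_def
    by (rule real_slice_continuous'[OF borel_slope_hol2 z], rule real_slice_continuous'[OF borel_sum_hol2 z])
  \<comment> \<open>The factor \<open>1/2\<close> is the derivative of \<open>t / 2\<close>;
    clearing it is what produces the coefficient \<open>2 * u\<close>.\<close>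
  have S_der: "(S has_vector_derivative (1/2) * (Sz t + (- \<phi> z * S t + g z * f t))) (at t)" if t: "t \<ge> 0" for t
  proof -
    have w: "(of_real t / 2, z) \<in> \<Omega>" using \<Omega>_real[OF z t] .
    have "((\<lambda>\<tau>. borel_slope \<phi> g (\<tau>, z)) has_field_derivative deriv (\<lambda>\<tau>. borel_slope \<phi> g (\<tau>, z)) (of_real t / 2)) (at (of_real t / 2))"
      using hol2_slice(1)[OF borel_slope_hol2 w] by (rule field_differentiable_derivI)
    also have "deriv (\<lambda>\<tau>. borel_slope \<phi> g (\<tau>, z)) (of_real t / 2) = Sz t + (- \<phi> z * S t + g z * f t)"
      using borel_slope_pde[OF w] unfolding Sz_def S_def f_def by (simp add: diff_eq_eq add.commute)
    finally have "((\<lambda>s. borel_slope \<phi> g (s / 2, z)) has_field_derivative (Sz t + (- \<phi> z * S t + g z * f t)) * (1/2)) (at (of_real t))"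
      by (rule DERIV_chain2) (auto intro!: derivative_eq_intros)
    from has_vector_derivative_real_field[OF this] show ?thesis
      by (simp add: S_def mult.commute)
  qed
  have Sz_le': "norm (Sz t) \<le> c2 * exp (\<sigma> * t)" if "t \<ge> 0" for t
    unfolding Sz_def by (rule Sz_le[OF that])
  have f_le: "norm (f t) \<le> K \<sigma> * M * exp (\<sigma> * t)" if "t \<ge> 0" for t
    unfolding f_def by (rule borel_sum_real_bound[OF z that \<sigma>])
  have S_le': "norm (S t) \<le> c1 * exp (\<sigma> * t)" if "t \<ge> 0" for t
    unfolding S_def using r that by (intro S_le) auto
  define c3 where "c3 = (1/2) * (c2 + (norm (\<phi> z) * c1 + norm (g z) * (K \<sigma> * M)))"
  have S'_le: "norm ((1/2) * (Sz t + (- \<phi> z * S t + g z * f t))) \<le> c3 * exp (\<sigma> * t)" if t: "t \<ge> 0" for t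
  proof -
    have "norm ((1/2) * (Sz t + (- \<phi> z * S t + g z * f t))) = (1/2) * norm (Sz t + (- \<phi> z * S t + g z * f t))"
      by (simp add: norm_mult)
    also have "\<dots> \<le> (1/2) * (norm (Sz t) + (norm (\<phi> z) * norm (S t) + norm (g z) * norm (f t)))"
      by (intro mult_left_mono norm_triangle_le add_mono) (auto simp: norm_mult)
    also have "\<dots> \<le> (1/2) * (c2 * exp (\<sigma> * t) + (norm (\<phi> z) * (c1 * exp (\<sigma> * t)) + norm (g z) * (K \<sigma> * M * exp (\<sigma> * t))))"
      using t by (intro mult_left_mono add_mono f_le S_le') (auto simp: Sz_def Sz_le)
    also have "\<dots> = c3 * exp (\<sigma> * t)" by (simp add: c3_def algebra_simps)
    finally show ?thesis .
  qed
  let ?L = "\<lambda>h. integral {0..} (\<lambda>t. exp (- u * of_real t) * h t)"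
  have L: "?L (\<lambda>t. (1/2) * (Sz t + (- \<phi> z * S t + g z * f t))) = u * ?L S - S 0"
    by (rule laplace_vector_derivative[OF S_der _ S_le' S'_le u\<sigma>]; (assumption | intro continuous_intros Sz_cont S_cont))
  have I: "(\<lambda>t. exp (- u * of_real t) * Sz t) integrable_on {0..}"
    "(\<lambda>t. exp (- u * of_real t) * S t) integrable_on {0..}"
    "(\<lambda>t. exp (- u * of_real t) * f t) integrable_on {0..}"
    by (rule laplace_bounds(1)[OF Sz_cont Sz_le' u\<sigma>], assumption,
        rule laplace_bounds(1)[OF S_cont(1) S_le' u\<sigma>], assumption,
        rule laplace_bounds(1)[OF S_cont(2) f_le u\<sigma>], assumption)
  have "?L (\<lambda>t. (1/2) * (Sz t + (- \<phi> z * S t + g z * f t))) = (1/2) * (?L Sz + (- \<phi> z * ?L S + g z * ?L f))"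
  proof (rule integral_unique)
    have "((\<lambda>t. (1/2) * (exp (- u * of_real t) * Sz t + (- \<phi> z * (exp (- u * of_real t) * S t) + g z * (exp (- u * of_real t) * f t))))
       has_integral (1/2) * (?L Sz + (- \<phi> z * ?L S + g z * ?L f))) {0..}"
      by (intro has_integral_mult_right has_integral_add integrable_integral I)
    then show "((\<lambda>t. exp (- u * of_real t) * ((1/2) * (Sz t + (- \<phi> z * S t + g z * f t)))) has_integral (1/2) * (?L Sz + (- \<phi> z * ?L S + g z * ?L f))) {0..}"
      by (simp add: algebra_simps)
  qed
  then have e: "(1/2) * (?L Sz + (- \<phi> z * ?L S + g z * ?L f)) = u * ?L S - S 0"
    using L by (rule trans[OF sym])
  have "X = 2 * (u * Y - s) + a * Y - b * Z" if "(1/2) * (X + (- a * Y + b * Z)) = u * Y - s" for X Y Z s a b :: complex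
  proof -
    have "X = 2 * ((1/2) * (X + (- a * Y + b * Z))) + a * Y - b * Z"
      by (simp add: field_simps)
    then show ?thesis unfolding that .
  qed
  from this[OF e] have "?L Sz = 2 * (u * ?L S - S 0) + \<phi> z * ?L S - g z * ?L f" .
  also have "S 0 = (1/2) * g z" using borel_slope_0[OF z] by (simp add: S_def)
  also have "?L S = lap' u z" by (simp add: S_def lap'_def)
  also have "?L f = lap u z" by (simp add: f_def lap_def)
  finally have "?L Sz = (2 * u + \<phi> z) * lap' u z - g z * (1 + lap u z)"
    by (simp add: algebra_simps)
  with D2 show "(lap' u has_field_derivative ((2 * u + \<phi> z) * lap' u z - g z * (1 + lap u z))) (at z)"
    by (simp add: Sz_def)
qed

end

section \<open>The recursion for the Taylor coefficients\<close>

text \<open>What the recursion requires beyond the construction: its integrand is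
  \<open>g + \<phi>'\<close>, and a boundary term with \<phi> has to vanish at infinity.\<close>

locale wkb_strip = right_strip +
  assumes d\<phi>_bound: "\<And>z. z \<in> D \<Longrightarrow> norm (deriv \<phi> z) \<le> \<gamma> (Re z)"
    and \<phi>_lim: "\<And>z. z \<in> D \<Longrightarrow> ((\<lambda>x. \<phi> (z + of_real x)) \<longlongrightarrow> 0) at_top"
begin

text \<open>This is to become the coefficient with index \<open>n + 1\<close>: the Laplace transform
  of \<open>t^n / n!\<close> is \<open>u^(-n-1)\<close>. The derivatives are in \<open>t\<close>,
  not in \<open>\<tau> = t / 2\<close>.\<close>

definition coeff :: "nat \<Rightarrow> complex \<Rightarrow> complex" where
  "coeff n z = (deriv ^^ n) (\<lambda>t. borel_sum \<phi> g (t / 2, z)) 0"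

text \<open>The fundamental theorem from \<open>z\<close> to infinity, where \<open>c\<close>
  vanishes; convergence follows from the majorant \<open>2 * \<gamma>\<close> of
  \<open>g + \<phi>'\<close>.\<close>

lemma half_plane_tail_integral:
  assumes z: "z \<in> D" and c: "\<And>z. z \<in> D \<Longrightarrow> (c has_field_derivative (1/2) * ((g z + deriv \<phi> z) * a z)) (at z)"
    and a: "continuous_on D a" and bnd: "\<And>x. x \<ge> 0 \<Longrightarrow> norm (a (z + of_real x)) \<le> A"
    and lim: "((\<lambda>x. c (z + of_real x)) \<longlongrightarrow> 0) at_top"
  shows "c z = - (1/2) * integral {0..} (\<lambda>x. (g (z + of_real x) + deriv \<phi> (z + of_real x)) * a (z + of_real x))"
proof -
  let ?k = "\<lambda>x. (g (z + of_real x) + deriv \<phi> (z + of_real x)) * a (z + of_real x)"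
  have A: "A \<ge> 0" using bnd[of 0] norm_ge_zero order_trans by blast
  have cont: "continuous_on {0..} ?k"
  proof -
    have d: "continuous_on D (\<lambda>z. (g z + deriv \<phi> z) * a z)"
      by (intro continuous_intros a holomorphic_on_imp_continuous_on hol_g holomorphic_deriv hol_\<phi> open_D)
    show ?thesis
      by (rule continuous_on_compose2[OF d, where f="\<lambda>x. z + of_real x"]) (use z right_D in \<open>auto intro!: continuous_intros\<close>)
  qed
  have \<mu>: "((\<lambda>x. 2 * A * G (Re z + x)) has_real_derivative - (2 * A * \<gamma> (Re z + x))) (at x)" for x
  proof -
    have "((\<lambda>x. G (Re z + x)) has_real_derivative - \<gamma> (Re z + x) * 1) (at x)"
      by (rule DERIV_chain2[OF G_deriv]) (auto intro!: derivative_eq_intros)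
    from DERIV_cmult[OF this, of "2 * A"] show ?thesis by simp
  qed
  have le: "norm (?k x) \<le> 2 * A * \<gamma> (Re z + x)" if x: "x \<ge> 0" for x
  proof -
    have zx: "z + of_real x \<in> D" using right_D[OF z x] .
    have "norm (g (z + of_real x)) \<le> \<gamma> (Re z + x)"
      using g_bound[OF zx, of 0] R_pos by simp
    moreover have "norm (deriv \<phi> (z + of_real x)) \<le> \<gamma> (Re z + x)"
      using d\<phi>_bound[OF zx] by simp
    ultimately have "norm (g (z + of_real x) + deriv \<phi> (z + of_real x)) \<le> 2 * \<gamma> (Re z + x)"
      using norm_triangle_ineq[of "g (z + of_real x)" "deriv \<phi> (z + of_real x)"] by linarith
    then have "norm (?k x) \<le> 2 * \<gamma> (Re z + x) * A"
      unfolding norm_mult using bnd[OF x] \<gamma>_nonneg by (intro mult_mono) auto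
    then show ?thesis by (simp add: mult_ac)
  qed
  have l: "((\<lambda>x. 2 * A * G (Re z + x)) \<longlongrightarrow> 0) at_top"
  proof -
    have "((\<lambda>x. G (Re z + x)) \<longlongrightarrow> 0) at_top"
      by (rule filterlim_compose[OF G_lim]) real_asymp
    then show ?thesis by (rule tendsto_mult_right_zero)
  qed
  have L: "(\<lambda>n. integral {0..real n} ?k) \<longlonglongrightarrow> integral {0..} ?k"
    by (rule improper_integral_dominated(4)[OF cont \<mu> le l])
  have I: "integral {0..real n} ?k = 2 * (c (z + of_real (real n)) - c z)" for n
  proof -
    have "(?k has_integral (2 * c (z + of_real (real n)) - 2 * c (z + of_real 0))) {0..real n}"
    proof (rule fundamental_theorem_of_calculus)
      fix x :: real assume x: "x \<in> {0..real n}"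
      have "((\<lambda>s. 2 * c (z + s)) has_field_derivative 2 * ((1/2) * ?k x * 1)) (at (of_real x))"
        by (rule DERIV_cmult, rule DERIV_chain2[OF c]) (use z right_D x in \<open>auto intro!: derivative_eq_intros\<close>)
      from has_vector_derivative_real_field[OF this]
      show "((\<lambda>x. 2 * c (z + of_real x)) has_vector_derivative ?k x) (at x within {0..real n})"
        by simp
    qed simp
    from integral_unique[OF this] show ?thesis by (simp add: algebra_simps)
  qed
  have "(\<lambda>n. c (z + of_real (real n))) \<longlonglongrightarrow> 0"
    by (rule filterlim_compose[OF lim filterlim_real_sequentially])
  then have "(\<lambda>n. integral {0..real n} ?k) \<longlonglongrightarrow> 2 * (0 - c z)"
    unfolding I by (intro tendsto_intros)
  from LIMSEQ_unique[OF L this] show ?thesis by simp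
qed

lemma box_radius:
  assumes z: "z \<in> D"
  obtains \<delta> where "\<delta> > 0" "cball z (2 * \<delta>) \<subseteq> D" "\<delta> \<le> R"
proof -
  obtain r where r: "r > 0" "cball z r \<subseteq> D" using open_D z open_contains_cball by blast
  have "cball z (2 * min (r / 2) R) \<subseteq> cball z r" by (intro subset_cball) simp
  then have "cball z (2 * min (r / 2) R) \<subseteq> D" using r by blast
  then show ?thesis using that[of "min (r / 2) R"] r R_pos by simp
qed

text \<open>Since \<open>D\<close> is invariant to the right, one polydisc radius serves all points
  of a ray; Cauchy's estimates are then uniform along it.\<close>

lemma coeff_box:
  assumes "cball z (2 * \<delta>) \<subseteq> D" "\<delta> \<le> R" "x \<ge> 0" "t \<in> cball 0 \<delta>" "z' \<in> cball (z + of_real x) \<delta>" "\<delta> > 0"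
  shows "(t / 2, z') \<in> \<Omega>"
proof -
  have n: "norm t \<le> \<delta>" "norm (z' - (z + of_real x)) \<le> \<delta>"
    using assms by (auto simp: dist_norm norm_minus_commute)
  have "z' - of_real x \<in> cball z (2 * \<delta>)"
    using n assms by (simp add: dist_norm norm_minus_commute algebra_simps)
  then have "z' - of_real x + of_real x \<in> D" using assms by (intro right_D) auto
  then have 1: "z' \<in> D" by simp
  have "norm ((z' - (z + of_real x)) + t / 2) \<le> \<delta> + \<delta> / 2"
    using n by (intro norm_triangle_mono) (auto simp: norm_divide)
  then have "z' + t / 2 - of_real x \<in> cball z (2 * \<delta>)"
    using assms by (simp add: dist_norm norm_minus_commute algebra_simps)
  then have "z' + t / 2 - of_real x + of_real x \<in> D" using assms by (intro right_D) auto
  then have 2: "z' + t / 2 \<in> D" by simp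
  have "\<bar>Re (t / 2)\<bar> \<le> \<delta> / 2"
    using abs_Re_le_cmod[of "t / 2"] n by (simp add: norm_divide)
  then have "Re (t / 2) > - R" using assms by simp
  with 1 2 show ?thesis by (simp add: \<Omega>_iff)
qed

text \<open>Taking Taylor coefficients in \<open>t\<close> commutes with
  \<open>z\<close>-derivatives. The second claim is the \<open>n\<close>-th coefficient of
  \<open>borel_slope_pde\<close>, a \<tau>-derivative being twice a
  \<open>t\<close>-derivative.\<close>

lemma coeff_derivs:
  assumes z: "z \<in> D"
  shows "(coeff n has_field_derivative (deriv ^^ n) (\<lambda>t. borel_slope \<phi> g (t / 2, z)) 0) (at z)"
    and "((\<lambda>z. (deriv ^^ n) (\<lambda>t. borel_slope \<phi> g (t / 2, z)) 0) has_field_derivative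
        2 * (deriv ^^ Suc n) (\<lambda>t. borel_slope \<phi> g (t / 2, z)) 0
        + \<phi> z * (deriv ^^ n) (\<lambda>t. borel_slope \<phi> g (t / 2, z)) 0 - g z * coeff n z) (at z)"
proof -
  obtain \<delta> where \<delta>: "\<delta> > 0" "cball z (2 * \<delta>) \<subseteq> D" "\<delta> \<le> R"
    using box_radius[OF z] .
  define T where "T = ball (0::complex) \<delta>"
  define Z where "Z = ball z \<delta>"
  have T: "open T" "0 \<in> T" and Z: "open Z" "z \<in> Z" using \<delta> by (auto simp: T_def Z_def)
  have box: "(t / 2, z') \<in> \<Omega>" if "t \<in> T" "z' \<in> Z" for t z'
    using that coeff_box[OF \<delta>(2,3), of 0 t z'] \<delta> by (auto simp: T_def Z_def)
  have cont: "continuous_on (T \<times> Z) (\<lambda>(t, z). f (t / 2, z))" if "hol2 f \<Omega>" for f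
    unfolding split_beta
    by (rule continuous_on_compose2[OF hol2_imp_continuous_on[OF that]]) (auto intro!: continuous_intros box)
  have h1: "(\<lambda>t. f (t / 2, z')) holomorphic_on T" if "hol2 f \<Omega>" "z' \<in> Z" for f z'
  proof -
    have "(\<lambda>t. f (t, z')) holomorphic_on (\<lambda>t. t / 2) ` T"
      by (rule hol2_slice_holomorphic(1)[OF that(1)]) (use box that in auto)
    from holomorphic_on_compose_gen[OF _ this, of "\<lambda>t. t / 2" T] show ?thesis
      by (simp add: o_def holomorphic_on_divide holomorphic_on_ident holomorphic_on_const)
  qed
  have h2: "(\<lambda>z. f (t / 2, z)) holomorphic_on Z" if "hol2 f \<Omega>" "t \<in> T" for f t
    using that box by (intro hol2_slice_holomorphic(2)) auto
  note P = higher_deriv_param_derivative[OF T(1) Z(1) cont h1 h2]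
  have cong: "(deriv ^^ n) f 0 = (deriv ^^ n) h 0" if "\<And>t. t \<in> T \<Longrightarrow> f t = h t" for f h :: "complex \<Rightarrow> complex" and n
    using that T by (intro higher_deriv_cong_ev eventually_nhds_in_open[OF T, THEN eventually_mono]) auto
  have "((\<lambda>z. (deriv ^^ n) (\<lambda>t. borel_sum \<phi> g (t / 2, z)) 0) has_field_derivative
      (deriv ^^ n) (\<lambda>t. deriv (\<lambda>z. borel_sum \<phi> g (t / 2, z)) z) 0) (at z)"
    by (rule P(2)[OF borel_sum_hol2 borel_sum_hol2 _ borel_sum_hol2 _ Z(2) T(2)])
  also have "(deriv ^^ n) (\<lambda>t. deriv (\<lambda>z. borel_sum \<phi> g (t / 2, z)) z) 0 = (deriv ^^ n) (\<lambda>t. borel_slope \<phi> g (t / 2, z)) 0"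
    using box Z by (intro cong) (auto simp: borel_sum_deriv_eq)
  finally show "(coeff n has_field_derivative (deriv ^^ n) (\<lambda>t. borel_slope \<phi> g (t / 2, z)) 0) (at z)"
    by (simp add: coeff_def[abs_def])
  have "((\<lambda>z. (deriv ^^ n) (\<lambda>t. borel_slope \<phi> g (t / 2, z)) 0) has_field_derivative
      (deriv ^^ n) (\<lambda>t. deriv (\<lambda>z. borel_slope \<phi> g (t / 2, z)) z) 0) (at z)"
    by (rule P(2)[OF borel_slope_hol2 borel_slope_hol2 _ borel_slope_hol2 _ Z(2) T(2)])
  also have "(deriv ^^ n) (\<lambda>t. deriv (\<lambda>z. borel_slope \<phi> g (t / 2, z)) z) 0
     = (deriv ^^ n) (\<lambda>t. (2 * deriv (\<lambda>t. borel_slope \<phi> g (t / 2, z)) t + \<phi> z * borel_slope \<phi> g (t / 2, z)) - g z * borel_sum \<phi> g (t / 2, z)) 0"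
  proof (rule cong)
    fix t assume t: "t \<in> T"
    have w: "(t / 2, z) \<in> \<Omega>" using box t Z by blast
    have "((\<lambda>\<tau>. borel_slope \<phi> g (\<tau>, z)) has_field_derivative deriv (\<lambda>\<tau>. borel_slope \<phi> g (\<tau>, z)) (t / 2)) (at (t / 2))"
      using hol2_slice(1)[OF borel_slope_hol2 w] by (rule field_differentiable_derivI)
    then have "((\<lambda>t. borel_slope \<phi> g (t / 2, z)) has_field_derivative deriv (\<lambda>\<tau>. borel_slope \<phi> g (\<tau>, z)) (t / 2) * (1/2)) (at t)"
      by (rule DERIV_chain2) (auto intro!: derivative_eq_intros)
    then have "2 * deriv (\<lambda>t. borel_slope \<phi> g (t / 2, z)) t = deriv (\<lambda>\<tau>. borel_slope \<phi> g (\<tau>, z)) (t / 2)"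
      by (simp add: DERIV_imp_deriv)
    with borel_slope_pde[OF w] show "deriv (\<lambda>z. borel_slope \<phi> g (t / 2, z)) z
      = (2 * deriv (\<lambda>t. borel_slope \<phi> g (t / 2, z)) t + \<phi> z * borel_slope \<phi> g (t / 2, z)) - g z * borel_sum \<phi> g (t / 2, z)"
      by (simp add: algebra_simps)
  qed
  also have "\<dots> = 2 * (deriv ^^ Suc n) (\<lambda>t. borel_slope \<phi> g (t / 2, z)) 0
        + \<phi> z * (deriv ^^ n) (\<lambda>t. borel_slope \<phi> g (t / 2, z)) 0 - g z * coeff n z"
  proof -
    let ?S = "\<lambda>t. borel_slope \<phi> g (t / 2, z)" and ?F = "\<lambda>t. borel_sum \<phi> g (t / 2, z)"
    have S: "?S holomorphic_on T" and F: "?F holomorphic_on T"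
      using h1 Z borel_slope_hol2 borel_sum_hol2 by blast+
    have S': "deriv ?S holomorphic_on T" using S T by (intro holomorphic_deriv)
    have "(deriv ^^ n) (\<lambda>t. (2 * deriv ?S t + \<phi> z * ?S t) - g z * ?F t) 0
       = (deriv ^^ n) (\<lambda>t. 2 * deriv ?S t + \<phi> z * ?S t) 0 - (deriv ^^ n) (\<lambda>t. g z * ?F t) 0"
      by (intro higher_deriv_diff[OF _ _ T] holomorphic_intros S S' F)
    also have "(deriv ^^ n) (\<lambda>t. 2 * deriv ?S t + \<phi> z * ?S t) 0
       = (deriv ^^ n) (\<lambda>t. 2 * deriv ?S t) 0 + (deriv ^^ n) (\<lambda>t. \<phi> z * ?S t) 0"
      by (intro higher_deriv_add[OF _ _ T] holomorphic_intros S S' F)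
    also have "(deriv ^^ n) (\<lambda>t. 2 * deriv ?S t) 0 = 2 * (deriv ^^ n) (deriv ?S) 0"
      by (intro higher_deriv_cmult[OF S' T(2,1)])
    also have "(deriv ^^ n) (\<lambda>t. \<phi> z * ?S t) 0 = \<phi> z * (deriv ^^ n) ?S 0"
      by (intro higher_deriv_cmult[OF S T(2,1)])
    also have "(deriv ^^ n) (\<lambda>t. g z * ?F t) 0 = g z * (deriv ^^ n) ?F 0"
      by (intro higher_deriv_cmult[OF F T(2,1)])
    also have "(deriv ^^ n) (deriv ?S) 0 = (deriv ^^ Suc n) ?S 0"
      by (simp only: funpow_Suc_right o_apply)
    finally show ?thesis by (simp add: coeff_def)
  qed
  finally show "((\<lambda>z. (deriv ^^ n) (\<lambda>t. borel_slope \<phi> g (t / 2, z)) 0) has_field_derivative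
        2 * (deriv ^^ Suc n) (\<lambda>t. borel_slope \<phi> g (t / 2, z)) 0
        + \<phi> z * (deriv ^^ n) (\<lambda>t. borel_slope \<phi> g (t / 2, z)) 0 - g z * coeff n z) (at z)" .
qed

lemma coeff_holomorphic: "coeff n holomorphic_on D"
  using coeff_derivs(1) open_D by (auto simp: holomorphic_on_open)

text \<open>Cauchy's inequality in \<open>t\<close>, then in \<open>z\<close>, applied to the bound
  of \<open>borel_sum\<close> with its factor \<open>G (m w)\<close>; the shift \<open>b\<close>
  allows for the leftward extent of the polydisc.\<close>

lemma coeff_decay:
  assumes z: "z \<in> D"
  obtains A b where "A \<ge> 0" "\<And>x. x \<ge> 0 \<Longrightarrow> norm (coeff n (z + of_real x)) \<le> A * G (x - b)"
    "\<And>x. x \<ge> 0 \<Longrightarrow> norm (deriv (coeff n) (z + of_real x)) \<le> A * G (x - b)"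
proof -
  obtain \<delta> where \<delta>: "\<delta> > 0" "cball z (2 * \<delta>) \<subseteq> D" "\<delta> \<le> R"
    using box_radius[OF z] .
  define b where "b = - Re z + 2 * \<delta>"
  define A0 where "A0 = fact n * (K 1 * exp \<delta>) / \<delta> ^ n"
  have A0: "A0 \<ge> 0" using K_pos[of 1] \<delta> by (simp add: A0_def)
  have c: "norm (coeff n z') \<le> A0 * G (x - b)" if x: "x \<ge> 0" and z': "z' \<in> cball (z + of_real x) \<delta>" for x z'
  proof -
    have box: "(t / 2, z') \<in> \<Omega>" if "t \<in> cball 0 \<delta>" for t
      using coeff_box[OF \<delta>(2,3) x that z' \<delta>(1)] .
    have hol: "(\<lambda>t. borel_sum \<phi> g (t / 2, z')) holomorphic_on cball 0 \<delta>"
    proof -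
      have "(\<lambda>t. borel_sum \<phi> g (t, z')) holomorphic_on (\<lambda>t. t / 2) ` cball 0 \<delta>"
        by (rule hol2_slice_holomorphic(1)[OF borel_sum_hol2]) (use box in auto)
      from holomorphic_on_compose_gen[OF _ this, of "\<lambda>t. t / 2" "cball 0 \<delta>"] show ?thesis
        by (simp add: o_def holomorphic_on_divide holomorphic_on_ident holomorphic_on_const)
    qed
    have "norm ((deriv ^^ n) (\<lambda>t. borel_sum \<phi> g (t / 2, z')) 0) \<le> fact n * (K 1 * exp \<delta> * G (x - b)) / \<delta> ^ n"
    proof (rule Cauchy_inequality)
      show "(\<lambda>t. borel_sum \<phi> g (t / 2, z')) holomorphic_on ball 0 \<delta>"
        "continuous_on (cball 0 \<delta>) (\<lambda>t. borel_sum \<phi> g (t / 2, z'))"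
        using hol ball_subset_cball[of 0 \<delta>] by (auto intro: holomorphic_on_imp_continuous_on holomorphic_on_subset)
      fix t :: complex assume "norm (0 - t) = \<delta>"
      then have t: "norm t = \<delta>" "t \<in> cball 0 \<delta>" by auto
      have "norm (borel_sum \<phi> g (t / 2, z')) \<le> K 1 * G (m (t / 2, z')) * exp (2 * 1 * norm (t / 2))"
        using borel_sum_bound[OF _ box[OF t(2)], of 1] by (simp add: K_def)
      also have "2 * 1 * norm (t / 2) = \<delta>" using t by (simp add: norm_divide)
      also have "G (m (t / 2, z')) \<le> G (x - b)"
      proof (rule G_antimono)
        have "\<bar>Re (t / 2)\<bar> \<le> \<delta> / 2"
          using abs_Re_le_cmod[of "t / 2"] t by (simp add: norm_divide)
        moreover have "\<bar>Re (z' - (z + of_real x))\<bar> \<le> \<delta>"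
          using abs_Re_le_cmod[of "z' - (z + of_real x)"] z' by (simp add: dist_norm norm_minus_commute)
        ultimately show "x - b \<le> m (t / 2, z')"
          using \<delta> by (simp add: m_def b_def abs_le_iff min_def)
      qed
      finally show "norm (borel_sum \<phi> g (t / 2, z')) \<le> K 1 * exp \<delta> * G (x - b)"
        using K_pos[of 1] by (simp add: mult_ac)
    qed (use \<delta> in auto)
    then show ?thesis by (simp add: coeff_def A0_def)
  qed
  define A where "A = max A0 (A0 / \<delta>)"
  have "norm (deriv (coeff n) (z + of_real x)) \<le> A0 * G (x - b) / \<delta>" if x: "x \<ge> 0" for x
  proof (rule cauchy_derivative_bound[OF coeff_holomorphic])
    show "cball (z + of_real x) \<delta> \<subseteq> D"
      using coeff_box[OF \<delta>(2,3) x, of 0] \<delta>(1) by (auto simp: \<Omega>_iff)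
  qed (use \<delta> c x in auto)
  then have "norm (deriv (coeff n) (z + of_real x)) \<le> A * G (x - b)" if x: "x \<ge> 0" for x
    using that mult_right_mono[of "A0 / \<delta>" A "G (x - b)"] G_nonneg by (force simp: A_def)
  moreover have "norm (coeff n (z + of_real x)) \<le> A * G (x - b)" if x: "x \<ge> 0" for x
    using c[OF x, of "z + of_real x"] mult_right_mono[of A0 A "G (x - b)"] G_nonneg \<delta> by (force simp: A_def)
  moreover have "A \<ge> 0" using A0 by (simp add: A_def)
  ultimately show ?thesis using that by blast
qed

lemma coeff_lim:
  assumes z: "z \<in> D"
  shows "((\<lambda>x. coeff n (z + of_real x)) \<longlongrightarrow> 0) at_top"
    and "((\<lambda>x. deriv (coeff n) (z + of_real x)) \<longlongrightarrow> 0) at_top"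
proof -
  obtain A b where A: "\<And>x. x \<ge> 0 \<Longrightarrow> norm (coeff n (z + of_real x)) \<le> A * G (x - b)"
    "\<And>x. x \<ge> 0 \<Longrightarrow> norm (deriv (coeff n) (z + of_real x)) \<le> A * G (x - b)"
    using coeff_decay[OF z] by blast
  have "((\<lambda>x. G (x - b)) \<longlongrightarrow> 0) at_top"
    by (rule filterlim_compose[OF G_lim]) real_asymp
  then have l: "((\<lambda>x. A * G (x - b)) \<longlongrightarrow> 0) at_top" by (rule tendsto_mult_right_zero)
  show "((\<lambda>x. coeff n (z + of_real x)) \<longlongrightarrow> 0) at_top"
    by (rule Lim_null_comparison[OF _ l]) (use eventually_ge_at_top[of 0] in eventually_elim, rule A)
  show "((\<lambda>x. deriv (coeff n) (z + of_real x)) \<longlongrightarrow> 0) at_top"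
    by (rule Lim_null_comparison[OF _ l]) (use eventually_ge_at_top[of 0] in eventually_elim, rule A)
qed

lemma \<phi>_derivative: "z \<in> D \<Longrightarrow> (\<phi> has_field_derivative deriv \<phi> z) (at z)"
  using hol_\<phi> open_D by (rule holomorphic_derivI)

text \<open>The slope at \<tau> = 0 gives \<open>c_0' = g/2\<close>; adding \<open>\<phi>/2\<close>
  makes the derivative \<open>(g + \<phi>')/2\<close>, and the sum still vanishes at
  infinity.\<close>

lemma coeff_0:
  assumes z: "z \<in> D"
  shows "coeff 0 z = - (1/2) * \<phi> z - (1/2) * integral {0..} (\<lambda>x. g (z + of_real x) + deriv \<phi> (z + of_real x))"
proof -
  have "coeff 0 z = (coeff 0 z + (1/2) * \<phi> z) - (1/2) * \<phi> z" by simp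
  also have "(coeff 0 z + (1/2) * \<phi> z) = - (1/2) * integral {0..} (\<lambda>x. (g (z + of_real x) + deriv \<phi> (z + of_real x)) * 1)"
  proof (rule half_plane_tail_integral[OF z, where a = "\<lambda>_. 1" and A = 1])
    show "((\<lambda>z. coeff 0 z + (1/2) * \<phi> z) has_field_derivative (1/2) * ((g z + deriv \<phi> z) * 1)) (at z)" if "z \<in> D" for z
      using DERIV_add[OF coeff_derivs(1)[OF that, of 0] DERIV_cmult[OF \<phi>_derivative[OF that], of "1/2"]] borel_slope_0[OF that]
      by (simp add: algebra_simps)
    show "((\<lambda>x. coeff 0 (z + of_real x) + (1/2) * \<phi> (z + of_real x)) \<longlongrightarrow> 0) at_top"
      using tendsto_add[OF coeff_lim(1)[OF z, of 0] tendsto_mult_right_zero[OF \<phi>_lim[OF z], of "1/2"]] by simp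
  qed auto
  finally show ?thesis by (rule trans) (simp add: algebra_simps)
qed

text \<open>By \<open>coeff_derivs\<close>, \<open>c_n'' = 2 c_(n+1)' + \<phi> c_n' - g c_n\<close>.
  Writing \<open>\<phi> c_n'\<close> as \<open>(\<phi> c_n)' - \<phi>' c_n\<close> shows that
  \<open>c_(n+1) + \<phi> c_n / 2 - c_n' / 2\<close> has derivative
  \<open>(g + \<phi>') c_n / 2\<close>; it vanishes at infinity.\<close>

lemma coeff_Suc:
  assumes z: "z \<in> D"
  shows "coeff (Suc n) z = - (1/2) * \<phi> z * coeff n z + (1/2) * deriv (coeff n) z
    - (1/2) * integral {0..} (\<lambda>x. (g (z + of_real x) + deriv \<phi> (z + of_real x)) * coeff n (z + of_real x))"
proof -
  have dc: "deriv (coeff n) z = (deriv ^^ n) (\<lambda>t. borel_slope \<phi> g (t / 2, z)) 0" if "z \<in> D" for z n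
    using coeff_derivs(1)[OF that] by (rule DERIV_imp_deriv)
  obtain A b where A: "A \<ge> 0" "\<And>x. x \<ge> 0 \<Longrightarrow> norm (coeff n (z + of_real x)) \<le> A * G (x - b)"
    using coeff_decay[OF z] by metis
  have "(coeff (Suc n) z + ((1/2) * (\<phi> z * coeff n z) - (1/2) * deriv (coeff n) z))
     = - (1/2) * integral {0..} (\<lambda>x. (g (z + of_real x) + deriv \<phi> (z + of_real x)) * coeff n (z + of_real x))"
  proof (rule half_plane_tail_integral[OF z])
    fix z assume z: "z \<in> D"
    let ?s = "\<lambda>n. (deriv ^^ n) (\<lambda>t. borel_slope \<phi> g (t / 2, z)) 0"
    have d2: "(deriv (coeff n) has_field_derivative 2 * ?s (Suc n) + \<phi> z * ?s n - g z * coeff n z) (at z)"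
      by (rule has_field_derivative_transform_within_open[OF coeff_derivs(2)[OF z] open_D z]) (simp add: dc)
    have "((\<lambda>z. coeff (Suc n) z + ((1/2) * (\<phi> z * coeff n z) - (1/2) * deriv (coeff n) z)) has_field_derivative
        ?s (Suc n) + ((1/2) * (deriv \<phi> z * coeff n z + ?s n * \<phi> z) - (1/2) * (2 * ?s (Suc n) + \<phi> z * ?s n - g z * coeff n z))) (at z)"
      by (intro DERIV_add DERIV_diff DERIV_cmult DERIV_mult coeff_derivs(1) d2 \<phi>_derivative z)
    also have "?s (Suc n) + ((1/2) * (deriv \<phi> z * coeff n z + ?s n * \<phi> z) - (1/2) * (2 * ?s (Suc n) + \<phi> z * ?s n - g z * coeff n z))
        = (1/2) * ((g z + deriv \<phi> z) * coeff n z)"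
      by (simp add: algebra_simps)
    finally show "((\<lambda>z. coeff (Suc n) z + ((1/2) * (\<phi> z * coeff n z) - (1/2) * deriv (coeff n) z)) has_field_derivative
        (1/2) * ((g z + deriv \<phi> z) * coeff n z)) (at z)" .
  next
    show "continuous_on D (coeff n)"
      by (intro holomorphic_on_imp_continuous_on coeff_holomorphic)
    show "norm (coeff n (z + of_real x)) \<le> A * M" if "x \<ge> 0" for x
      using A(2)[OF that] mult_left_mono[OF G_le A(1), of "x - b"] by linarith
    show "((\<lambda>x. coeff (Suc n) (z + of_real x) + ((1/2) * (\<phi> (z + of_real x) * coeff n (z + of_real x)) - (1/2) * deriv (coeff n) (z + of_real x))) \<longlongrightarrow> 0) at_top"
      using tendsto_add[OF coeff_lim(1)[OF z, of "Suc n"] tendsto_diff[OF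
        tendsto_mult_right_zero[OF tendsto_mult_zero[OF \<phi>_lim[OF z] coeff_lim(1)[OF z]], of "1/2" n]
        tendsto_mult_right_zero[OF coeff_lim(2)[OF z], of "1/2" n]]] by simp
  qed
  then show ?thesis by (simp add: algebra_simps)
qed

end

section \<open>Half-strip charts of the surface\<close>

text \<open>The open-and-closed argument of \<open>horizontal_lift_unique\<close> for an arbitrary
  connected parameter set; it serves both for rays and for two-dimensional charts.\<close>

lemma lifts_agree:
  fixes a b :: "'b::topological_space \<Rightarrow> 'a::t2_space"
  assumes G: "spread_domain p G" and C: "connected C"
    and c: "continuous_on C a" "continuous_on C b" and sub: "a ` C \<subseteq> G"
    and p: "\<And>x. x \<in> C \<Longrightarrow> p (a x) = p (b x)"
    and x0: "x0 \<in> C" "a x0 = b x0" and x: "x \<in> C"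
  shows "a x = b x"
proof -
  let ?T = "{x\<in>C. a x = b x}"
  let ?X = "top_of_set C"
  have pre: "openin ?X (C \<inter> a -` V)" "openin ?X (C \<inter> b -` V)" if "open V" for V
    using continuous_openin_preimage_gen[OF c(1) that] continuous_openin_preimage_gen[OF c(2) that]
    by auto
  have "openin ?X ?T"
  proof (subst openin_subopen, intro ballI)
    fix y assume "y \<in> ?T"
    then have y: "y \<in> C" "a y = b y" by auto
    then have "a y \<in> G" using sub by blast
    then obtain V g where V: "open V" "a y \<in> V" "homeomorphism V (p ` V) p g"
      using G unfolding spread_domain_def by blast
    let ?N = "(C \<inter> a -` V) \<inter> (C \<inter> b -` V)"
    have "?N \<subseteq> ?T"
    proof
      fix z assume z: "z \<in> ?N"
      then have "g (p (a z)) = g (p (b z))" using p by simp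
      moreover have "g (p (a z)) = a z" "g (p (b z)) = b z"
        using z V(3) by (auto simp: homeomorphism_def)
      ultimately show "z \<in> ?T" using z by auto
    qed
    moreover have "openin ?X ?N" using pre[OF V(1)] by (rule openin_Int)
    moreover have "y \<in> ?N" using y V(2) by auto
    ultimately show "\<exists>N. openin ?X N \<and> y \<in> N \<and> N \<subseteq> ?T" by blast
  qed
  moreover have "openin ?X (C - ?T)"
  proof (subst openin_subopen, intro ballI)
    fix y assume "y \<in> C - ?T"
    then have y: "y \<in> C" "a y \<noteq> b y" by auto
    then obtain U V where UV: "open U" "open V" "a y \<in> U" "b y \<in> V" "U \<inter> V = {}"
      using hausdorff by metis
    let ?N = "(C \<inter> a -` U) \<inter> (C \<inter> b -` V)"
    have "openin ?X ?N" using pre(1)[OF UV(1)] pre(2)[OF UV(2)] by (rule openin_Int)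
    moreover have "y \<in> ?N" using y UV by auto
    moreover have "?N \<subseteq> C - ?T" using UV by auto
    ultimately show "\<exists>N. openin ?X N \<and> y \<in> N \<and> N \<subseteq> C - ?T" by blast
  qed
  then have "closedin ?X ?T" unfolding closedin_def by auto
  moreover have "?T \<noteq> {}" using x0 by auto
  ultimately have "?T = C" using C unfolding connected_clopen by blast
  with x show ?thesis by auto
qed

text \<open>\<open>U(r)\<close> is the \<open>r\<close>-neighbourhood of the half-line from
  \<open>0\<close>; convexity, translation and margins are all easier to see in this form.\<close>

lemma U_region_iff:
  assumes "r > 0"
  shows "t \<in> U_region r \<longleftrightarrow> (\<exists>x\<ge>0. norm (t - of_real x) < r)"
proof
  assume t: "t \<in> U_region r"
  show "\<exists>x\<ge>0. norm (t - of_real x) < r"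
  proof (cases "Re t > 0 \<and> \<bar>Im t\<bar> < r")
    case True
    then show ?thesis
      by (intro exI[of _ "Re t"]) (simp add: norm_complex_def)
  next
    case False
    then show ?thesis using t by (intro exI[of _ 0]) (auto simp: U_region_def)
  qed
next
  assume "\<exists>x\<ge>0. norm (t - of_real x) < r"
  then obtain x where x: "x \<ge> 0" "norm (t - of_real x) < r" by blast
  have i: "\<bar>Im t\<bar> < r" using abs_Im_le_cmod[of "t - of_real x"] x by simp
  show "t \<in> U_region r"
  proof (cases "Re t > 0")
    case True
    then show ?thesis using i by (simp add: U_region_def)
  next
    case False
    \<comment> \<open>Left of the imaginary axis the nearest point of the half-line is its end
      \<open>0\<close>.\<close>
    then have "(Re t)\<^sup>2 \<le> (Re t - x)\<^sup>2" using x by (simp add: abs_le_square_iff[symmetric])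
    then have "norm t \<le> norm (t - of_real x)"
      by (simp add: norm_complex_def)
    then show ?thesis using x by (simp add: U_region_def)
  qed
qed

text \<open>For \<open>r = d\<close> this is the union of the discs that the definition of \<Gamma>
  grants along a horizontal ray.\<close>

definition half_strip :: "complex \<Rightarrow> real \<Rightarrow> complex set" where
  "half_strip z0 r = {z. z - z0 \<in> U_region r}"

lemma half_strip_iff:
  "r > 0 \<Longrightarrow> z \<in> half_strip z0 r \<longleftrightarrow> (\<exists>x\<ge>0. norm (z - (z0 + of_real x)) < r)"
  by (simp add: half_strip_def U_region_iff diff_diff_eq)

lemma half_strip_eq_UN: "r > 0 \<Longrightarrow> half_strip z0 r = (\<Union>x\<in>{0..}. ball (z0 + of_real x) r)"
  by (auto simp: half_strip_iff dist_norm norm_minus_commute)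

lemma open_half_strip: "r > 0 \<Longrightarrow> open (half_strip z0 r)"
  unfolding half_strip_eq_UN by (intro open_UN ballI open_ball)

lemma convex_half_strip:
  assumes "r > 0"
  shows "convex (half_strip z0 r)"
proof (rule convexI)
  fix z z' and u v :: real
  assume z: "z \<in> half_strip z0 r" "z' \<in> half_strip z0 r" and uv: "0 \<le> u" "0 \<le> v" "u + v = 1"
  from z obtain x x' where x: "x \<ge> 0" "norm (z - (z0 + of_real x)) < r" "x' \<ge> 0" "norm (z' - (z0 + of_real x')) < r"
    using assms by (auto simp: half_strip_iff)
  have "(of_real u + of_real v) * z0 = z0" using uv by (metis mult_1 of_real_1 of_real_add)
  then have e: "u *\<^sub>R z + v *\<^sub>R z' - (z0 + of_real (u * x + v * x'))
      = u *\<^sub>R (z - (z0 + of_real x)) + v *\<^sub>R (z' - (z0 + of_real x'))"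
    by (simp add: scaleR_conv_of_real algebra_simps)
  have "norm (u *\<^sub>R z + v *\<^sub>R z' - (z0 + of_real (u * x + v * x')))
      \<le> u * norm (z - (z0 + of_real x)) + v * norm (z' - (z0 + of_real x'))"
    unfolding e using uv by (intro norm_triangle_le) simp
  also have "\<dots> < r"
    using x uv by (intro convex_bound_lt) auto
  finally show "u *\<^sub>R z + v *\<^sub>R z' \<in> half_strip z0 r"
    using assms x uv by (auto simp: half_strip_iff intro!: exI[of _ "u * x + v * x'"])
qed

lemma half_strip_right:
  assumes "r > 0" "z \<in> half_strip z0 r" "x \<ge> 0"
  shows "z + of_real x \<in> half_strip z0 r"
proof -
  obtain y where "y \<ge> 0" "norm (z - (z0 + of_real y)) < r"
    using assms by (auto simp: half_strip_iff)
  moreover have "z + of_real x - (z0 + of_real (y + x)) = z - (z0 + of_real y)" by simp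
  ultimately show ?thesis
    unfolding half_strip_iff[OF assms(1)] using assms(3) by (metis add_nonneg_nonneg)
qed

lemma half_strip_Im_Re:
  assumes "r > 0" "z \<in> half_strip z0 r"
  shows "\<bar>Im z - Im z0\<bar> < r" "Re z - Re z0 > - r"
proof -
  obtain x where x: "x \<ge> 0" "norm (z - (z0 + of_real x)) < r"
    using assms by (auto simp: half_strip_iff)
  show "\<bar>Im z - Im z0\<bar> < r" "Re z - Re z0 > - r"
    using abs_Im_le_cmod[of "z - (z0 + of_real x)"] abs_Re_le_cmod[of "z - (z0 + of_real x)"] x
    by (auto simp: abs_le_iff)
qed

lemma half_strip_mono: "0 < r \<Longrightarrow> r \<le> r' \<Longrightarrow> half_strip z0 r \<subseteq> half_strip z0 r'"
  by (force simp: half_strip_iff)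

lemma half_strip_cball:
  assumes "0 < r" "0 < \<delta>" "r + \<delta> \<le> r'" "z \<in> half_strip z0 r"
  shows "cball z \<delta> \<subseteq> half_strip z0 r'"
proof
  fix y assume y: "y \<in> cball z \<delta>"
  obtain x where x: "x \<ge> 0" "norm (z - (z0 + of_real x)) < r"
    using assms by (auto simp: half_strip_iff)
  have "dist y (z0 + of_real x) \<le> dist y z + dist z (z0 + of_real x)"
    by (rule dist_triangle)
  then have "norm (y - (z0 + of_real x)) < r'"
    using y x assms by (simp add: dist_norm norm_minus_commute)
  then show "y \<in> half_strip z0 r'" using assms x by (auto simp: half_strip_iff)
qed

lemma half_strip_base: "r > 0 \<Longrightarrow> x \<ge> 0 \<Longrightarrow> z0 + of_real x \<in> half_strip z0 r"
  by (auto simp: half_strip_iff)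

lemma half_strip_shrink:
  assumes "d > 0" "z \<in> half_strip z0 d"
  obtains r where "0 < r" "r < d" "z \<in> half_strip z0 r"
proof -
  obtain x where x: "x \<ge> 0" "norm (z - (z0 + of_real x)) < d"
    using assms by (auto simp: half_strip_iff)
  then obtain r where r: "norm (z - (z0 + of_real x)) < r" "r < d" using dense by blast
  then have "0 < r" using norm_ge_zero[of "z - (z0 + of_real x)"] by linarith
  then show ?thesis using that[of r] r x by (auto simp: half_strip_iff)
qed

text \<open>
  The coordinate \<open>q = - s p\<close> makes all half-lines run to \<open>+\<infinity>\<close>, which merges the two signs. A chart
  about \<open>\<xi>\<close> is obtained by gluing the discs about the points of the half-line from \<open>\<xi>\<close>.
\<close>

locale wkb_setting =
  fixes p :: "'a::t2_space \<Rightarrow> complex" and G \<Delta> \<Gamma> :: "'a set" and s d :: real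
  assumes s: "s = 1 \<or> s = -1" and G: "spread_domain p G" and \<Delta>: "domain_in G \<Delta>"
    and d: "d > 0" and \<Gamma>: "Gamma_domain p s \<Delta> d \<Gamma>"
begin

definition q :: "'a \<Rightarrow> complex" where "q \<xi> = - of_real s * p \<xi>"

lemma s_sq: "s * s = 1" "of_real s * (of_real s * z) = (z :: complex)" "of_real s * (of_real s :: complex) = 1"
  using s by auto

lemma p_q: "p \<xi> = - of_real s * q \<xi>"
  by (simp add: q_def s_sq)

text \<open>A continuous section of the coordinate over an open set; injectivity of \<open>L\<close>
  is implied by \<open>q (L z) = z\<close>.\<close>

definition chart :: "complex set \<Rightarrow> (complex \<Rightarrow> 'a) \<Rightarrow> bool" where
  "chart D L \<longleftrightarrow> open D \<and> continuous_on D L \<and> L ` D \<subseteq> \<Delta> \<and> (\<forall>z\<in>D. q (L z) = z)"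

lemma \<Delta>_sub: "\<Delta> \<subseteq> G" and \<Gamma>_sub: "\<Gamma> \<subseteq> \<Delta>" and open_\<Gamma>: "open \<Gamma>"
  using \<Delta> \<Gamma> by (auto simp: domain_in_def Gamma_domain_def)

lemma charts_agree:
  assumes "chart D L" "chart D' L'" "connected K" "K \<subseteq> D" "K \<subseteq> D'" "z0 \<in> K" "L z0 = L' z0" "z \<in> K"
  shows "L z = L' z"
proof (rule lifts_agree[OF G assms(3)])
  show "continuous_on K L" "continuous_on K L'"
    using assms continuous_on_subset by (auto simp: chart_def)
  show "L ` K \<subseteq> G" using assms(1,4) \<Delta>_sub unfolding chart_def by blast
  show "p (L x) = p (L' x)" if "x \<in> K" for x
    using assms that by (auto simp: chart_def p_q subset_iff)
qed (use assms in auto)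

text \<open>Near \<open>L z\<close> the section is inverse to \<open>q\<close>, because
  \<open>p\<close> is locally injective. Through this identity every limit on the surface becomes a
  limit in the plane.\<close>

lemma at_chart:
  assumes L: "chart D L" and z: "z \<in> D"
  shows "at (L z) = filtermap L (at z)"
proof -
  have D: "open D" "continuous_on D L" "L ` D \<subseteq> G" "\<And>z. z \<in> D \<Longrightarrow> q (L z) = z"
    using L \<Delta>_sub by (auto simp: chart_def)
  obtain V g where V: "open V" "L z \<in> V" "V \<subseteq> G" "homeomorphism V (p ` V) p g"
    using G D(3) z unfolding spread_domain_def by blast
  have qV: "continuous_on V q"
    unfolding q_def using V(4) by (intro continuous_intros) (auto simp: homeomorphism_def)
  have inj: "\<zeta> = \<zeta>'" if "\<zeta> \<in> V" "\<zeta>' \<in> V" "q \<zeta> = q \<zeta>'" for \<zeta> \<zeta>'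
  proof -
    have "p \<zeta> = p \<zeta>'" using that(3) p_q by metis
    then show ?thesis using that V(4) by (metis homeomorphism_apply1)
  qed
  have oN: "open (D \<inter> L -` S)" if "open S" for S
    using continuous_open_preimage[OF D(2,1) that] .
  show ?thesis
  proof (rule filter_eqI)
    fix P
    show "eventually P (at (L z)) \<longleftrightarrow> eventually P (filtermap L (at z))"
    proof
      assume "eventually P (at (L z))"
      then obtain S where S: "open S" "L z \<in> S" "\<And>\<zeta>. \<zeta> \<in> S \<Longrightarrow> \<zeta> \<noteq> L z \<Longrightarrow> P \<zeta>"
        unfolding eventually_at_topological by blast
      have "P (L z')" if "z' \<in> D \<inter> L -` S" "z' \<noteq> z" for z'
      proof -
        have "L z' \<noteq> L z" using that D(4)[of z'] D(4)[OF z] by auto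
        then show ?thesis using S(3) that by auto
      qed
      then show "eventually P (filtermap L (at z))"
        unfolding eventually_filtermap eventually_at_topological
        using oN[OF S(1)] S(2) z by (intro exI[of _ "D \<inter> L -` S"]) auto
    next
      assume "eventually P (filtermap L (at z))"
      then obtain T where T: "open T" "z \<in> T" "\<And>z'. z' \<in> T \<Longrightarrow> z' \<noteq> z \<Longrightarrow> P (L z')"
        unfolding eventually_filtermap eventually_at_topological by blast
      define T' where "T' = T \<inter> (D \<inter> L -` V)"
      have T': "open T'" "z \<in> T'" using T oN[OF V(1)] z V(2) by (auto simp: T'_def)
      have "open (V \<inter> q -` T')"
        using continuous_open_preimage[OF qV V(1) T'(1)] .
      moreover have "L z \<in> V \<inter> q -` T'" using V(2) T'(2) D(4)[OF z] by simp
      moreover have "P \<zeta>" if \<zeta>: "\<zeta> \<in> V \<inter> q -` T'" "\<zeta> \<noteq> L z" for \<zeta>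
      proof -
        have "L (q \<zeta>) = \<zeta>"
          using \<zeta> D(4) by (intro inj) (auto simp: T'_def)
        moreover from this have "q \<zeta> \<noteq> z" using \<zeta>(2) by auto
        ultimately show ?thesis using T(3)[of "q \<zeta>"] \<zeta> by (auto simp: T'_def)
      qed
      ultimately show "eventually P (at (L z))"
        unfolding eventually_at_topological by blast
    qed
  qed
qed

text \<open>The factor is the chain rule for \<open>q = - s p\<close>, with \<open>s\<close> its own
  inverse.\<close>

lemma has_spread_deriv_chart:
  assumes L: "chart D L" and z: "z \<in> D"
  shows "has_spread_deriv p f (- of_real s * E) (L z) \<longleftrightarrow> ((\<lambda>z. f (L z)) has_field_derivative E) (at z)"
proof -
  have D: "open D" "\<And>z. z \<in> D \<Longrightarrow> p (L z) = - of_real s * z"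
    using L by (auto simp: chart_def p_q)
  have "has_spread_deriv p f (- of_real s * E) (L z) \<longleftrightarrow>
      ((\<lambda>z'. (f (L z') - f (L z)) / (p (L z') - p (L z))) \<longlongrightarrow> - of_real s * E) (at z)"
    unfolding has_spread_deriv_def at_chart[OF L z] filterlim_filtermap ..
  also have "\<dots> \<longleftrightarrow> ((\<lambda>z'. - of_real s * ((f (L z') - f (L z)) / (z' - z))) \<longlongrightarrow> - of_real s * E) (at z)"
  proof (rule tendsto_cong)
    have "eventually (\<lambda>z'. z' \<in> D) (at z)"
      using D(1) z by (rule eventually_at_in_open')
    then show "\<forall>\<^sub>F z' in at z. (f (L z') - f (L z)) / (p (L z') - p (L z)) = - of_real s * ((f (L z') - f (L z)) / (z' - z))"
    proof eventually_elim
      case (elim z')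
      have "p (L z') - p (L z) = - of_real s * (z' - z)"
        using D(2)[OF elim] D(2)[OF z] by (simp add: algebra_simps)
      moreover have "a / (- of_real s * b) = - of_real s * (a / b)" for a b :: complex
        using s by auto
      ultimately show ?case by simp
    qed
  qed
  also have "\<dots> \<longleftrightarrow> ((\<lambda>z'. (f (L z') - f (L z)) / (z' - z)) \<longlongrightarrow> E) (at z)"
    using s by (intro tendsto_mult_left_iff) auto
  finally show ?thesis by (simp add: has_field_derivative_iff)
qed

lemma spread_deriv_chart:
  assumes L: "chart D L" and z: "z \<in> D" and f: "((\<lambda>z. f (L z)) has_field_derivative E) (at z)"
  shows "spread_deriv p f (L z) = - of_real s * E"
    and "has_spread_deriv p f (- of_real s * E) (L z)"
proof -
  show 1: "has_spread_deriv p f (- of_real s * E) (L z)"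
    using has_spread_deriv_chart[OF L z] f by blast
  have nb: "at (L z) \<noteq> bot" unfolding at_chart[OF L z] by (simp add: filtermap_bot_iff)
  have "has_spread_deriv p f (spread_deriv p f (L z)) (L z)"
    unfolding spread_deriv_def using 1 by (rule someI)
  with 1 nb show "spread_deriv p f (L z) = - of_real s * E"
    unfolding has_spread_deriv_def using tendsto_unique by blast
qed

lemma spread_holomorphic_chart:
  assumes f: "spread_holomorphic p f G" and L: "chart D L"
  shows "(\<lambda>z. f (L z)) holomorphic_on D"
proof -
  have "\<exists>E. ((\<lambda>z. f (L z)) has_field_derivative E) (at z)" if z: "z \<in> D" for z
  proof -
    have "L z \<in> G" using L z \<Delta>_sub by (auto simp: chart_def)
    then obtain E where "has_spread_deriv p f E (L z)"
      using f by (auto simp: spread_holomorphic_def)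
    moreover have "E = - of_real s * (- of_real s * E)" using s by auto
    ultimately have "has_spread_deriv p f (- of_real s * (- of_real s * E)) (L z)" by metis
    then show ?thesis using has_spread_deriv_chart[OF L z] by blast
  qed
  then show ?thesis using L by (auto simp: holomorphic_on_open chart_def)
qed

section \<open>Charts along horizontal rays\<close>

definition ray :: "'a \<Rightarrow> real \<Rightarrow> 'a" where "ray \<xi> = horizontal_ray p s \<Gamma> \<xi>"

lemma ray:
  assumes "\<xi> \<in> \<Gamma>"
  shows "continuous_on {0..} (ray \<xi>)" "\<And>x. x \<ge> 0 \<Longrightarrow> ray \<xi> x \<in> \<Gamma>" "ray \<xi> 0 = \<xi>"
    "\<And>x. x \<ge> 0 \<Longrightarrow> q (ray \<xi> x) = q \<xi> + of_real x"
proof -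
  have "\<exists>\<gamma>. horizontal_lift p s \<Gamma> \<xi> \<gamma>" using \<Gamma> assms by (auto simp: Gamma_domain_def)
  then have h: "horizontal_lift p s \<Gamma> \<xi> (ray \<xi>)"
    unfolding ray_def horizontal_ray_def by (rule someI_ex)
  show "continuous_on {0..} (ray \<xi>)" "\<And>x. x \<ge> 0 \<Longrightarrow> ray \<xi> x \<in> \<Gamma>" "ray \<xi> 0 = \<xi>"
    using h by (auto simp: horizontal_lift_def)
  show "q (ray \<xi> x) = q \<xi> + of_real x" if "x \<ge> 0" for x
  proof -
    have "p (ray \<xi> x) = p \<xi> - of_real (s * x)" using h that by (simp add: horizontal_lift_def)
    then show ?thesis by (simp add: q_def right_diff_distrib s_sq)
  qed
qed

lemma disc_chart:
  assumes "\<xi> \<in> \<Gamma>"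
  shows "\<exists>h. chart (ball (q \<xi>) d) h \<and> h (q \<xi>) = \<xi>"
proof -
  obtain V g where V: "open V" "\<xi> \<in> V" "V \<subseteq> \<Delta>" "homeomorphism V (ball (p \<xi>) d) p g"
    using \<Gamma> assms unfolding Gamma_domain_def by blast
  have b: "- of_real s * z \<in> ball (p \<xi>) d" if "z \<in> ball (q \<xi>) d" for z
  proof -
    have "dist (p \<xi>) (- of_real s * z) = norm (- of_real s * (q \<xi> - z))"
      by (simp only: p_q[of \<xi>] dist_norm right_diff_distrib)
    also have "\<dots> = dist (q \<xi>) z" using s by (auto simp: dist_norm norm_mult norm_minus_commute)
    finally show ?thesis using that by simp
  qed
  let ?h = "\<lambda>z. g (- of_real s * z)"
  have "continuous_on (ball (q \<xi>) d) ?h"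
    by (rule continuous_on_compose2[of "ball (p \<xi>) d" g]) (use V(4) b in \<open>auto simp: homeomorphism_def intro!: continuous_intros\<close>)
  moreover have "?h ` ball (q \<xi>) d \<subseteq> \<Delta>"
    using V(3,4) b unfolding homeomorphism_def by blast
  moreover have "q (?h z) = z" if "z \<in> ball (q \<xi>) d" for z
    using b[OF that] V(4) by (simp add: q_def homeomorphism_apply2 s_sq)
  ultimately have "chart (ball (q \<xi>) d) ?h"
    unfolding chart_def by blast
  moreover have "?h (q \<xi>) = \<xi>"
  proof -
    have "- of_real s * q \<xi> = p \<xi>" using p_q[of \<xi>] by (rule sym)
    then show ?thesis using homeomorphism_apply1[OF V(4,2)] by simp
  qed
  ultimately show ?thesis by (intro exI[of _ ?h] conjI)
qed

text \<open>Each disc chart follows the ray over the part of it inside the disc. Two overlapping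
  discs meet in a convex set containing the midpoint of their centres; this lies on the ray, so the
  charts agree there and hence on the whole overlap.\<close>

lemma strip_chart_exists:
  assumes \<xi>: "\<xi> \<in> \<Gamma>"
  shows "\<exists>L. chart (half_strip (q \<xi>) d) L \<and> (\<forall>x\<ge>0. L (q \<xi> + of_real x) = ray \<xi> x)"
proof -
  have dist_q: "dist (q \<xi> + of_real a) (q \<xi> + of_real b) = \<bar>a - b\<bar>" for a b
    by (simp add: dist_real_def)
  have "\<forall>x\<in>{0..}. \<exists>h. chart (ball (q \<xi> + of_real x) d) h \<and> h (q \<xi> + of_real x) = ray \<xi> x"
    using disc_chart[OF ray(2)[OF \<xi>]] ray(4)[OF \<xi>] by auto
  then obtain h where h: "\<And>x. x \<ge> 0 \<Longrightarrow> chart (ball (q \<xi> + of_real x) d) (h x)"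
      "\<And>x. x \<ge> 0 \<Longrightarrow> h x (q \<xi> + of_real x) = ray \<xi> x"
    by (metis (no_types, lifting) atLeast_iff bchoice)
  have h_ray: "h x (q \<xi> + of_real y) = ray \<xi> y" if xy: "x \<ge> 0" "y \<ge> 0" "\<bar>x - y\<bar> < d" for x y
  proof (rule lifts_agree[OF G, where a="\<lambda>t. h x (q \<xi> + of_real t)" and b="ray \<xi>" and C="closed_segment x y" and ?x0.0 = x])
    have sub: "t \<ge> 0 \<and> \<bar>x - t\<bar> < d" if "t \<in> closed_segment x y" for t
      using that xy by (auto simp: closed_segment_eq_real_ivl split: if_splits)
    have B: "q \<xi> + of_real t \<in> ball (q \<xi> + of_real x) d" if "t \<in> closed_segment x y" for t
      unfolding mem_ball dist_q using sub[OF that] by blast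
    show "continuous_on (closed_segment x y) (\<lambda>t. h x (q \<xi> + of_real t))"
      by (rule continuous_on_compose2[of "ball (q \<xi> + of_real x) d" "h x"])
        (use h(1)[OF xy(1)] B in \<open>auto simp: chart_def intro!: continuous_intros\<close>)
    show "continuous_on (closed_segment x y) (ray \<xi>)"
      using ray(1)[OF \<xi>] sub by (auto intro: continuous_on_subset)
    show "(\<lambda>t. h x (q \<xi> + of_real t)) ` closed_segment x y \<subseteq> G"
      using h(1)[OF xy(1)] B \<Delta>_sub unfolding chart_def by blast
    show "p (h x (q \<xi> + of_real t)) = p (ray \<xi> t)" if "t \<in> closed_segment x y" for t
      using h(1)[OF xy(1)] B[OF that] sub[OF that] ray(4)[OF \<xi>, of t] by (simp add: p_q chart_def)
  qed (use h(2) xy in auto)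
  have agree: "h x z = h x' z" if x: "x \<ge> 0" "x' \<ge> 0"
    and z: "z \<in> ball (q \<xi> + of_real x) d" "z \<in> ball (q \<xi> + of_real x') d" for x x' z
  proof (rule charts_agree[OF h(1)[OF x(1)] h(1)[OF x(2)]])
    let ?K = "ball (q \<xi> + of_real x) d \<inter> ball (q \<xi> + of_real x') d"
    show "connected ?K" by (intro convex_connected convex_Int convex_ball)
    let ?y = "(x + x') / 2"
    have "dist (q \<xi> + of_real x) (q \<xi> + of_real x') < d + d"
      by (rule dist_triangle_less_add[of _ z]) (use z in auto)
    then have "\<bar>x - x'\<bar> < 2 * d" unfolding dist_q by simp
    then have xx: "\<bar>x - ?y\<bar> < d" "\<bar>x' - ?y\<bar> < d" by (auto simp: field_simps abs_less_iff)
    then show "q \<xi> + of_real ?y \<in> ?K"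
      unfolding Int_iff mem_ball dist_q by blast
    show "h x (q \<xi> + of_real ?y) = h x' (q \<xi> + of_real ?y)"
      using h_ray[OF x(1) _ xx(1)] h_ray[OF x(2) _ xx(2)] x by simp
  qed (use z in auto)
  define X where "X = (\<lambda>z. SOME x. x \<ge> 0 \<and> z \<in> ball (q \<xi> + of_real x) d)"
  have X: "X z \<ge> 0 \<and> z \<in> ball (q \<xi> + of_real (X z)) d" if "z \<in> half_strip (q \<xi>) d" for z
    unfolding X_def by (rule someI_ex) (use that d in \<open>auto simp: half_strip_eq_UN\<close>)
  define L where "L = (\<lambda>z. h (X z) z)"
  have Lh: "L z = h x z" if "x \<ge> 0" "z \<in> ball (q \<xi> + of_real x) d" for x z
  proof -
    have "z \<in> half_strip (q \<xi>) d" using that d by (auto simp: half_strip_eq_UN)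
    then have "X z \<ge> 0" "z \<in> ball (q \<xi> + of_real (X z)) d" using X by blast+
    then show ?thesis unfolding L_def using that by (intro agree)
  qed
  have "continuous_on (half_strip (q \<xi>) d) L"
    unfolding half_strip_eq_UN[OF d]
  proof (rule continuous_on_open_UN)
    fix x :: real assume "x \<in> {0..}"
    then have "continuous_on (ball (q \<xi> + of_real x) d) (h x)" using h(1) by (simp add: chart_def)
    then show "continuous_on (ball (q \<xi> + of_real x) d) L"
      using \<open>x \<in> {0..}\<close> Lh by (subst continuous_on_cong[OF refl, of _ L "h x"]) auto
  qed auto
  moreover have "L z \<in> \<Delta> \<and> q (L z) = z" if "z \<in> half_strip (q \<xi>) d" for z
    using X[OF that] h(1)[of "X z"] by (auto simp: L_def chart_def)
  ultimately have "chart (half_strip (q \<xi>) d) L"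
    using open_half_strip[OF d] by (auto simp: chart_def)
  moreover have "L (q \<xi> + of_real x) = ray \<xi> x" if "x \<ge> 0" for x
    using Lh[OF that, of "q \<xi> + of_real x"] h(2)[OF that] d by simp
  ultimately show ?thesis by blast
qed

definition lift :: "'a \<Rightarrow> complex \<Rightarrow> 'a" where
  "lift \<xi> = (SOME L. chart (half_strip (q \<xi>) d) L \<and> (\<forall>x\<ge>0. L (q \<xi> + of_real x) = ray \<xi> x))"

lemma lift:
  assumes "\<xi> \<in> \<Gamma>"
  shows "chart (half_strip (q \<xi>) d) (lift \<xi>)" "\<And>x. x \<ge> 0 \<Longrightarrow> lift \<xi> (q \<xi> + of_real x) = ray \<xi> x"
    "lift \<xi> (q \<xi>) = \<xi>"
proof -
  show "chart (half_strip (q \<xi>) d) (lift \<xi>)" and 2: "\<And>x. x \<ge> 0 \<Longrightarrow> lift \<xi> (q \<xi> + of_real x) = ray \<xi> x"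
    using someI_ex[OF strip_chart_exists[OF assms]] unfolding lift_def[symmetric] by blast+
  show "lift \<xi> (q \<xi>) = \<xi>" using 2[of 0] ray(3)[OF assms] by simp
qed

text \<open>Consistency of charts with different centres: both are sections over the convex
  intersection of the half-strips and agree at \<open>z\<close>.\<close>

lemma lift_lift:
  assumes \<xi>: "\<xi> \<in> \<Gamma>" and z: "z \<in> half_strip (q \<xi>) d" "lift \<xi> z \<in> \<Gamma>"
    and z': "z' \<in> half_strip (q \<xi>) d" "z' \<in> half_strip z d"
  shows "lift (lift \<xi> z) z' = lift \<xi> z'"
proof -
  have q: "q (lift \<xi> z) = z" using lift(1)[OF \<xi>] z by (auto simp: chart_def)
  show ?thesis
  proof (rule charts_agree[OF lift(1)[OF z(2)] lift(1)[OF \<xi>]])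
    show "connected (half_strip (q \<xi>) d \<inter> half_strip z d)"
      by (intro convex_connected convex_Int convex_half_strip d)
    show "z \<in> half_strip (q \<xi>) d \<inter> half_strip z d"
      using z half_strip_base[OF d, of 0 z] by simp
    show "lift (lift \<xi> z) z = lift \<xi> z" using lift(3)[OF z(2)] q by simp
  qed (use z' q in auto)
qed

end

section \<open>Bounds on the data\<close>

definition weight :: "real \<Rightarrow> real \<Rightarrow> real" where
  "weight \<rho> x = (1 + \<bar>x\<bar>) powr (- (1 + \<rho>))"

text \<open>The integral of \<open>weight\<close> from \<open>x\<close> to infinity in closed form;
  the whole line contributes \<open>2 / \<rho>\<close>.\<close>

definition weight_tail :: "real \<Rightarrow> real \<Rightarrow> real" where
  "weight_tail \<rho> x = (if x \<ge> 0 then (1 + x) powr (- \<rho>) else 2 - (1 - x) powr (- \<rho>)) / \<rho>"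

lemma weight_pos: "weight \<rho> x > 0"
  by (simp add: weight_def)

lemma weight_le_1: "\<rho> > 0 \<Longrightarrow> weight \<rho> x \<le> 1"
  using powr_mono[of "- (1 + \<rho>)" 0 "1 + \<bar>x\<bar>"] by (simp add: weight_def split: if_splits)

lemma weight_tail_deriv:
  assumes "\<rho> > 0"
  shows "(weight_tail \<rho> has_real_derivative - weight \<rho> x) (at x)"
proof -
  define a where "a = (\<lambda>x. (1 + x) powr (- \<rho>) / \<rho>)"
  define b where "b = (\<lambda>x. (2 - (1 - x) powr (- \<rho>)) / \<rho>)"
  have a: "(a has_real_derivative - weight \<rho> x) (at x)" if "x \<ge> 0" for x
  proof -
    have "(a has_real_derivative (- \<rho> * (1 + x) powr (- \<rho> - 1) * 1) / \<rho>) (at x)"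
      unfolding a_def using that by (auto intro!: derivative_eq_intros)
    also have "(- \<rho> * (1 + x) powr (- \<rho> - 1) * 1) / \<rho> = - ((1 + x) powr (- \<rho> - 1))"
      using assms by simp
    also have "- \<rho> - 1 = - (1 + \<rho>)" by simp
    finally show ?thesis using that by (simp add: weight_def)
  qed
  have b: "(b has_real_derivative - weight \<rho> x) (at x)" if "x \<le> 0" for x
  proof -
    have "(b has_real_derivative (0 - (- \<rho> * (1 - x) powr (- \<rho> - 1) * (- 1))) / \<rho>) (at x)"
      unfolding b_def using that by (auto intro!: derivative_eq_intros)
    also have "(0 - (- \<rho> * (1 - x) powr (- \<rho> - 1) * (- 1))) / \<rho> = - ((1 - x) powr (- \<rho> - 1))"
      using assms by simp
    also have "- \<rho> - 1 = - (1 + \<rho>)" by simp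
    finally show ?thesis using that by (simp add: weight_def)
  qed
  consider "x > 0" | "x < 0" | "x = 0" by linarith
  then show ?thesis
  proof cases
    case 1
    have "(a has_real_derivative - weight \<rho> x) (at x)" using a 1 by simp
    then show ?thesis
      by (rule has_field_derivative_transform_within_open[of _ _ _ "{0<..}"]) (use 1 in \<open>auto simp: a_def weight_tail_def\<close>)
  next
    case 2
    have "(b has_real_derivative - weight \<rho> x) (at x)" using b 2 by simp
    then show ?thesis
      by (rule has_field_derivative_transform_within_open[of _ _ _ "{..<0}"]) (use 2 in \<open>auto simp: b_def weight_tail_def\<close>)
  next
    case 3
    \<comment> \<open>At the junction the two one-sided derivatives are computed from the two
      formulas and coincide.\<close>
    have ab: "a 0 = weight_tail \<rho> 0" "b 0 = weight_tail \<rho> 0"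
      by (auto simp: a_def b_def weight_tail_def)
    have "((\<lambda>y. (weight_tail \<rho> y - weight_tail \<rho> 0) / (y - 0)) \<longlongrightarrow> - weight \<rho> 0) (at_left 0)"
    proof (rule Lim_transform_eventually)
      show "((\<lambda>y. (b y - b 0) / (y - 0)) \<longlongrightarrow> - weight \<rho> 0) (at_left 0)"
        using b[of 0] unfolding has_field_derivative_iff by (simp add: filterlim_at_split)
      show "\<forall>\<^sub>F y in at_left 0. (b y - b 0) / (y - 0) = (weight_tail \<rho> y - weight_tail \<rho> 0) / (y - 0)"
        by (rule eventually_at_leftI[of "-1"]) (auto simp: ab(2)[symmetric] simp: b_def weight_tail_def)
    qed
    moreover have "((\<lambda>y. (weight_tail \<rho> y - weight_tail \<rho> 0) / (y - 0)) \<longlongrightarrow> - weight \<rho> 0) (at_right 0)"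
    proof (rule Lim_transform_eventually)
      show "((\<lambda>y. (a y - a 0) / (y - 0)) \<longlongrightarrow> - weight \<rho> 0) (at_right 0)"
        using a[of 0] unfolding has_field_derivative_iff by (simp add: filterlim_at_split)
      show "\<forall>\<^sub>F y in at_right 0. (a y - a 0) / (y - 0) = (weight_tail \<rho> y - weight_tail \<rho> 0) / (y - 0)"
        by (rule eventually_at_rightI[of _ 1]) (auto simp: ab(1)[symmetric] simp: a_def weight_tail_def)
    qed
    ultimately show ?thesis unfolding 3 has_field_derivative_iff by (simp add: filterlim_at_split)
  qed
qed

lemma weight_tail_le:
  assumes "\<rho> > 0"
  shows "weight_tail \<rho> x \<le> 2 / \<rho>"
proof -
  have "(1 + x) powr (- \<rho>) \<le> 1" if "x \<ge> 0"
    using powr_mono[of "- \<rho>" 0 "1 + x"] that assms by simp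
  moreover have "(1 - x) powr (- \<rho>) \<ge> 0" by simp
  ultimately have "(if x \<ge> 0 then (1 + x) powr (- \<rho>) else 2 - (1 - x) powr (- \<rho>)) \<le> 2" by auto
  then show ?thesis using assms by (simp add: weight_tail_def divide_right_mono)
qed

lemma weight_tail_lim:
  assumes "\<rho> > 0"
  shows "(weight_tail \<rho> \<longlongrightarrow> 0) at_top"
proof (rule Lim_transform_eventually)
  show "((\<lambda>x. (1 + x) powr (- \<rho>) / \<rho>) \<longlongrightarrow> 0) at_top"
    using assms by real_asymp
  show "\<forall>\<^sub>F x in at_top. (1 + x) powr (- \<rho>) / \<rho> = weight_tail \<rho> x"
    using eventually_ge_at_top[of 0] by eventually_elim (simp add: weight_tail_def)
qed

text \<open>For \<open>x \<le> 2 * d\<close> both sides are of order one; beyond,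
  \<open>1 + (x - d) \<ge> x / 2\<close> gives the decay. The constant is the sum of those for the
  two ranges.\<close>

lemma weight_tail_shift_le:
  assumes \<rho>: "\<rho> > 0" and d: "d > 0"
  shows "weight_tail \<rho> (x - d) \<le> (2 / \<rho> * max 1 ((2 * d) powr \<rho>) + 2 powr \<rho> / \<rho>) / max 1 (sgn x * \<bar>x\<bar> powr \<rho>)"
proof -
  let ?m = "max 1 (sgn x * \<bar>x\<bar> powr \<rho>)"
  have m: "?m > 0" by simp
  have "weight_tail \<rho> (x - d) * ?m \<le> 2 / \<rho> * max 1 ((2 * d) powr \<rho>) + 2 powr \<rho> / \<rho>"
  proof (cases "x \<le> 2 * d")
    case True
    have "?m \<le> max 1 ((2 * d) powr \<rho>)"
    proof (cases "x > 0")
      case True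
      then have "x powr \<rho> \<le> (2 * d) powr \<rho>" using \<open>x \<le> 2 * d\<close> \<rho> by (intro powr_mono2) auto
      then show ?thesis using True by (simp add: max.coboundedI2)
    next
      case False
      then have "sgn x * \<bar>x\<bar> powr \<rho> \<le> 0" by (auto simp: sgn_if)
      then show ?thesis by simp
    qed
    moreover have "?m \<ge> 0" by simp
    ultimately have "weight_tail \<rho> (x - d) * ?m \<le> 2 / \<rho> * max 1 ((2 * d) powr \<rho>)"
      using weight_tail_le[OF \<rho>, of "x - d"] \<rho> by (intro mult_mono) auto
    moreover have "2 powr \<rho> / \<rho> \<ge> 0" using \<rho> by simp
    ultimately show ?thesis by linarith
  next
    case False
    then have x: "x > 2 * d" by simp
    have "weight_tail \<rho> (x - d) * 1 \<le> 2 / \<rho> * max 1 ((2 * d) powr \<rho>)"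
      using weight_tail_le[OF \<rho>, of "x - d"] \<rho> by (intro mult_mono) auto
    moreover have "weight_tail \<rho> (x - d) * x powr \<rho> \<le> 2 powr \<rho> / \<rho>"
    proof -
      have "(1 + (x - d)) powr (- \<rho>) \<le> (x / 2) powr (- \<rho>)"
        using x d \<rho> by (intro powr_mono2') auto
      then have "weight_tail \<rho> (x - d) \<le> (x / 2) powr (- \<rho>) / \<rho>"
        using x d \<rho> by (simp add: weight_tail_def divide_right_mono)
      then have "weight_tail \<rho> (x - d) * x powr \<rho> \<le> (x / 2) powr (- \<rho>) / \<rho> * x powr \<rho>"
        by (rule mult_right_mono) simp
      also have "\<dots> = 2 powr \<rho> / \<rho>"
        using x d by (simp add: powr_minus powr_divide field_simps)
      finally show ?thesis .
    qed
    moreover have "2 / \<rho> * max 1 ((2 * d) powr \<rho>) \<ge> 0" "2 powr \<rho> / \<rho> \<ge> 0"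
      using \<rho> by (auto intro!: mult_nonneg_nonneg)
    ultimately show ?thesis using x d by (auto simp: max_def)
  qed
  then show ?thesis using m by (simp add: pos_le_divide_eq)
qed

text \<open>A Peetre-type inequality: bounded shifts change the weight by at most a constant
  factor.\<close>

lemma weight_shift:
  assumes "\<rho> > 0" "0 \<le> b" "b \<le> R" "\<bar>x - y\<bar> \<le> b"
  shows "weight \<rho> x \<le> (1 + R) powr (1 + \<rho>) * weight \<rho> y"
proof -
  have "(1 + \<bar>y\<bar>) \<le> (1 + \<bar>x\<bar>) * (1 + R)"
  proof -
    have "\<bar>y\<bar> \<le> \<bar>x\<bar> + R" using assms by linarith
    moreover have "\<bar>x\<bar> * R \<ge> 0" using assms by simp
    ultimately show ?thesis by (simp add: algebra_simps)
  qed
  then have "(1 + \<bar>y\<bar>) powr (1 + \<rho>) \<le> ((1 + \<bar>x\<bar>) * (1 + R)) powr (1 + \<rho>)"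
    using assms by (intro powr_mono2) auto
  also have "\<dots> = (1 + \<bar>x\<bar>) powr (1 + \<rho>) * (1 + R) powr (1 + \<rho>)"
    by (rule powr_mult)
  finally show ?thesis
    unfolding weight_def powr_minus by (simp add: divide_simps mult_ac) linarith
qed

lemma decay_le_powr:
  fixes a x y :: real
  assumes "a > 0" "0 \<le> x" "x \<le> y"
  shows "1 / (1 + y powr a) \<le> 2 powr a * (1 + x) powr (- a)"
proof -
  have "(1 + x) powr a \<le> (2 * max 1 y) powr a"
    using assms by (intro powr_mono2) auto
  also have "\<dots> = 2 powr a * (max 1 y) powr a"
    by (rule powr_mult)
  also have "(max 1 y) powr a \<le> 1 + y powr a"
    using assms by (auto simp: max_def)
  finally have "(1 + x) powr a \<le> 2 powr a * (1 + y powr a)" by simp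
  moreover have "1 + y powr a > 0" by (intro add_pos_nonneg) auto
  ultimately show ?thesis
    using assms by (simp add: powr_minus field_simps)
qed

section \<open>The data under (C1) or (C2) in the charts\<close>

locale wkb_data = wkb_setting p G \<Delta> \<Gamma> s d
  for p :: "'a::t2_space \<Rightarrow> complex" and G \<Delta> \<Gamma> :: "'a set" and s d :: real +
  fixes \<phi> \<psi> :: "'a \<Rightarrow> complex" and c \<rho> :: real
  assumes hol_\<phi>: "spread_holomorphic p \<phi> G" and hol_\<psi>: "spread_holomorphic p \<psi> G"
    and C12: "C1 p \<phi> \<psi> \<Delta> c \<rho> \<or> C2 p \<phi> \<psi> \<Delta> c \<rho>"
begin

text \<open>The potential \<open>g = \<phi>\<^sup>2/4 - \<phi>'/2 - \<psi>\<close> with respect to \<open>q\<close>: here \<open>d/dq = - s d/dp\<close>.\<close>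

definition pot :: "'a \<Rightarrow> complex" where
  "pot \<zeta> = (1/4) * (\<phi> \<zeta>)^2 + of_real s * (1/2) * spread_deriv p \<phi> \<zeta> - \<psi> \<zeta>"

lemma c_pos: "c > 0" and \<rho>_pos: "\<rho> > 0"
  using C12 by (auto simp: C1_def C2_def)

lemma \<phi>_chart:
  assumes L: "chart D L" and z: "z \<in> D"
  shows "((\<lambda>z. \<phi> (L z)) has_field_derivative deriv (\<lambda>z. \<phi> (L z)) z) (at z)"
    and "spread_deriv p \<phi> (L z) = - of_real s * deriv (\<lambda>z. \<phi> (L z)) z"
proof -
  show 1: "((\<lambda>z. \<phi> (L z)) has_field_derivative deriv (\<lambda>z. \<phi> (L z)) z) (at z)"
    using spread_holomorphic_chart[OF hol_\<phi> L] z L by (auto simp: chart_def intro: holomorphic_derivI)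
  show "spread_deriv p \<phi> (L z) = - of_real s * deriv (\<lambda>z. \<phi> (L z)) z"
    using spread_deriv_chart(1)[OF L z 1] .
qed

lemma pot_chart:
  assumes L: "chart D L" and z: "z \<in> D"
  shows "pot (L z) = (1/4) * (\<phi> (L z))^2 - (1/2) * deriv (\<lambda>z. \<phi> (L z)) z - \<psi> (L z)"
  unfolding pot_def \<phi>_chart(2)[OF L z] using s by auto

lemma pot_chart_holomorphic:
  assumes L: "chart D L"
  shows "(\<lambda>z. pot (L z)) holomorphic_on D"
proof -
  have D: "open D" using L by (simp add: chart_def)
  have "(\<lambda>z. (1/4) * (\<phi> (L z))^2 - (1/2) * deriv (\<lambda>z. \<phi> (L z)) z - \<psi> (L z)) holomorphic_on D"
    by (intro holomorphic_intros holomorphic_deriv D spread_holomorphic_chart[OF hol_\<phi> L] spread_holomorphic_chart[OF hol_\<psi> L])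
  then show ?thesis
    by (rule holomorphic_transform) (simp add: pot_chart[OF L])
qed

lemma norm_chart: "chart D L \<Longrightarrow> z \<in> D \<Longrightarrow> norm (p (L z)) = norm z"
  using s by (auto simp: p_q chart_def norm_mult)

text \<open>Under (C1) the bound on \<open>\<phi>'\<close> comes from Cauchy's inequality, which costs the passage from \<open>d\<close> to \<open>r\<close>.\<close>

lemma data_bounds:
  assumes r: "0 < r" "r < d"
  shows "\<exists>c'>0. \<forall>\<xi>\<in>\<Gamma>. \<forall>z\<in>half_strip (q \<xi>) r.
     norm (\<phi> (lift \<xi> z)) \<le> c' * (1 + \<bar>Re z\<bar>) powr (- (1/2)) \<and>
     norm (\<phi> (lift \<xi> z)) ^ 2 \<le> c' * weight \<rho> (Re z) \<and>
     norm (deriv (\<lambda>z. \<phi> (lift \<xi> z)) z) \<le> c' * weight \<rho> (Re z) \<and>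
     norm (\<psi> (lift \<xi> z)) \<le> c' * weight \<rho> (Re z)"
proof -
  let ?e = "(2::real) powr (1 + \<rho>)"
  have sub: "half_strip (q \<xi>) r \<subseteq> half_strip (q \<xi>) d" for \<xi>
    using r by (intro half_strip_mono) auto
  have in_\<Delta>: "lift \<xi> z \<in> \<Delta>" "norm (p (lift \<xi> z)) = norm z" if "\<xi> \<in> \<Gamma>" "z \<in> half_strip (q \<xi>) d" for \<xi> z
    using lift(1)[OF that(1)] that norm_chart by (auto simp: chart_def)
  have dec: "c / (1 + norm z powr (1 + \<rho>)) \<le> c * ?e * weight \<rho> (Re z)" for z :: complex
    using mult_left_mono[OF decay_le_powr[of "1 + \<rho>" "\<bar>Re z\<bar>" "norm z"], of c] c_pos \<rho>_pos abs_Re_le_cmod[of z]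
    by (simp add: weight_def mult_ac)
  \<comment> \<open>The exponent \<open>1/2\<close> is a decay rate of \<phi> available under either
    condition; the integrable weight is required only for its square and its derivative.\<close>
  have powr_half: "a powr (- (1/2 + \<rho>)) \<le> a powr (- (1/2))" "a powr (- (1 + \<rho>)) \<le> a powr (- (1/2))"
    "a powr (- (1 + 2 * \<rho>)) \<le> a powr (- (1 + \<rho>))" "a powr (- (2 + 2 * \<rho>)) \<le> a powr (- (1 + \<rho>))" if "a \<ge> 1" for a :: real
    using that \<rho>_pos by (auto intro!: powr_mono)
  from C12 show ?thesis
  proof
    assume C: "C1 p \<phi> \<psi> \<Delta> c \<rho>"
    \<comment> \<open>Discs of this radius about points of the \<open>r\<close>-strip stay inside
      the \<open>d\<close>-strip, where (C1) can be used.\<close>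
    define \<delta> where "\<delta> = (d - r) / 2"
    have \<delta>: "\<delta> > 0" "r + \<delta> \<le> d" using r by (auto simp: \<delta>_def field_simps)
    have b: "norm (\<phi> (lift \<xi> z)) \<le> c * ?e * weight \<rho> (Re z)" "norm (\<psi> (lift \<xi> z)) \<le> c * ?e * weight \<rho> (Re z)"
      if "\<xi> \<in> \<Gamma>" "z \<in> half_strip (q \<xi>) d" for \<xi> z
      using C in_\<Delta>[OF that] dec[of z] unfolding C1_def by (metis order_trans)+
    define k where "k = c * ?e * (1 + \<delta>) powr (1 + \<rho>) / \<delta>"
    have der: "norm (deriv (\<lambda>z. \<phi> (lift \<xi> z)) z) \<le> k * weight \<rho> (Re z)"
      if \<xi>: "\<xi> \<in> \<Gamma>" and z: "z \<in> half_strip (q \<xi>) r" for \<xi> z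
    proof -
      have cb: "cball z \<delta> \<subseteq> half_strip (q \<xi>) d"
        using half_strip_cball[OF r(1) \<delta> z] .
      have "norm ((deriv ^^ 1) (\<lambda>z. \<phi> (lift \<xi> z)) z) \<le> fact 1 * (c * ?e * ((1 + \<delta>) powr (1 + \<rho>) * weight \<rho> (Re z))) / \<delta> ^ 1"
      proof (rule Cauchy_inequality)
        have "(\<lambda>z. \<phi> (lift \<xi> z)) holomorphic_on half_strip (q \<xi>) d"
          by (rule spread_holomorphic_chart[OF hol_\<phi> lift(1)[OF \<xi>]])
        from holomorphic_on_subset[OF this cb]
        show "(\<lambda>z. \<phi> (lift \<xi> z)) holomorphic_on ball z \<delta>" "continuous_on (cball z \<delta>) (\<lambda>z. \<phi> (lift \<xi> z))"
          using ball_subset_cball[of z \<delta>] by (auto intro: holomorphic_on_imp_continuous_on holomorphic_on_subset)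
        fix x assume x: "norm (z - x) = \<delta>"
        then have "x \<in> half_strip (q \<xi>) d" using cb by (auto simp: dist_norm)
        then have "norm (\<phi> (lift \<xi> x)) \<le> c * ?e * weight \<rho> (Re x)" using b \<xi> by blast
        also have "weight \<rho> (Re x) \<le> (1 + \<delta>) powr (1 + \<rho>) * weight \<rho> (Re z)"
          using abs_Re_le_cmod[of "z - x"] x \<delta> \<rho>_pos by (intro weight_shift[of _ \<delta>]) (auto simp: abs_minus_commute)
        finally show "norm (\<phi> (lift \<xi> x)) \<le> c * ?e * ((1 + \<delta>) powr (1 + \<rho>) * weight \<rho> (Re z))"
          using c_pos by simp
      qed (use \<delta> in auto)
      then show ?thesis by (simp add: k_def mult_ac)
    qed
    define c' where "c' = c * ?e + (c * ?e)^2 + k"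
    have k: "k \<ge> 0" "c * ?e > 0" using c_pos \<delta> by (auto simp: k_def)
    then have c': "c' > 0" "c * ?e \<le> c'" "(c * ?e)^2 \<le> c'" "k \<le> c'"
      by (auto simp: c'_def intro!: add_pos_nonneg)
    show ?thesis
    proof (intro exI[of _ c'] conjI ballI c'(1))
      fix \<xi> z assume \<xi>: "\<xi> \<in> \<Gamma>" and z: "z \<in> half_strip (q \<xi>) r"
      have zd: "z \<in> half_strip (q \<xi>) d" using sub z by auto
      have w: "weight \<rho> (Re z) \<ge> 0" using weight_pos[of \<rho> "Re z"] by simp
      have "norm (\<phi> (lift \<xi> z)) \<le> c * ?e * (1 + \<bar>Re z\<bar>) powr (- (1/2))"
        using b(1)[OF \<xi> zd] mult_left_mono[OF powr_half(2)[of "1 + \<bar>Re z\<bar>"], of "c * ?e"] k by (simp add: weight_def)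
      then show "norm (\<phi> (lift \<xi> z)) \<le> c' * (1 + \<bar>Re z\<bar>) powr (- (1/2))"
        using mult_right_mono[OF c'(2), of "(1 + \<bar>Re z\<bar>) powr (- (1/2))"] by simp
      have "norm (\<phi> (lift \<xi> z)) ^ 2 \<le> (c * ?e * weight \<rho> (Re z)) ^ 2"
        using b(1)[OF \<xi> zd] by (intro power_mono) auto
      also have "\<dots> = (c * ?e)^2 * (weight \<rho> (Re z) * weight \<rho> (Re z))" by (simp add: power2_eq_square mult_ac)
      also have "\<dots> \<le> c' * (weight \<rho> (Re z) * 1)"
        using c' w weight_le_1[OF \<rho>_pos] by (intro mult_mono) auto
      finally show "norm (\<phi> (lift \<xi> z)) ^ 2 \<le> c' * weight \<rho> (Re z)" by simp
      show "norm (deriv (\<lambda>z. \<phi> (lift \<xi> z)) z) \<le> c' * weight \<rho> (Re z)"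
        using der[OF \<xi> z] mult_right_mono[OF c'(4) w] by simp
      show "norm (\<psi> (lift \<xi> z)) \<le> c' * weight \<rho> (Re z)"
        using b(2)[OF \<xi> zd] mult_right_mono[OF c'(2) w] by simp
    qed
  next
    assume C: "C2 p \<phi> \<psi> \<Delta> c \<rho>"
    let ?f = "(2::real) powr (1/2 + \<rho>)"
    define c' where "c' = c * ?e + c * ?f + (c * ?f)^2"
    have k: "c * ?f > 0" "c * ?e > 0" using c_pos by auto
    then have c': "c' > 0" "c * ?e \<le> c'" "c * ?f \<le> c'" "(c * ?f)^2 \<le> c'"
      by (auto simp: c'_def intro!: add_pos_nonneg)
    show ?thesis
    proof (intro exI[of _ c'] conjI ballI c'(1))
      fix \<xi> z assume \<xi>: "\<xi> \<in> \<Gamma>" and z: "z \<in> half_strip (q \<xi>) r"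
      have zd: "z \<in> half_strip (q \<xi>) d" using sub z by auto
      have w: "weight \<rho> (Re z) \<ge> 0" using weight_pos[of \<rho> "Re z"] by simp
      have L: "chart (half_strip (q \<xi>) d) (lift \<xi>)" using lift(1)[OF \<xi>] .
      have 1: "norm (\<phi> (lift \<xi> z)) \<le> c * ?f * (1 + \<bar>Re z\<bar>) powr (- (1/2 + \<rho>))"
      proof -
        have "norm (\<phi> (lift \<xi> z)) \<le> c / (1 + norm z powr (1/2 + \<rho>))"
          using C in_\<Delta>[OF \<xi> zd] unfolding C2_def by metis
        also have "\<dots> \<le> c * ?f * (1 + \<bar>Re z\<bar>) powr (- (1/2 + \<rho>))"
          using mult_left_mono[OF decay_le_powr[of "1/2 + \<rho>" "\<bar>Re z\<bar>" "norm z"], of c] c_pos \<rho>_pos abs_Re_le_cmod[of z]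
          by (simp add: mult_ac)
        finally show ?thesis .
      qed
      have "norm (\<phi> (lift \<xi> z)) \<le> c * ?f * (1 + \<bar>Re z\<bar>) powr (- (1/2))"
        using 1 mult_left_mono[OF powr_half(1)[of "1 + \<bar>Re z\<bar>"], of "c * ?f"] k by simp
      then show "norm (\<phi> (lift \<xi> z)) \<le> c' * (1 + \<bar>Re z\<bar>) powr (- (1/2))"
        using mult_right_mono[OF c'(3), of "(1 + \<bar>Re z\<bar>) powr (- (1/2))"] by simp
      have "norm (\<phi> (lift \<xi> z)) ^ 2 \<le> (c * ?f * (1 + \<bar>Re z\<bar>) powr (- (1/2 + \<rho>))) ^ 2"
        using 1 by (intro power_mono) auto
      \<comment> \<open>Squaring the exponent \<open>1/2 + \<rho>\<close> of (C2) gives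
        \<open>1 + 2 * \<rho>\<close>, which is integrable.\<close>
      also have "\<dots> = (c * ?f)^2 * (1 + \<bar>Re z\<bar>) powr (- (1 + 2 * \<rho>))"
        by (simp add: power_mult_distrib power2_eq_square flip: powr_add)
      also have "\<dots> \<le> c' * weight \<rho> (Re z)"
        using c' powr_half(3)[of "1 + \<bar>Re z\<bar>"] unfolding weight_def by (intro mult_mono) auto
      finally show "norm (\<phi> (lift \<xi> z)) ^ 2 \<le> c' * weight \<rho> (Re z)" .
      have "norm (deriv (\<lambda>z. \<phi> (lift \<xi> z)) z) = norm (spread_deriv p \<phi> (lift \<xi> z))"
        unfolding \<phi>_chart(2)[OF L zd] using s by (auto simp: norm_mult)
      also have "\<dots> \<le> c / (1 + norm z powr (1 + \<rho>))"
        using C in_\<Delta>[OF \<xi> zd] unfolding C2_def by metis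
      also have "\<dots> \<le> c * ?e * weight \<rho> (Re z)" by (rule dec)
      also have "\<dots> \<le> c' * weight \<rho> (Re z)" using c' w by (intro mult_right_mono)
      finally show "norm (deriv (\<lambda>z. \<phi> (lift \<xi> z)) z) \<le> c' * weight \<rho> (Re z)" .
      have "norm (\<psi> (lift \<xi> z)) \<le> c / (1 + norm z powr (1 + \<rho>))"
        using C in_\<Delta>[OF \<xi> zd] unfolding C2_def by metis
      also have "\<dots> \<le> c * ?e * weight \<rho> (Re z)" by (rule dec)
      also have "\<dots> \<le> c' * weight \<rho> (Re z)" using c' w by (intro mult_right_mono)
      finally show "norm (\<psi> (lift \<xi> z)) \<le> c' * weight \<rho> (Re z)" .
    qed
  qed
qed

text \<open>The majorants and constants are common to all charts; this is the source of uniformity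
  in \<xi>.\<close>

definition strip_constants :: "real \<Rightarrow> (real \<Rightarrow> real) \<Rightarrow> (real \<Rightarrow> real) \<Rightarrow> (real \<Rightarrow> real) \<Rightarrow> real \<Rightarrow> bool" where
  "strip_constants r \<gamma> H \<kappa> M \<longleftrightarrow> (\<forall>\<xi>\<in>\<Gamma>. wkb_strip (half_strip (q \<xi>) r) (\<lambda>z. \<phi> (lift \<xi> z)) (\<lambda>z. pot (lift \<xi> z)) \<gamma> H \<kappa> (2 * d) M (2 * r))"

lemma strip_constants_exist:
  assumes r: "0 < r" "r < d"
  shows "\<exists>\<gamma> H \<kappa> M K0. strip_constants r \<gamma> H \<kappa> M \<and> K0 > 0 \<and> (\<forall>x. H (x - d) \<le> K0 / max 1 (sgn x * \<bar>x\<bar> powr \<rho>))"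
proof -
  obtain c' where c': "c' > 0"
    "\<And>\<xi> z. \<xi> \<in> \<Gamma> \<Longrightarrow> z \<in> half_strip (q \<xi>) r \<Longrightarrow> norm (\<phi> (lift \<xi> z)) \<le> c' * (1 + \<bar>Re z\<bar>) powr (- (1/2))"
    "\<And>\<xi> z. \<xi> \<in> \<Gamma> \<Longrightarrow> z \<in> half_strip (q \<xi>) r \<Longrightarrow> norm (\<phi> (lift \<xi> z)) ^ 2 \<le> c' * weight \<rho> (Re z)"
    "\<And>\<xi> z. \<xi> \<in> \<Gamma> \<Longrightarrow> z \<in> half_strip (q \<xi>) r \<Longrightarrow> norm (deriv (\<lambda>z. \<phi> (lift \<xi> z)) z) \<le> c' * weight \<rho> (Re z)"
    "\<And>\<xi> z. \<xi> \<in> \<Gamma> \<Longrightarrow> z \<in> half_strip (q \<xi>) r \<Longrightarrow> norm (\<psi> (lift \<xi> z)) \<le> c' * weight \<rho> (Re z)"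
    using data_bounds[OF r] by blast
  \<comment> \<open>\<open>2 * c'\<close> covers the weights \<open>1/4 + 1/2 + 1\<close> of the
    three terms of \<open>pot\<close>; the power pays for the slack \<open>b \<le> 2 * d\<close>
    through \<open>weight_shift\<close>.\<close>
  define k where "k = 2 * c' * (1 + 2 * d) powr (1 + \<rho>)"
  have k1: "(1 + 2 * d) powr (1 + \<rho>) \<ge> 1"
    using d \<rho>_pos by (intro ge_one_powr_ge_zero) auto
  have k: "k > 0" "k \<ge> c'"
    using c'(1) mult_mono[OF order_refl k1, of "2 * c'"] d by (auto simp: k_def)
  define \<gamma> where "\<gamma> = (\<lambda>x. k * weight \<rho> x)"
  define H where "H = (\<lambda>x. k * weight_tail \<rho> x)"
  \<comment> \<open>Where the bound of \<phi> exceeds \<sigma>, \<open>1 + \<bar>Re z\<bar>\<close>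
    is less than \<open>(c' / \<sigma>)^2\<close>, so the weight is bounded below there and a
    multiple of it dominates \<phi>.\<close>
  define \<kappa> where "\<kappa> = (\<lambda>\<sigma>. c' * (c' / \<bar>\<sigma>\<bar>) powr (2 * (1 + \<rho>)) / k)"
  define M where "M = max k (k * (2 / \<rho>))"
  have "strip_constants r \<gamma> H \<kappa> M"
    unfolding strip_constants_def
  proof
    fix \<xi> assume \<xi>: "\<xi> \<in> \<Gamma>"
    let ?D = "half_strip (q \<xi>) r" and ?\<phi> = "\<lambda>z. \<phi> (lift \<xi> z)" and ?g = "\<lambda>z. pot (lift \<xi> z)"
    have sub: "?D \<subseteq> half_strip (q \<xi>) d" using r by (intro half_strip_mono) auto
    have L: "chart (half_strip (q \<xi>) d) (lift \<xi>)" using lift(1)[OF \<xi>] .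
    have w: "weight \<rho> x \<ge> 0" for x using weight_pos[of \<rho> x] by simp
    show "wkb_strip ?D ?\<phi> ?g \<gamma> H \<kappa> (2 * d) M (2 * r)"
    proof
      show "open ?D" "convex ?D" using r by (auto intro: open_half_strip convex_half_strip)
      show "z + of_real x \<in> ?D" if "z \<in> ?D" "x \<ge> 0" for z x
        using half_strip_right that r by blast
      show "\<bar>Im z - Im z'\<bar> \<le> 2 * r" if "z \<in> ?D" "z' \<in> ?D" for z z'
        using half_strip_Im_Re(1)[OF r(1) that(1)] half_strip_Im_Re(1)[OF r(1) that(2)] by linarith
      show "?\<phi> holomorphic_on ?D" "?g holomorphic_on ?D"
        using holomorphic_on_subset[OF spread_holomorphic_chart[OF hol_\<phi> L] sub]
          holomorphic_on_subset[OF pot_chart_holomorphic[OF L] sub] by auto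
      show "(H has_real_derivative - \<gamma> x) (at x)" for x
        using DERIV_cmult[OF weight_tail_deriv[OF \<rho>_pos], of k x] by (simp add: H_def \<gamma>_def)
      show "continuous_on UNIV \<gamma>"
        unfolding \<gamma>_def weight_def by (intro continuous_intros) auto
      show "\<gamma> x \<ge> 0" for x using k w by (simp add: \<gamma>_def)
      show "\<gamma> x \<le> M" for x
        using mult_left_mono[OF weight_le_1[OF \<rho>_pos, of x], of k] k by (simp add: \<gamma>_def M_def le_max_iff_disj)
      show "(H \<longlongrightarrow> 0) at_top"
        unfolding H_def by (intro tendsto_mult_right_zero weight_tail_lim \<rho>_pos)
      show "H x \<le> M" for x
        using mult_left_mono[OF weight_tail_le[OF \<rho>_pos, of x], of k] k by (simp add: H_def M_def le_max_iff_disj)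
      show "2 * d > 0" using d by simp
      show "norm (?g z) \<le> \<gamma> (Re z - b)" if z: "z \<in> ?D" and b: "0 \<le> b" "b \<le> 2 * d" for z b
      proof -
        have zd: "z \<in> half_strip (q \<xi>) d" using sub z by auto
        have "norm (?g z) \<le> (1/4) * norm (?\<phi> z) ^ 2 + (1/2) * norm (deriv ?\<phi> z) + norm (\<psi> (lift \<xi> z))"
          unfolding pot_chart[OF L zd]
          by (intro order_trans[OF norm_triangle_ineq4] add_mono) (auto simp: norm_mult norm_power)
        also have "\<dots> \<le> (1/4) * (c' * weight \<rho> (Re z)) + (1/2) * (c' * weight \<rho> (Re z)) + c' * weight \<rho> (Re z)"
          using c'(3-5)[OF \<xi> z] by (intro add_mono mult_left_mono) auto
        also have "\<dots> \<le> 2 * c' * weight \<rho> (Re z)"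
          using mult_nonneg_nonneg[OF less_imp_le[OF c'(1)] w[of "Re z"]] by simp
        also have "weight \<rho> (Re z) \<le> (1 + 2 * d) powr (1 + \<rho>) * weight \<rho> (Re z - b)"
          using b \<rho>_pos by (intro weight_shift[of _ b]) auto
        finally show ?thesis using c'(1) by (simp add: \<gamma>_def k_def mult_ac)
      qed
      show "norm (?\<phi> z) \<le> \<sigma> + \<kappa> \<sigma> * \<gamma> (Re z)" if z: "z \<in> ?D" and \<sigma>: "\<sigma> > 0" for z \<sigma>
      proof (cases "c' * (1 + \<bar>Re z\<bar>) powr (- (1/2)) \<le> \<sigma>")
        case True
        have "\<kappa> \<sigma> * \<gamma> (Re z) \<ge> 0" using k w c'(1) by (simp add: \<kappa>_def \<gamma>_def)
        then show ?thesis using c'(2)[OF \<xi> z] True by linarith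
      next
        case False
        let ?a = "1 + \<bar>Re z\<bar>"
        have "?a powr (1/2) < c' / \<sigma>"
          using False \<sigma> by (simp add: powr_minus field_simps)
        then have powr_le: "(?a powr (1/2)) powr (2 * (1 + \<rho>)) \<le> (c' / \<sigma>) powr (2 * (1 + \<rho>))"
          using \<rho>_pos by (intro powr_mono2) auto
        have a: "?a powr (1 + \<rho>) \<le> (c' / \<sigma>) powr (2 * (1 + \<rho>))"
        proof -
          have "(?a powr (1/2)) powr (2 * (1 + \<rho>)) = ?a powr (1 + \<rho>)"
            unfolding powr_powr by (rule arg_cong2[where f="(powr)"]) auto
          then show ?thesis using powr_le by simp
        qed
        have "norm (?\<phi> z) \<le> c' * ?a powr (- (1/2))" by (rule c'(2)[OF \<xi> z])
        also have "\<dots> \<le> c' * 1"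
          using c'(1) by (intro mult_left_mono) (auto simp: powr_minus inverse_le_1_iff ge_one_powr_ge_zero)
        also have "1 = ?a powr (1 + \<rho>) * weight \<rho> (Re z)"
          unfolding weight_def by (simp flip: powr_add)
        also have "\<dots> \<le> (c' / \<sigma>) powr (2 * (1 + \<rho>)) * weight \<rho> (Re z)"
          using a w by (intro mult_right_mono)
        also have "c' * ((c' / \<sigma>) powr (2 * (1 + \<rho>)) * weight \<rho> (Re z)) = \<kappa> \<sigma> * \<gamma> (Re z)"
          using k \<sigma> by (simp add: \<kappa>_def \<gamma>_def)
        finally show ?thesis using \<sigma> c'(1) by simp
      qed
      show "\<kappa> \<sigma> \<ge> 0" for \<sigma> using k c'(1) by (simp add: \<kappa>_def)
      show "norm (deriv ?\<phi> z) \<le> \<gamma> (Re z)" if z: "z \<in> ?D" for z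
        using c'(4)[OF \<xi> z] mult_right_mono[OF k(2) w[of "Re z"]] by (simp add: \<gamma>_def)
      show "((\<lambda>x. ?\<phi> (z + of_real x)) \<longlongrightarrow> 0) at_top" if z: "z \<in> ?D" for z
      proof (rule Lim_null_comparison)
        show "\<forall>\<^sub>F x in at_top. norm (?\<phi> (z + of_real x)) \<le> c' * (1 + \<bar>Re z + x\<bar>) powr (- (1/2))"
          using eventually_ge_at_top[of 0]
        proof eventually_elim
          case (elim x)
          have "z + of_real x \<in> ?D" using half_strip_right[OF r(1) z elim] .
          from c'(2)[OF \<xi> this] show ?case by simp
        qed
        have "((\<lambda>x. (1 + \<bar>Re z + x\<bar>) powr (- (1/2))) \<longlongrightarrow> 0) at_top"
          by real_asymp
        then show "((\<lambda>x. c' * (1 + \<bar>Re z + x\<bar>) powr (- (1/2))) \<longlongrightarrow> 0) at_top"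
          by (rule tendsto_mult_right_zero)
      qed
    qed
  qed
  moreover define K0 where "K0 = k * (2 / \<rho> * max 1 ((2 * d) powr \<rho>) + 2 powr \<rho> / \<rho>)"
  moreover have "K0 > 0"
    unfolding K0_def using k \<rho>_pos by (intro mult_pos_pos add_pos_pos divide_pos_pos) auto
  moreover have "H (x - d) \<le> K0 / max 1 (sgn x * \<bar>x\<bar> powr \<rho>)" for x
    using mult_left_mono[OF weight_tail_shift_le[OF \<rho>_pos d, of x], of k] k by (simp add: H_def K0_def)
  ultimately show ?thesis by blast
qed

end

section \<open>Assembling the charts\<close>

lemma jointly_analytic_hol2:
  assumes "hol2 f S" "(t, z) \<in> S"
  shows "\<exists>a b. ((\<lambda>(t', z'). (f (t', z') - f (t, z) - (a * (t' - t) + b * (z' - z))) / complex_of_real (norm (t' - t, z' - z)))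
     \<longlongrightarrow> 0) (at (t, z))"
proof -
  have "\<exists>a b. ((\<lambda>(t, z). f (t, z)) has_derivative (\<lambda>(h, k). a * h + b * k)) (at (t, z))"
    using assms unfolding hol2_def by (fastforce simp: case_prod_unfold)
  then have "jointly_analytic (\<lambda>z. z) (\<lambda>t z. f (t, z)) {t} {z}"
    unfolding jointly_analytic_plane by simp
  then show ?thesis by (simp add: jointly_analytic_def)
qed

context wkb_setting
begin

lemma at_prod_chart:
  fixes t :: complex
  assumes L: "chart D L" and z: "z \<in> D"
  shows "at (t, L z) = filtermap (\<lambda>(t, z). (t, L z)) (at (t, z))"
proof -
  have D: "open D" "\<And>z. z \<in> D \<Longrightarrow> q (L z) = z" using L by (auto simp: chart_def)
  have ev: "eventually (\<lambda>w. snd w \<in> D) (nhds (t, z))"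
    using D(1) z by (intro eventually_nhds_in_open[of "UNIV \<times> D", THEN eventually_mono]) (auto intro: open_Times)
  have "nhds (L z) = filtermap L (nhds z)"
  proof (rule filter_eqI)
    fix P
    show "eventually P (nhds (L z)) \<longleftrightarrow> eventually P (filtermap L (nhds z))"
      unfolding eventually_nhds_conv_at eventually_filtermap at_chart[OF L z] ..
  qed
  then have nh: "nhds (t, L z) = filtermap (\<lambda>(t, z). (t, L z)) (nhds (t, z))"
    by (simp add: nhds_prod prod_filtermap2 apsnd_def map_prod_def)
  show ?thesis
  proof (rule filter_eqI)
    fix P
    have "eventually P (at (t, L z)) \<longleftrightarrow> eventually (\<lambda>w. w \<noteq> (t, L z) \<longrightarrow> P w) (nhds (t, L z))"
      by (simp add: eventually_at_filter)
    also have "\<dots> \<longleftrightarrow> eventually (\<lambda>w. (fst w, L (snd w)) \<noteq> (t, L z) \<longrightarrow> P (fst w, L (snd w))) (nhds (t, z))"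
      unfolding nh eventually_filtermap by (simp add: case_prod_unfold)
    also have "\<dots> \<longleftrightarrow> eventually (\<lambda>w. w \<noteq> (t, z) \<longrightarrow> P (fst w, L (snd w))) (nhds (t, z))"
    proof (rule eventually_subst)
      show "\<forall>\<^sub>F w in nhds (t, z). ((fst w, L (snd w)) \<noteq> (t, L z) \<longrightarrow> P (fst w, L (snd w))) = (w \<noteq> (t, z) \<longrightarrow> P (fst w, L (snd w)))"
        using ev
      proof eventually_elim
        case (elim w)
        have "L (snd w) = L z \<longleftrightarrow> snd w = z" using D(2)[OF elim] D(2)[OF z] by metis
        then show ?case by (cases w) auto
      qed
    qed
    also have "\<dots> \<longleftrightarrow> eventually P (filtermap (\<lambda>(t, z). (t, L z)) (at (t, z)))"
      by (simp add: eventually_at_filter eventually_filtermap case_prod_unfold)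
    finally show "eventually P (at (t, L z)) \<longleftrightarrow> eventually P (filtermap (\<lambda>(t, z). (t, L z)) (at (t, z)))" .
  qed
qed

text \<open>A local criterion in the plane. \<open>F\<close> is compared with \<open>f\<close> only
  where the lifted point lies in \<Gamma>; as \<Gamma> is open, this still covers a
  neighbourhood.\<close>

lemma jointly_analytic_chart:
  assumes "\<And>t \<xi>. t \<in> T \<Longrightarrow> \<xi> \<in> \<Gamma> \<Longrightarrow> \<exists>f S. hol2 f S \<and> open S \<and> (t, q \<xi>) \<in> S \<and>
      (\<forall>(t', z)\<in>S. z \<in> half_strip (q \<xi>) d \<longrightarrow> lift \<xi> z \<in> \<Gamma> \<longrightarrow> F t' (lift \<xi> z) = f (t', z))"
  shows "jointly_analytic p F T \<Gamma>"
  unfolding jointly_analytic_def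
proof (intro ballI)
  fix t \<xi> assume t: "t \<in> T" and \<xi>: "\<xi> \<in> \<Gamma>"
  let ?D = "half_strip (q \<xi>) d" and ?L = "lift \<xi>" and ?z = "q \<xi>"
  have L: "chart ?D ?L" "?L ?z = \<xi>" using lift[OF \<xi>] by auto
  have zD: "?z \<in> ?D" using half_strip_base[OF d, of 0] by simp
  obtain f S where f: "hol2 f S" "open S" "(t, ?z) \<in> S"
    "\<And>t' z. (t', z) \<in> S \<Longrightarrow> z \<in> ?D \<Longrightarrow> ?L z \<in> \<Gamma> \<Longrightarrow> F t' (?L z) = f (t', z)"
    using assms[OF t \<xi>] by blast
  obtain a b where ab: "((\<lambda>(t', z'). (f (t', z') - f (t, ?z) - (a * (t' - t) + b * (z' - ?z))) / complex_of_real (norm (t' - t, z' - ?z)))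
     \<longlongrightarrow> 0) (at (t, ?z))"
    using jointly_analytic_hol2[OF f(1,3)] by blast
  define b' where "b' = - of_real s * b"
  let ?Q = "\<lambda>(t', \<xi>'). (F t' \<xi>' - F t \<xi> - (a * (t' - t) + b' * (p \<xi>' - p \<xi>))) / complex_of_real (norm (t' - t, p \<xi>' - p \<xi>))"
  have oN: "open (?D \<inter> ?L -` \<Gamma>)"
    using continuous_open_preimage[of ?D ?L \<Gamma>] L(1) open_\<Gamma> by (simp add: chart_def)
  have "((\<lambda>w. ?Q (fst w, ?L (snd w))) \<longlongrightarrow> 0) (at (t, ?z))"
  proof (rule Lim_transform_eventually[OF ab])
    have "eventually (\<lambda>w. w \<in> S \<inter> UNIV \<times> (?D \<inter> ?L -` \<Gamma>)) (at (t, ?z))"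
      using f(2,3) oN zD L(2) \<xi> by (intro eventually_at_in_open') (auto intro!: open_Int open_Times)
    then show "\<forall>\<^sub>F w in at (t, ?z). (case w of (t', z') \<Rightarrow> (f (t', z') - f (t, ?z) - (a * (t' - t) + b * (z' - ?z))) / complex_of_real (norm (t' - t, z' - ?z)))
        = ?Q (fst w, ?L (snd w))"
    proof eventually_elim
      case (elim w)
      obtain t' z' where w: "w = (t', z')" by force
      have z': "z' \<in> ?D" "?L z' \<in> \<Gamma>" "(t', z') \<in> S" using elim w by auto
      have 1: "F t' (?L z') = f (t', z')" using f(4) z' by blast
      have 2: "F t \<xi> = f (t, ?z)" using f(4)[OF f(3) zD] L(2) \<xi> by simp
      have 3: "p (?L z') - p \<xi> = - of_real s * (z' - ?z)"
        using L(1) z'(1) by (simp add: p_q chart_def algebra_simps)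
      have 4: "norm (t' - t, - of_real s * (z' - ?z)) = norm (t' - t, z' - ?z)"
        using s by (auto simp: norm_Pair norm_mult)
      have 5: "b' * (- of_real s * (z' - ?z)) = b * (z' - ?z)"
        using s by (auto simp: b'_def)
      show ?case unfolding w by (simp only: prod.case fst_conv snd_conv 1 2 3 4 5)
    qed
  qed
  then have "(?Q \<longlongrightarrow> 0) (at (t, ?L ?z))"
    unfolding at_prod_chart[OF L(1) zD] filterlim_filtermap by (simp add: case_prod_unfold)
  then show "\<exists>a b. ((\<lambda>(t', \<xi>'). (F t' \<xi>' - F t \<xi> - (a * (t' - t) + b * (p \<xi>' - p \<xi>)))
         / complex_of_real (norm (t' - t, p \<xi>' - p \<xi>))) \<longlongrightarrow> 0) (at (t, \<xi>))"
    unfolding L(2) by blast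
qed

end

context wkb_data
begin

text \<open>Every point uses the chart centred at itself, and no strip radius enters; results for
  different \<open>r\<close> therefore concern one and the same function.\<close>

definition borel :: "complex \<Rightarrow> 'a \<Rightarrow> complex" where
  "borel t \<xi> = borel_sum (\<lambda>z. \<phi> (lift \<xi> z)) (\<lambda>z. pot (lift \<xi> z)) (t / 2, q \<xi>)"

definition eta :: "complex \<Rightarrow> 'a \<Rightarrow> complex" where
  "eta u \<xi> = integral {0..} (\<lambda>t. exp (- u * of_real t) * borel (of_real t) \<xi>)"

lemma q_half_strip: "r > 0 \<Longrightarrow> q \<xi> \<in> half_strip (q \<xi>) r"
  using half_strip_base[of r 0 "q \<xi>"] by simp

text \<open>The intersection of the two half-strips is convex, invariant to the right and contains
  both ends of the segment; there the two lifts agree, so \<open>borel_sum_cong\<close>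
  applies.\<close>

lemma borel_lift:
  assumes \<xi>: "\<xi> \<in> \<Gamma>" and z: "z \<in> half_strip (q \<xi>) d" "lift \<xi> z \<in> \<Gamma>"
    and t: "z + t / 2 \<in> half_strip (q \<xi>) d" "t / 2 \<in> U_region d"
  shows "borel t (lift \<xi> z) = borel_sum (\<lambda>z. \<phi> (lift \<xi> z)) (\<lambda>z. pot (lift \<xi> z)) (t / 2, z)"
proof -
  have q: "q (lift \<xi> z) = z" using lift(1)[OF \<xi>] z by (auto simp: chart_def)
  show ?thesis
    unfolding borel_def q
  proof (rule borel_sum_cong[where K = "half_strip (q \<xi>) d \<inter> half_strip z d"])
    show "convex (half_strip (q \<xi>) d \<inter> half_strip z d)"
      by (intro convex_Int convex_half_strip d)
    show "z' + of_real x \<in> half_strip (q \<xi>) d \<inter> half_strip z d"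
      if "z' \<in> half_strip (q \<xi>) d \<inter> half_strip z d" "x \<ge> 0" for z' x
      using half_strip_right[OF d] that by blast
    show "\<phi> (lift (lift \<xi> z) z') = \<phi> (lift \<xi> z')" "pot (lift (lift \<xi> z) z') = pot (lift \<xi> z')"
      if "z' \<in> half_strip (q \<xi>) d \<inter> half_strip z d" for z'
      using lift_lift[OF \<xi> z, of z'] that by auto
    show "z \<in> half_strip (q \<xi>) d \<inter> half_strip z d"
      using z half_strip_base[OF d, of 0 z] by simp
    show "z + t / 2 \<in> half_strip (q \<xi>) d \<inter> half_strip z d"
      using t by (simp add: half_strip_def)
  qed
qed

lemma U_region_real: "r > 0 \<Longrightarrow> x \<ge> 0 \<Longrightarrow> of_real x \<in> U_region r"
  by (auto simp: U_region_iff)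

lemma U_region_half: "r > 0 \<Longrightarrow> t \<in> U_region (2 * r) \<Longrightarrow> t / 2 \<in> U_region r"
  by (auto simp: U_region_def norm_divide)

lemma borel_lift_real:
  assumes \<xi>: "\<xi> \<in> \<Gamma>" and z: "z \<in> half_strip (q \<xi>) d" "lift \<xi> z \<in> \<Gamma>" and t: "t \<ge> 0"
  shows "borel (of_real t) (lift \<xi> z) = borel_sum (\<lambda>z. \<phi> (lift \<xi> z)) (\<lambda>z. pot (lift \<xi> z)) (of_real t / 2, z)"
  using half_strip_right[OF d z(1), of "t / 2"] U_region_real[OF d, of "t / 2"] t
  by (intro borel_lift \<xi> z) auto

end

text \<open>One admissible radius with its uniform constants; the theorem interprets this for
  several values of \<open>r\<close>.\<close>

locale wkb_strips = wkb_data +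
  fixes r :: real and \<gamma> H \<kappa> :: "real \<Rightarrow> real" and M K0 :: real
  assumes r: "0 < r" "r < d"
    and strips: "strip_constants r \<gamma> H \<kappa> M" and K0: "K0 > 0"
    and H_le: "\<And>x. H (x - d) \<le> K0 / max 1 (sgn x * \<bar>x\<bar> powr \<rho>)"
begin

abbreviation "data\<phi> \<xi> \<equiv> (\<lambda>z. \<phi> (lift \<xi> z))"
abbreviation "datag \<xi> \<equiv> (\<lambda>z. pot (lift \<xi> z))"

lemma strip: "\<xi> \<in> \<Gamma> \<Longrightarrow> wkb_strip (half_strip (q \<xi>) r) (data\<phi> \<xi>) (datag \<xi>) \<gamma> H \<kappa> (2 * d) M (2 * r)"
  using strips by (simp add: strip_constants_def)

lemma strip': "\<xi> \<in> \<Gamma> \<Longrightarrow> right_strip (half_strip (q \<xi>) r) (data\<phi> \<xi>) (datag \<xi>) \<gamma> H \<kappa> (2 * d) M (2 * r)"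
  using strip by (simp add: wkb_strip_def)

lemma sub: "half_strip (q \<xi>) r \<subseteq> half_strip (q \<xi>) d"
  using r by (intro half_strip_mono) auto

text \<open>Lifts of strip points are only known to lie in \<Delta>, while rays and coefficients
  live over \<Gamma>; this is the part where both make sense, and it contains the ray.\<close>

definition nbhd :: "'a \<Rightarrow> complex set" where
  "nbhd \<xi> = half_strip (q \<xi>) r \<inter> lift \<xi> -` \<Gamma>"

lemma nbhd:
  assumes "\<xi> \<in> \<Gamma>"
  shows "open (nbhd \<xi>)" "q \<xi> \<in> nbhd \<xi>" "\<And>x. x \<ge> 0 \<Longrightarrow> q \<xi> + of_real x \<in> nbhd \<xi>"
proof -
  have L: "chart (half_strip (q \<xi>) d) (lift \<xi>)" using lift(1)[OF assms] .
  have "continuous_on (half_strip (q \<xi>) r) (lift \<xi>)"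
    by (intro continuous_on_subset[OF _ sub]) (use L in \<open>simp add: chart_def\<close>)
  then show "open (nbhd \<xi>)"
    unfolding nbhd_def using open_half_strip[OF r(1)] open_\<Gamma> by (intro continuous_open_preimage)
  show *: "q \<xi> + of_real x \<in> nbhd \<xi>" if "x \<ge> 0" for x
  proof -
    have "lift \<xi> (q \<xi> + of_real x) \<in> \<Gamma>"
      unfolding lift(2)[OF assms that] by (rule ray(2)[OF assms that])
    then show ?thesis unfolding nbhd_def using half_strip_base[OF r(1) that] by blast
  qed
  show "q \<xi> \<in> nbhd \<xi>" using *[of 0] by simp
qed

lemma \<Omega>_mem:
  assumes "\<xi> \<in> \<Gamma>" "t \<in> U_region (2 * r)"
  shows "(t / 2, q \<xi>) \<in> right_strip.\<Omega> (half_strip (q \<xi>) r) (2 * d)"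
proof -
  have t: "t / 2 \<in> U_region r" using U_region_half[OF r(1) assms(2)] .
  then have z: "q \<xi> + t / 2 \<in> half_strip (q \<xi>) r" by (simp add: half_strip_def)
  have "Re (q \<xi> + t / 2) - Re (q \<xi>) > - r" using half_strip_Im_Re(2)[OF r(1) z] .
  then show ?thesis
    unfolding right_strip.\<Omega>_iff[OF strip'[OF assms(1)]] using z q_half_strip[OF r(1)] r by auto
qed

lemma joint_chart:
  assumes t: "t \<in> U_region (2 * r)" and \<xi>: "\<xi> \<in> \<Gamma>"
  shows "\<exists>f S. hol2 f S \<and> open S \<and> (t, q \<xi>) \<in> S \<and>
      (\<forall>(t', z)\<in>S. z \<in> half_strip (q \<xi>) d \<longrightarrow> lift \<xi> z \<in> \<Gamma> \<longrightarrow> borel t' (lift \<xi> z) = f (t', z))"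
proof -
  interpret right_strip "half_strip (q \<xi>) r" "data\<phi> \<xi>" "datag \<xi>" \<gamma> H \<kappa> "2 * d" M "2 * r"
    using strip'[OF \<xi>] .
  let ?S = "((\<lambda>w. (fst w / 2, snd w)) -` \<Omega>) \<inter> {w. fst w / 2 \<in> U_region r}"
  have oU: "open (U_region r)"
    using open_half_strip[OF r(1), of 0] by (simp add: half_strip_def)
  have o: "open ?S"
  proof -
    have "open ((\<lambda>w :: complex \<times> complex. fst w / 2) -` U_region r)"
      by (intro open_vimage oU continuous_intros) auto
    moreover have "open ((\<lambda>w :: complex \<times> complex. (fst w / 2, snd w)) -` \<Omega>)"
      by (intro open_vimage open_\<Omega> continuous_intros) auto
    ultimately show ?thesis by (auto simp: vimage_def)
  qed
  have "hol2 (\<lambda>w. borel_sum (data\<phi> \<xi>) (datag \<xi>) (1/2 * fst w, snd w)) ?S"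
    by (intro hol2_compose[OF borel_sum_hol2] hol2_intros) auto
  moreover have "(t, q \<xi>) \<in> ?S" using \<Omega>_mem[OF \<xi> t] U_region_half[OF r(1) t] by simp
  moreover have "borel t' (lift \<xi> z) = borel_sum (data\<phi> \<xi>) (datag \<xi>) (1/2 * t', z)"
    if "(t', z) \<in> ?S" "z \<in> half_strip (q \<xi>) d" "lift \<xi> z \<in> \<Gamma>" for t' z
  proof -
    have "U_region r \<subseteq> U_region d" using half_strip_mono[OF r(1), of d 0] r by (simp add: half_strip_def)
    then show ?thesis
      using borel_lift[OF \<xi> that(2,3), of t'] that(1) sub by (auto simp: \<Omega>_iff)
  qed
  ultimately show ?thesis using o by (intro exI[of _ "\<lambda>w. borel_sum (data\<phi> \<xi>) (datag \<xi>) (1/2 * fst w, snd w)"] exI[of _ ?S]) auto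
qed

lemma eta_chart:
  assumes \<xi>: "\<xi> \<in> \<Gamma>" and z: "z \<in> half_strip (q \<xi>) d" "lift \<xi> z \<in> \<Gamma>"
  shows "eta u (lift \<xi> z) = right_strip.lap (data\<phi> \<xi>) (datag \<xi>) u z"
proof -
  interpret right_strip "half_strip (q \<xi>) r" "data\<phi> \<xi>" "datag \<xi>" \<gamma> H \<kappa> "2 * d" M "2 * r"
    using strip'[OF \<xi>] .
  show ?thesis unfolding eta_def lap_def
    by (rule integral_cong) (use borel_lift_real[OF \<xi> z] in auto)
qed

lemma joint_chart_eta:
  assumes u: "Re u > 0" and \<xi>: "\<xi> \<in> \<Gamma>"
  shows "\<exists>f S. hol2 f S \<and> open S \<and> (u, q \<xi>) \<in> S \<and>
      (\<forall>(u', z)\<in>S. z \<in> half_strip (q \<xi>) d \<longrightarrow> lift \<xi> z \<in> \<Gamma> \<longrightarrow> eta u' (lift \<xi> z) = f (u', z))"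
proof -
  interpret right_strip "half_strip (q \<xi>) r" "data\<phi> \<xi>" "datag \<xi>" \<gamma> H \<kappa> "2 * d" M "2 * r"
    using strip'[OF \<xi>] .
  show ?thesis
    using lap_hol2 u q_half_strip[OF r(1)] open_half_strip[OF r(1)] eta_chart[OF \<xi>]
    by (intro exI[of _ "\<lambda>w. lap (fst w) (snd w)"] exI[of _ "{u. Re u > 0} \<times> half_strip (q \<xi>) r"])
      (auto intro!: open_Times open_halfspace_Re_gt)
qed

lemma eta_has_integral:
  assumes "Re u > 0" "\<xi> \<in> \<Gamma>"
  shows "((\<lambda>t. exp (- u * of_real t) * borel (of_real t) \<xi>) has_integral eta u \<xi>) {0..}"
proof -
  interpret right_strip "half_strip (q \<xi>) r" "data\<phi> \<xi>" "datag \<xi>" \<gamma> H \<kappa> "2 * d" M "2 * r"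
    using strip'[OF assms(2)] .
  show ?thesis
    using lap_has_integral[OF q_half_strip[OF r(1)] assms(1)] by (simp add: eta_def borel_def lap_def)
qed

lemma borel_bound:
  assumes \<sigma>: "\<sigma> > 0"
  shows "\<exists>K>0. \<forall>t\<in>U_region (2 * r). \<forall>\<xi>\<in>\<Gamma>. norm (borel t \<xi>)
      \<le> K * (exp (\<sigma> * Re t) / max 1 (- s * sgn (Re (p \<xi>)) * \<bar>Re (p \<xi>)\<bar> powr \<rho>))"
proof -
  define B where "B = exp (\<kappa> (\<sigma> / 2) * (2 * r * M + M))"
  \<comment> \<open>\<open>K0\<close> carries the decay in \<xi>; the last factor pays for replacing
    \<open>norm t\<close> by \<open>Re t\<close> on \<open>U(2r)\<close>, where
    \<open>\<bar>Im t\<bar> < 2 * r\<close> and \<open>Re t > - 2 * r\<close>.\<close>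
  define K where "K = 1/2 * B * exp (B * M / (\<sigma> / 2)) * K0 * exp (4 * \<sigma> * r)"
  have "K > 0" using K0 by (simp add: K_def B_def)
  moreover have "norm (borel t \<xi>) \<le> K * (exp (\<sigma> * Re t) / max 1 (- s * sgn (Re (p \<xi>)) * \<bar>Re (p \<xi>)\<bar> powr \<rho>))"
    if t: "t \<in> U_region (2 * r)" and \<xi>: "\<xi> \<in> \<Gamma>" for t \<xi>
  proof -
    interpret S: right_strip "half_strip (q \<xi>) r" "data\<phi> \<xi>" "datag \<xi>" \<gamma> H \<kappa> "2 * d" M "2 * r"
      using strip'[OF \<xi>] .
    have B: "S.B (\<sigma> / 2) = B" by (simp add: S.B_def B_def)
    let ?x = "max 1 (- s * sgn (Re (p \<xi>)) * \<bar>Re (p \<xi>)\<bar> powr \<rho>)"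
    have 1: "norm (borel t \<xi>) \<le> 1/2 * B * exp (B * M / (\<sigma> / 2)) * H (S.m (t / 2, q \<xi>)) * exp (2 * (\<sigma> / 2) * norm (t / 2))"
      using S.borel_sum_bound[OF _ \<Omega>_mem[OF \<xi> t], of "\<sigma> / 2"] \<sigma> by (simp add: B borel_def)
    have 2: "H (S.m (t / 2, q \<xi>)) \<le> K0 / ?x"
    proof -
      have "q \<xi> + t / 2 \<in> half_strip (q \<xi>) r"
        using U_region_half[OF r(1) t] by (simp add: half_strip_def)
      \<comment> \<open>The segment reaches less than \<open>r < d\<close> to the left of
        \<open>q \<xi>\<close>, which explains the shift by \<open>d\<close> in
        \<open>H_le\<close>.\<close>
      from half_strip_Im_Re(2)[OF r(1) this] have "Re (q \<xi>) - d \<le> S.m (t / 2, q \<xi>)"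
        using r by (simp add: S.m_def min_def)
      then have "H (S.m (t / 2, q \<xi>)) \<le> H (Re (q \<xi>) - d)" by (rule S.G_antimono)
      also have "\<dots> \<le> K0 / ?x"
        using H_le[of "Re (q \<xi>)"] s by (auto simp: q_def)
      finally show ?thesis .
    qed
    have 3: "exp (2 * (\<sigma> / 2) * norm (t / 2)) \<le> exp (4 * \<sigma> * r) * exp (\<sigma> * Re t)"
    proof -
      have "norm t \<le> \<bar>Re t\<bar> + \<bar>Im t\<bar>" by (rule cmod_le)
      moreover have "\<bar>Im t\<bar> < 2 * r" "Re t > - 2 * r"
        using half_strip_Im_Re[of "2 * r" t 0] t r by (auto simp: half_strip_def)
      ultimately have "norm t / 2 \<le> 4 * r + Re t"
        using r by (cases "Re t \<ge> 0") auto
      then have "\<sigma> * (norm t / 2) \<le> \<sigma> * (4 * r + Re t)" using \<sigma> by (intro mult_left_mono) auto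
      then show ?thesis by (simp add: norm_divide algebra_simps flip: exp_add)
    qed
    have "norm (borel t \<xi>) \<le> 1/2 * B * exp (B * M / (\<sigma> / 2)) * (K0 / ?x) * (exp (4 * \<sigma> * r) * exp (\<sigma> * Re t))"
      using 2 3 K0 by (intro order_trans[OF 1] mult_mono mult_left_mono) (auto simp: B_def)
    also have "\<dots> = K * (exp (\<sigma> * Re t) / ?x)"
      by (simp add: K_def)
    finally show ?thesis .
  qed
  ultimately show ?thesis by blast
qed

end

section \<open>Coefficients, solution and asymptotic expansion\<close>

context wkb_strips
begin

lemma borel_holomorphic:
  assumes \<xi>: "\<xi> \<in> \<Gamma>"
  shows "(\<lambda>t. borel t \<xi>) holomorphic_on U_region (2 * r)"
proof -
  interpret S: right_strip "half_strip (q \<xi>) r" "data\<phi> \<xi>" "datag \<xi>" \<gamma> H \<kappa> "2 * d" M "2 * r"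
    using strip'[OF \<xi>] .
  have "(\<lambda>t. borel_sum (data\<phi> \<xi>) (datag \<xi>) (t, q \<xi>)) holomorphic_on (\<lambda>t. t / 2) ` U_region (2 * r)"
    by (rule hol2_slice_holomorphic(1)[OF S.borel_sum_hol2]) (use \<Omega>_mem[OF \<xi>] in auto)
  from holomorphic_on_compose_gen[OF _ this, of "\<lambda>t. t / 2" "U_region (2 * r)"] show ?thesis
    by (simp add: o_def borel_def holomorphic_on_divide holomorphic_on_ident holomorphic_on_const)
qed

lemma open_U_region: "\<rho>' > 0 \<Longrightarrow> open (U_region \<rho>')"
  using open_half_strip[of \<rho>' 0] by (simp add: half_strip_def)

lemma U_region_cball: "x \<ge> 0 \<Longrightarrow> cball (of_real x) r \<subseteq> U_region (2 * r)"
  using half_strip_cball[of "r" r "2 * r" "of_real x" 0] half_strip_base[of r x 0] r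
  by (simp add: half_strip_def)

definition borel_coeff :: "nat \<Rightarrow> 'a \<Rightarrow> complex" where
  "borel_coeff n \<xi> = (deriv ^^ n) (\<lambda>t. borel t \<xi>) 0"

text \<open>For \<open>t\<close> near \<open>0\<close>, \<open>borel_lift\<close> identifies the two
  functions of \<open>t\<close>, hence their Taylor coefficients.\<close>

lemma borel_coeff_lift:
  assumes \<xi>: "\<xi> \<in> \<Gamma>" and z: "z \<in> nbhd \<xi>"
  shows "borel_coeff n (lift \<xi> z) = wkb_strip.coeff (data\<phi> \<xi>) (datag \<xi>) n z"
proof -
  interpret S: wkb_strip "half_strip (q \<xi>) r" "data\<phi> \<xi>" "datag \<xi>" \<gamma> H \<kappa> "2 * d" M "2 * r"
    using strip[OF \<xi>] .
  let ?T = "((\<lambda>t. z + t / 2) -` half_strip (q \<xi>) d) \<inter> ((\<lambda>t. t / 2) -` U_region d)"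
  have "open ?T"
    by (intro open_Int open_vimage open_half_strip open_U_region continuous_intros d) auto
  moreover have zd: "z \<in> half_strip (q \<xi>) d" "lift \<xi> z \<in> \<Gamma>" using z sub by (auto simp: nbhd_def)
  moreover have "0 \<in> ?T" using zd U_region_real[OF d, of 0] by simp
  ultimately have "eventually (\<lambda>t. borel t (lift \<xi> z) = borel_sum (data\<phi> \<xi>) (datag \<xi>) (t / 2, z)) (nhds 0)"
    using borel_lift[OF \<xi>] by (intro eventually_nhds_in_open[of ?T, THEN eventually_mono]) auto
  then show ?thesis
    unfolding borel_coeff_def S.coeff_def by (intro higher_deriv_cong_ev refl)
qed

text \<open>In the coordinate \<open>q\<close> the term with \<phi>' changes sign, so the integrand
  of the recursion is \<open>g + \<phi>'\<close> for either choice of \<open>s\<close>.\<close>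

lemma potential_lift:
  assumes \<xi>: "\<xi> \<in> \<Gamma>" and z: "z \<in> half_strip (q \<xi>) d"
  shows "(1/4) * (\<phi> (lift \<xi> z))^2 - complex_of_real s * (1/2) * spread_deriv p \<phi> (lift \<xi> z) - \<psi> (lift \<xi> z)
    = datag \<xi> z + deriv (data\<phi> \<xi>) z"
  unfolding pot_chart[OF lift(1)[OF \<xi>] z] \<phi>_chart(2)[OF lift(1)[OF \<xi>] z] using s by auto

text \<open>Both sides obey the same recursion in the chart about \<xi>, the two factors
  \<open>s\<close> of the ray integral cancelling. The induction hypothesis is needed near \<xi> for
  the derivative and along the ray for the integral.\<close>

lemma A_coeff_eq:
  assumes "\<xi> \<in> \<Gamma>"
  shows "A_coeff p \<phi> \<psi> s \<Gamma> (Suc n) \<xi> = borel_coeff n \<xi>"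
  using assms
proof (induction n arbitrary: \<xi>)
  case (0 \<xi>)
  interpret S: wkb_strip "half_strip (q \<xi>) r" "data\<phi> \<xi>" "datag \<xi>" \<gamma> H \<kappa> "2 * d" M "2 * r"
    using strip[OF 0] .
  have L: "chart (half_strip (q \<xi>) d) (lift \<xi>)" "lift \<xi> (q \<xi>) = \<xi>" using lift[OF 0] by auto
  have "spread_deriv p (\<lambda>\<xi>. 1) (lift \<xi> (q \<xi>)) = - of_real s * 0"
    by (rule spread_deriv_chart(1)[OF L(1) q_half_strip[OF d]]) simp
  then have sd: "spread_deriv p (\<lambda>\<xi>. 1) \<xi> = 0" using L(2) by simp
  have I: "integral {0..} (\<lambda>x. ((1/4) * (\<phi> (ray \<xi> x))^2 - complex_of_real s * (1/2) * spread_deriv p \<phi> (ray \<xi> x) - \<psi> (ray \<xi> x)) * 1)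
     = integral {0..} (\<lambda>x. datag \<xi> (q \<xi> + of_real x) + deriv (data\<phi> \<xi>) (q \<xi> + of_real x))"
  proof (rule integral_cong)
    fix x :: real assume x: "x \<in> {0..}"
    then have "q \<xi> + of_real x \<in> half_strip (q \<xi>) d" using half_strip_base[OF d] by simp
    from potential_lift[OF 0 this] x lift(2)[OF 0, of x]
    show "((1/4) * (\<phi> (ray \<xi> x))^2 - complex_of_real s * (1/2) * spread_deriv p \<phi> (ray \<xi> x) - \<psi> (ray \<xi> x)) * 1
       = datag \<xi> (q \<xi> + of_real x) + deriv (data\<phi> \<xi>) (q \<xi> + of_real x)" by simp
  qed
  have "borel_coeff 0 \<xi> = S.coeff 0 (q \<xi>)"
    using borel_coeff_lift[OF 0 nbhd(2)[OF 0], of 0] L(2) by simp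
  also have "\<dots> = - (1/2) * \<phi> \<xi> - (1/2) * integral {0..} (\<lambda>x. datag \<xi> (q \<xi> + of_real x) + deriv (data\<phi> \<xi>) (q \<xi> + of_real x))"
    using S.coeff_0[OF q_half_strip[OF r(1)]] L(2) by simp
  finally have R: "borel_coeff 0 \<xi> = - (1/2) * \<phi> \<xi> - (1/2) * integral {0..} (\<lambda>x. datag \<xi> (q \<xi> + of_real x) + deriv (data\<phi> \<xi>) (q \<xi> + of_real x))" .
  have "A_coeff p \<phi> \<psi> s \<Gamma> (Suc 0) \<xi> = - (1/2) * \<phi> \<xi> * 1 - complex_of_real s * (1/2) * 0
       - complex_of_real s * (1/2) * (complex_of_real s * integral {0..} (\<lambda>x. datag \<xi> (q \<xi> + of_real x) + deriv (data\<phi> \<xi>) (q \<xi> + of_real x)))"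
    unfolding A_coeff.simps ray_integral_def ray_def[symmetric] sd I ..
  then show ?case unfolding R using s by auto
next
  case (Suc n \<xi>)
  interpret S: wkb_strip "half_strip (q \<xi>) r" "data\<phi> \<xi>" "datag \<xi>" \<gamma> H \<kappa> "2 * d" M "2 * r"
    using strip[OF Suc.prems] .
  let ?A = "A_coeff p \<phi> \<psi> s \<Gamma> (Suc n)"
  have L: "chart (half_strip (q \<xi>) d) (lift \<xi>)" "lift \<xi> (q \<xi>) = \<xi>" using lift[OF Suc.prems] by auto
  have A: "?A (lift \<xi> z) = S.coeff n z" if "z \<in> nbhd \<xi>" for z
    using Suc.IH[of "lift \<xi> z"] borel_coeff_lift[OF Suc.prems that, of n] that by (simp add: nbhd_def)
  have zr: "q \<xi> \<in> half_strip (q \<xi>) r" using q_half_strip[OF r(1)] .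
  have "(S.coeff n has_field_derivative deriv (S.coeff n) (q \<xi>)) (at (q \<xi>))"
    using S.coeff_holomorphic S.open_D zr by (rule holomorphic_derivI)
  then have "((\<lambda>z. ?A (lift \<xi> z)) has_field_derivative deriv (S.coeff n) (q \<xi>)) (at (q \<xi>))"
    by (rule has_field_derivative_transform_within_open[OF _ nbhd(1,2)[OF Suc.prems]]) (simp only: A)
  from spread_deriv_chart(1)[OF L(1) q_half_strip[OF d] this]
  have sd: "spread_deriv p ?A \<xi> = - of_real s * deriv (S.coeff n) (q \<xi>)" unfolding L(2) .
  have I: "integral {0..} (\<lambda>x. ((1/4) * (\<phi> (ray \<xi> x))^2 - complex_of_real s * (1/2) * spread_deriv p \<phi> (ray \<xi> x) - \<psi> (ray \<xi> x)) * ?A (ray \<xi> x))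
     = integral {0..} (\<lambda>x. (datag \<xi> (q \<xi> + of_real x) + deriv (data\<phi> \<xi>) (q \<xi> + of_real x)) * S.coeff n (q \<xi> + of_real x))"
  proof (rule integral_cong)
    fix x :: real assume x: "x \<in> {0..}"
    then have x0: "x \<ge> 0" by simp
    have "q \<xi> + of_real x \<in> half_strip (q \<xi>) d" using half_strip_base[OF d x0] .
    from potential_lift[OF Suc.prems this] A[OF nbhd(3)[OF Suc.prems x0]]
    show "((1/4) * (\<phi> (ray \<xi> x))^2 - complex_of_real s * (1/2) * spread_deriv p \<phi> (ray \<xi> x) - \<psi> (ray \<xi> x)) * ?A (ray \<xi> x)
       = (datag \<xi> (q \<xi> + of_real x) + deriv (data\<phi> \<xi>) (q \<xi> + of_real x)) * S.coeff n (q \<xi> + of_real x)"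
      unfolding lift(2)[OF Suc.prems x0] by (simp only:)
  qed
  have "borel_coeff (Suc n) \<xi> = S.coeff (Suc n) (q \<xi>)"
    using borel_coeff_lift[OF Suc.prems nbhd(2)[OF Suc.prems], of "Suc n"] unfolding L(2) .
  also have "\<dots> = - (1/2) * \<phi> \<xi> * S.coeff n (q \<xi>) + (1/2) * deriv (S.coeff n) (q \<xi>)
     - (1/2) * integral {0..} (\<lambda>x. (datag \<xi> (q \<xi> + of_real x) + deriv (data\<phi> \<xi>) (q \<xi> + of_real x)) * S.coeff n (q \<xi> + of_real x))"
    using S.coeff_Suc[OF zr, of n] unfolding L(2) .
  finally have R: "borel_coeff (Suc n) \<xi> = - (1/2) * \<phi> \<xi> * S.coeff n (q \<xi>) + (1/2) * deriv (S.coeff n) (q \<xi>)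
     - (1/2) * integral {0..} (\<lambda>x. (datag \<xi> (q \<xi> + of_real x) + deriv (data\<phi> \<xi>) (q \<xi> + of_real x)) * S.coeff n (q \<xi> + of_real x))" .
  have A\<xi>: "?A \<xi> = S.coeff n (q \<xi>)" using A[OF nbhd(2)[OF Suc.prems]] unfolding L(2) .
  have "A_coeff p \<phi> \<psi> s \<Gamma> (Suc (Suc n)) \<xi> = - (1/2) * \<phi> \<xi> * ?A \<xi> - complex_of_real s * (1/2) * spread_deriv p ?A \<xi>
       - complex_of_real s * (1/2) * (complex_of_real s * integral {0..} (\<lambda>x. ((1/4) * (\<phi> (ray \<xi> x))^2 - complex_of_real s * (1/2) * spread_deriv p \<phi> (ray \<xi> x) - \<psi> (ray \<xi> x)) * ?A (ray \<xi> x)))"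
    by (subst A_coeff.simps(2)) (simp only: ray_integral_def ray_def)
  also have "\<dots> = borel_coeff (Suc n) \<xi>"
    unfolding A\<xi> sd I R using s by auto
  finally show ?case .
qed

lemma borel_sums:
  assumes "\<xi> \<in> \<Gamma>" "t \<in> ball 0 (2 * r)"
  shows "(\<lambda>n. A_coeff p \<phi> \<psi> s \<Gamma> (n + 1) \<xi> / fact n * t ^ n) sums borel t \<xi>"
proof -
  have "(\<lambda>t. borel t \<xi>) holomorphic_on ball 0 (2 * r)"
    by (rule holomorphic_on_subset[OF borel_holomorphic[OF assms(1)]]) (auto simp: U_region_def)
  from holomorphic_power_series[OF this assms(2)] show ?thesis
    using A_coeff_eq[OF assms(1)] by (simp add: borel_coeff_def)
qed

text \<open>In a chart \<open>W = e (1 + lap)\<close> with \<open>e' = - (u + \<phi>/2) e\<close>.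
  In \<open>W''\<close> the terms with \<open>lap'\<close> cancel and
  \<open>(u + \<phi>/2)^2 - \<phi>'/2 - g\<close> equals \<open>u^2 + u \<phi> + \<psi>\<close>;
  differentiating twice cancels the factor \<open>- s\<close>.\<close>

lemma solution:
  assumes u: "Re u > 0" and \<Phi>: "\<And>\<xi>. \<xi> \<in> \<Gamma> \<Longrightarrow> has_spread_deriv p \<Phi> (\<phi> \<xi>) \<xi>"
  defines "W \<equiv> \<lambda>\<xi>. exp (complex_of_real s * u * p \<xi> + complex_of_real s * (1/2) * \<Phi> \<xi>) * (1 + eta u \<xi>)"
  shows "solves_ode p \<phi> \<psi> \<Gamma> u W"
proof -
  have main: "(\<exists>E. has_spread_deriv p W E \<xi>) \<and> (\<exists>E. has_spread_deriv p (spread_deriv p W) E \<xi>) \<and>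
     spread_deriv p (spread_deriv p W) \<xi> = (u^2 + u * \<phi> \<xi> + \<psi> \<xi>) * W \<xi>" if \<xi>: "\<xi> \<in> \<Gamma>" for \<xi>
  proof -
    interpret S: wkb_strip "half_strip (q \<xi>) r" "data\<phi> \<xi>" "datag \<xi>" \<gamma> H \<kappa> "2 * d" M "2 * r"
      using strip[OF \<xi>] .
    let ?L = "lift \<xi>" and ?\<phi> = "data\<phi> \<xi>" and ?g = "datag \<xi>" and ?N = "nbhd \<xi>"
    have L: "chart (half_strip (q \<xi>) d) ?L" "?L (q \<xi>) = \<xi>" using lift[OF \<xi>] by auto
    have N: "z \<in> half_strip (q \<xi>) r" "z \<in> half_strip (q \<xi>) d" "?L z \<in> \<Gamma>" if "z \<in> ?N" for z
      using that sub by (auto simp: nbhd_def)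
    define e where "e = (\<lambda>z. exp (- u * z + complex_of_real s * (1/2) * \<Phi> (?L z)))"
    have W: "W (?L z) = e z * (1 + S.lap u z)" if z: "z \<in> ?N" for z
    proof -
      have "p (?L z) = - of_real s * z" using L(1) N(2)[OF z] by (simp add: p_q chart_def)
      then have "complex_of_real s * u * p (?L z) = - u * z" using s by auto
      then show ?thesis unfolding W_def e_def using eta_chart[OF \<xi> N(2)[OF z] N(3)[OF z]] by simp
    qed
    have e': "(e has_field_derivative e z * (- (u + (1/2) * ?\<phi> z))) (at z)" if z: "z \<in> ?N" for z
    proof -
      have "has_spread_deriv p \<Phi> (- of_real s * (- of_real s * ?\<phi> z)) (?L z)"
        using \<Phi>[OF N(3)[OF z]] s by auto
      then have "((\<lambda>z. \<Phi> (?L z)) has_field_derivative - of_real s * ?\<phi> z) (at z)"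
        unfolding has_spread_deriv_chart[OF L(1) N(2)[OF z]] .
      then have "(e has_field_derivative e z * (- u + of_real s * (1/2) * (- of_real s * ?\<phi> z))) (at z)"
        unfolding e_def by (auto intro!: derivative_eq_intros)
      moreover have "- u + of_real s * (1/2) * (- of_real s * ?\<phi> z) = - (u + (1/2) * ?\<phi> z)"
        using s by auto
      ultimately show ?thesis by (simp only:)
    qed
    define V1 where "V1 = (\<lambda>z. - (u + (1/2) * ?\<phi> z) * (1 + S.lap u z) + S.lap' u z)"
    have d1: "((\<lambda>z. W (?L z)) has_field_derivative e z * V1 z) (at z)" if z: "z \<in> ?N" for z
    proof -
      have "((\<lambda>z. e z * (1 + S.lap u z)) has_field_derivative
          e z * (- (u + (1/2) * ?\<phi> z)) * (1 + S.lap u z) + (0 + S.lap' u z) * e z) (at z)"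
        by (intro DERIV_mult DERIV_add DERIV_const e' z S.lap_derivatives(1) N(1) u)
      also have "e z * (- (u + (1/2) * ?\<phi> z)) * (1 + S.lap u z) + (0 + S.lap' u z) * e z = e z * V1 z"
        by (simp add: V1_def algebra_simps)
      finally show ?thesis
        by (rule has_field_derivative_transform_within_open[OF _ nbhd(1)[OF \<xi>] z]) (simp add: W)
    qed
    define V2 where "V2 = (\<lambda>z. - (u + (1/2) * ?\<phi> z) * V1 z + (- ((1/2) * deriv ?\<phi> z) * (1 + S.lap u z)
        - (u + (1/2) * ?\<phi> z) * S.lap' u z + ((2 * u + ?\<phi> z) * S.lap' u z - ?g z * (1 + S.lap u z))))"
    have d2: "((\<lambda>z. e z * V1 z) has_field_derivative e z * V2 z) (at z)" if z: "z \<in> ?N" for z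
    proof -
      have p: "(?\<phi> has_field_derivative deriv ?\<phi> z) (at z)"
        using \<phi>_chart(1)[OF L(1) N(2)[OF z]] .
      have "((\<lambda>z. - (u + (1/2) * ?\<phi> z)) has_field_derivative - (0 + (1/2) * deriv ?\<phi> z)) (at z)"
        by (intro DERIV_minus DERIV_add DERIV_const DERIV_cmult p)
      then have "(V1 has_field_derivative ((- (0 + (1/2) * deriv ?\<phi> z) * (1 + S.lap u z) + (0 + S.lap' u z) * (- (u + (1/2) * ?\<phi> z)))
          + ((2 * u + ?\<phi> z) * S.lap' u z - ?g z * (1 + S.lap u z)))) (at z)"
        unfolding V1_def by (intro DERIV_mult DERIV_add DERIV_const S.lap_derivatives N(1) u z)
      from DERIV_mult[OF e'[OF z] this] show ?thesis
        by (rule back_subst[of "\<lambda>x. (_ has_field_derivative x) _"]) (simp add: V2_def algebra_simps)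
    qed
    have sd: "spread_deriv p W (?L z) = - of_real s * (e z * V1 z)" if z: "z \<in> ?N" for z
      using spread_deriv_chart(1)[OF L(1) N(2)[OF z] d1[OF z]] .
    have dsd: "((\<lambda>z. spread_deriv p W (?L z)) has_field_derivative - of_real s * (e z * V2 z)) (at z)" if z: "z \<in> ?N" for z
      by (rule has_field_derivative_transform_within_open[OF DERIV_cmult[OF d2[OF z]] nbhd(1)[OF \<xi>] z]) (simp add: sd)
    let ?z = "q \<xi>"
    have z: "?z \<in> ?N" using nbhd(2)[OF \<xi>] .
    have "spread_deriv p (spread_deriv p W) \<xi> = - of_real s * (- of_real s * (e ?z * V2 ?z))"
      using spread_deriv_chart(1)[OF L(1) N(2)[OF z] dsd[OF z]] unfolding L(2) .
    also have "\<dots> = e ?z * V2 ?z" using s by auto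
    also have "\<dots> = (u^2 + u * \<phi> \<xi> + \<psi> \<xi>) * (e ?z * (1 + S.lap u ?z))"
    proof -
      have g: "?g ?z = (1/4) * (?\<phi> ?z)^2 - (1/2) * deriv ?\<phi> ?z - \<psi> (?L ?z)"
        using pot_chart[OF L(1) N(2)[OF z]] .
      have "V2 ?z = (u^2 + u * ?\<phi> ?z + \<psi> (?L ?z)) * (1 + S.lap u ?z)"
        unfolding V2_def V1_def g by (simp add: field_simps power2_eq_square)
      then show ?thesis unfolding L(2) by (simp add: mult_ac)
    qed
    also have "e ?z * (1 + S.lap u ?z) = W \<xi>" using W[OF z] unfolding L(2) by simp
    finally show ?thesis
      using spread_deriv_chart(2)[OF L(1) N(2)[OF z] d1[OF z]] spread_deriv_chart(2)[OF L(1) N(2)[OF z] dsd[OF z]]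
      unfolding L(2) by blast
  qed
  then show ?thesis by (auto simp: solves_ode_def spread_holomorphic_def)
qed

lemma borel_exp_bound:
  assumes \<sigma>: "\<sigma> > 0"
  obtains K where "K > 0" "\<And>t \<xi>. t \<in> U_region (2 * r) \<Longrightarrow> \<xi> \<in> \<Gamma> \<Longrightarrow> norm (borel t \<xi>)
      \<le> K * (exp (\<sigma> * Re t) / max 1 (- s * sgn (Re (p \<xi>)) * \<bar>Re (p \<xi>)\<bar> powr \<rho>))"
    "\<And>t \<xi>. t \<in> U_region (2 * r) \<Longrightarrow> \<xi> \<in> \<Gamma> \<Longrightarrow> norm (borel t \<xi>) \<le> K * exp (\<sigma> * Re t)"
proof -
  obtain K where K: "K > 0" "\<And>t \<xi>. t \<in> U_region (2 * r) \<Longrightarrow> \<xi> \<in> \<Gamma> \<Longrightarrow> norm (borel t \<xi>)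
      \<le> K * (exp (\<sigma> * Re t) / max 1 (- s * sgn (Re (p \<xi>)) * \<bar>Re (p \<xi>)\<bar> powr \<rho>))"
    using borel_bound[OF \<sigma>] by blast
  have "norm (borel t \<xi>) \<le> K * exp (\<sigma> * Re t)" if "t \<in> U_region (2 * r)" "\<xi> \<in> \<Gamma>" for t \<xi>
  proof -
    have "exp (\<sigma> * Re t) / max 1 (- s * sgn (Re (p \<xi>)) * \<bar>Re (p \<xi>)\<bar> powr \<rho>) \<le> exp (\<sigma> * Re t) / 1"
      by (intro divide_left_mono) auto
    then have "K * (exp (\<sigma> * Re t) / max 1 (- s * sgn (Re (p \<xi>)) * \<bar>Re (p \<xi>)\<bar> powr \<rho>)) \<le> K * (exp (\<sigma> * Re t) / 1)"
      using K(1) by (intro mult_left_mono) auto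
    then show ?thesis using K(2)[OF that] by simp
  qed
  with K that show ?thesis by blast
qed

lemma expansion:
  assumes \<sigma>: "\<sigma> > 0"
  shows "uniform_expansion {u. Re u > \<sigma>} \<Gamma> eta (A_coeff p \<phi> \<psi> s \<Gamma>)"
  unfolding uniform_expansion_def
proof (intro allI impI)
  fix N :: nat assume N: "N \<ge> 1"
  \<comment> \<open>Half the rate keeps \<open>Re u - \<sigma> / 2\<close> above
    \<open>\<sigma> / 2\<close> on the whole half-plane.\<close>
  obtain K where K: "K > 0" "\<And>t \<xi>. t \<in> U_region (2 * r) \<Longrightarrow> \<xi> \<in> \<Gamma> \<Longrightarrow> norm (borel t \<xi>) \<le> K * exp (\<sigma> / 2 * Re t)"
    using borel_exp_bound[of "\<sigma> / 2"] \<sigma> by (metis half_gt_zero)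
  define C1 where "C1 = fact N * K * exp (\<sigma> / 2 * r) / r ^ N / (\<sigma> / 2)"
  \<comment> \<open>\<open>Re u\<close> need not grow with \<open>norm u\<close>, so
    \<open>watson\<close> gives the order \<open>N\<close> only with \<open>N\<close> terms
    retained; the last of them is moved into the error, and \<open>C2\<close> is its Cauchy
    bound.\<close>
  define C2 where "C2 = fact (N - 1) * (K * exp (\<sigma> / 2 * r)) / r ^ (N - 1)"
  have "norm (eta u \<xi> - (\<Sum>n = 1..N - 1. A_coeff p \<phi> \<psi> s \<Gamma> n \<xi> / u ^ n)) \<le> (C1 + C2) / norm u ^ N"
    if u: "Re u > \<sigma>" and \<xi>: "\<xi> \<in> \<Gamma>" for u \<xi>
  proof -
    have u0: "u \<noteq> 0" using u \<sigma> by auto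
    have W: "norm (eta u \<xi> - (\<Sum>n<N. borel_coeff n \<xi> / u ^ (n + 1)))
       \<le> fact N * K * exp (\<sigma> / 2 * r) / r ^ N / (Re u - \<sigma> / 2) / norm u ^ N"
      unfolding eta_def borel_coeff_def
      by (rule watson[OF open_U_region borel_holomorphic[OF \<xi>] r(1) U_region_cball])
        (use K \<xi> u \<sigma> r in auto)
    also have "\<dots> \<le> C1 / norm u ^ N"
      unfolding C1_def using u \<sigma> K r
      by (intro divide_right_mono divide_left_mono) auto
    finally have W': "norm (eta u \<xi> - (\<Sum>n<N. borel_coeff n \<xi> / u ^ (n + 1))) \<le> C1 / norm u ^ N" .
    have c: "norm (borel_coeff (N - 1) \<xi>) \<le> C2"
      unfolding borel_coeff_def C2_def
    proof (rule Cauchy_inequality)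
      have sub': "cball 0 r \<subseteq> U_region (2 * r)" using U_region_cball[of 0] by simp
      show "(\<lambda>t. borel t \<xi>) holomorphic_on ball 0 r" "continuous_on (cball 0 r) (\<lambda>t. borel t \<xi>)"
        using holomorphic_on_subset[OF borel_holomorphic[OF \<xi>] sub'] ball_subset_cball[of 0 r]
        by (auto intro: holomorphic_on_imp_continuous_on holomorphic_on_subset)
      fix t :: complex assume t: "norm (0 - t) = r"
      then have "t \<in> U_region (2 * r)" using sub' by auto
      then have "norm (borel t \<xi>) \<le> K * exp (\<sigma> / 2 * Re t)" using K \<xi> by blast
      also have "\<dots> \<le> K * exp (\<sigma> / 2 * r)"
        using complex_Re_le_cmod[of t] t K(1) \<sigma> by simp
      finally show "norm (borel t \<xi>) \<le> K * exp (\<sigma> / 2 * r)" .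
    qed (use r in auto)
    have "(\<Sum>n<N. borel_coeff n \<xi> / u ^ (n + 1)) = (\<Sum>n<N. A_coeff p \<phi> \<psi> s \<Gamma> (Suc n) \<xi> / u ^ Suc n)"
      by (simp only: A_coeff_eq[OF \<xi>] Suc_eq_plus1[symmetric])
    also have "\<dots> = (\<Sum>n = 1..N. A_coeff p \<phi> \<psi> s \<Gamma> n \<xi> / u ^ n)"
      by (rule sum.reindex_bij_witness[of _ "\<lambda>n. n - 1" Suc]) auto
    also have "\<dots> = (\<Sum>n = 1..N - 1. A_coeff p \<phi> \<psi> s \<Gamma> n \<xi> / u ^ n) + borel_coeff (N - 1) \<xi> / u ^ N"
      using N A_coeff_eq[OF \<xi>, of "N - 1"] by (cases N) auto
    finally have "eta u \<xi> - (\<Sum>n = 1..N - 1. A_coeff p \<phi> \<psi> s \<Gamma> n \<xi> / u ^ n)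
        = (eta u \<xi> - (\<Sum>n<N. borel_coeff n \<xi> / u ^ (n + 1))) + borel_coeff (N - 1) \<xi> / u ^ N" by simp
    also have "norm \<dots> \<le> C1 / norm u ^ N + C2 / norm u ^ N"
      using W' c by (intro norm_triangle_mono) (auto simp: norm_divide norm_power divide_right_mono)
    finally show ?thesis by (simp add: add_divide_distrib)
  qed
  then show "\<exists>C R. \<forall>u\<in>{u. \<sigma> < Re u}. R \<le> norm u \<longrightarrow>
      (\<forall>\<xi>\<in>\<Gamma>. norm (eta u \<xi> - (\<Sum>n = 1..N - 1. A_coeff p \<phi> \<psi> s \<Gamma> n \<xi> / u ^ n)) \<le> C / norm u ^ N)"
    by blast
qed

text \<open>The decay of the Borel transform in \<xi> does not involve \<open>t\<close>, so it
  factors out of the Laplace integral.\<close>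

lemma eta_limit:
  assumes u: "Re u > 0"
  shows "(eta u \<longlongrightarrow> 0) (inf (filtercomap (\<lambda>\<xi>. - s * Re (p \<xi>)) at_top) (principal \<Gamma>))"
proof -
  let ?F = "inf (filtercomap (\<lambda>\<xi>. - s * Re (p \<xi>)) at_top) (principal \<Gamma>)"
  define \<sigma> where "\<sigma> = Re u / 2"
  have \<sigma>: "\<sigma> > 0" "Re u > \<sigma>" using u by (auto simp: \<sigma>_def)
  obtain K where K: "K > 0" "\<And>t \<xi>. t \<in> U_region (2 * r) \<Longrightarrow> \<xi> \<in> \<Gamma> \<Longrightarrow> norm (borel t \<xi>)
      \<le> K * (exp (\<sigma> * Re t) / max 1 (- s * sgn (Re (p \<xi>)) * \<bar>Re (p \<xi>)\<bar> powr \<rho>))"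
    using borel_exp_bound[OF \<sigma>(1)] by metis
  have bnd: "norm (eta u \<xi>) \<le> K / (Re u - \<sigma>) * (- s * Re (p \<xi>)) powr (- \<rho>)"
    if \<xi>: "\<xi> \<in> \<Gamma>" and X: "- s * Re (p \<xi>) > 0" for \<xi>
  proof -
    let ?X = "- s * Re (p \<xi>)"
    have m: "- s * sgn (Re (p \<xi>)) * \<bar>Re (p \<xi>)\<bar> powr \<rho> = ?X powr \<rho>"
      using X s by auto
    have "norm (eta u \<xi>) \<le> (K / max 1 (?X powr \<rho>)) / (Re u - \<sigma>)"
      unfolding eta_def
    proof (rule laplace_bounds(2)[OF _ _ \<sigma>(2)])
      show "continuous_on {0..} (\<lambda>t. borel (of_real t) \<xi>)"
        by (rule continuous_on_compose2[OF holomorphic_on_imp_continuous_on[OF borel_holomorphic[OF \<xi>]]])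
          (use U_region_real[of "2 * r"] r in \<open>auto intro!: continuous_intros\<close>)
      show "norm (borel (of_real t) \<xi>) \<le> K / max 1 (?X powr \<rho>) * exp (\<sigma> * t)" if "t \<ge> 0" for t
        using K(2)[OF U_region_real[of "2 * r" t] \<xi>] that r unfolding m by simp
    qed
    also have "\<dots> \<le> (K / (?X powr \<rho>)) / (Re u - \<sigma>)"
      using K(1) \<sigma> X by (intro divide_right_mono divide_left_mono mult_pos_pos) auto
    also have "\<dots> = K / (Re u - \<sigma>) * ?X powr (- \<rho>)"
      by (simp add: powr_minus divide_simps)
    finally show ?thesis .
  qed
  have FX: "filterlim (\<lambda>\<xi>. - s * Re (p \<xi>)) at_top ?F"
    by (rule filterlim_mono[OF filterlim_filtercomap order_refl inf_le1])
  have "((\<lambda>X. K / (Re u - \<sigma>) * X powr (- \<rho>)) \<longlongrightarrow> 0) at_top"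
  proof (rule tendsto_mult_right_zero)
    show "((\<lambda>X::real. X powr (- \<rho>)) \<longlongrightarrow> 0) at_top" using \<rho>_pos by real_asymp
  qed
  from filterlim_compose[OF this FX] show ?thesis
  proof (rule Lim_null_comparison[rotated])
    have "\<forall>\<^sub>F \<xi> in ?F. - s * Re (p \<xi>) > 0"
      using FX unfolding filterlim_at_top_dense by blast
    moreover have "\<forall>\<^sub>F \<xi> in ?F. \<xi> \<in> \<Gamma>"
      by (simp add: eventually_inf_principal)
    ultimately show "\<forall>\<^sub>F \<xi> in ?F. norm (eta u \<xi>) \<le> K / (Re u - \<sigma>) * (- s * Re (p \<xi>)) powr (- \<rho>)"
      by eventually_elim (rule bnd)
  qed
qed

end

text \<open>On the sector \<open>cos (Arg u)\<close> is at least its minimum \<open>k > 0\<close>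
  over the two boundary angles, so \<open>Re u > 1\<close> as soon as
  \<open>norm u \<ge> 2 / k\<close>.\<close>

lemma uniform_expansion_sector:
  assumes "uniform_expansion {u. Re u > 1} S f a" "- pi / 2 < \<theta>\<^sub>1" "\<theta>\<^sub>1 \<le> \<theta>\<^sub>2" "\<theta>\<^sub>2 < pi / 2"
  shows "uniform_expansion {u. u \<noteq> 0 \<and> \<theta>\<^sub>1 \<le> Arg u \<and> Arg u \<le> \<theta>\<^sub>2} S f a"
  unfolding uniform_expansion_def
proof (intro allI impI)
  fix N :: nat assume "N \<ge> 1"
  then obtain C R where CR: "\<And>u \<xi>. Re u > 1 \<Longrightarrow> norm u \<ge> R \<Longrightarrow> \<xi> \<in> S \<Longrightarrow>
      norm (f u \<xi> - (\<Sum>n = 1..N - 1. a n \<xi> / u ^ n)) \<le> C / norm u ^ N"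
    using assms(1) unfolding uniform_expansion_def by blast
  define k where "k = min (cos \<theta>\<^sub>1) (cos \<theta>\<^sub>2)"
  have k: "k > 0" using assms by (auto simp: k_def intro!: cos_gt_zero_pi)
  have "Re u > 1" if u: "u \<noteq> 0" "\<theta>\<^sub>1 \<le> Arg u" "Arg u \<le> \<theta>\<^sub>2" "norm u \<ge> 2 / k" for u
  proof -
    have "k \<le> cos (Arg u)"
    proof (cases "Arg u \<ge> 0")
      case True
      then have "cos \<theta>\<^sub>2 \<le> cos (Arg u)" using u assms by (intro cos_monotone_0_pi_le) auto
      then show ?thesis by (simp add: k_def)
    next
      case False
      then have "cos (- \<theta>\<^sub>1) \<le> cos (- Arg u)" using u assms by (intro cos_monotone_0_pi_le) auto
      then show ?thesis by (simp add: k_def)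
    qed
    then have "norm u * k \<le> norm u * cos (Arg u)" by (intro mult_left_mono) auto
    also have "\<dots> = Re u" using u(1) by (simp add: cos_Arg)
    finally have "norm u * k \<le> Re u" .
    moreover have "2 \<le> norm u * k" using u(4) k by (simp add: field_simps)
    ultimately show ?thesis by linarith
  qed
  then show "\<exists>C R. \<forall>u\<in>{u. u \<noteq> 0 \<and> \<theta>\<^sub>1 \<le> Arg u \<and> Arg u \<le> \<theta>\<^sub>2}. R \<le> norm u \<longrightarrow>
      (\<forall>\<xi>\<in>S. norm (f u \<xi> - (\<Sum>n = 1..N - 1. a n \<xi> / u ^ n)) \<le> C / norm u ^ N)"
    using CR by (intro exI[of _ C] exI[of _ "max R (2 / k)"]) auto
qed

theorem theorem1p1:
  fixes p :: "'a::t2_space \<Rightarrow> complex"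
    and G \<Delta> \<Gamma> :: "'a set"
    and \<phi> \<psi> \<Phi> :: "'a \<Rightarrow> complex"
    and \<alpha> :: "'a option"
    and s d c \<rho> :: real
  assumes "s = 1 \<or> s = -1"
    and "spread_domain p G"
    and "spread_holomorphic p \<phi> G" and "spread_holomorphic p \<psi> G"
    and "domain_in G \<Delta>"
    and "C1 p \<phi> \<psi> \<Delta> c \<rho> \<or> C2 p \<phi> \<psi> \<Delta> c \<rho>"
    and "d > 0"
    and "Gamma_domain p s \<Delta> d \<Gamma>"
    and "integral_branch p G \<phi> \<alpha> \<Gamma> \<Phi>"
  shows "\<exists>(W :: complex \<Rightarrow> 'a \<Rightarrow> complex) (\<eta> :: complex \<Rightarrow> 'a \<Rightarrow> complex) (F :: complex \<Rightarrow> 'a \<Rightarrow> complex).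
      (\<forall>u. Re u > 0 \<longrightarrow> solves_ode p \<phi> \<psi> \<Gamma> u (W u))
    \<and> (\<forall>u \<xi>. Re u > 0 \<and> \<xi> \<in> \<Gamma> \<longrightarrow>
         W u \<xi> = exp (complex_of_real s * u * p \<xi> + complex_of_real s * (1/2) * \<Phi> \<xi>) * (1 + \<eta> u \<xi>))
    \<and> jointly_analytic p \<eta> {u. Re u > 0} \<Gamma>
    \<and> (\<forall>u. Re u > 0 \<longrightarrow>
         (\<eta> u \<longlongrightarrow> 0) (inf (filtercomap (\<lambda>\<xi>. - s * Re (p \<xi>)) at_top) (principal \<Gamma>)))
    \<and> (\<forall>u \<xi>. Re u > 0 \<and> \<xi> \<in> \<Gamma> \<longrightarrow>
         ((\<lambda>t. exp (- u * complex_of_real t) * F (complex_of_real t) \<xi>) has_integral \<eta> u \<xi>) {0..})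
    \<and> jointly_analytic p F (U_region (2 * d)) \<Gamma>
    \<and> (\<forall>t\<in>ball 0 (2 * d). \<forall>\<xi>\<in>\<Gamma>.
         (\<lambda>n. A_coeff p \<phi> \<psi> s \<Gamma> (n + 1) \<xi> / fact n * t ^ n) sums F t \<xi>)
    \<and> (\<forall>\<sigma> r. \<sigma> > 0 \<and> 0 < r \<and> r < d \<longrightarrow> (\<exists>K>0. \<forall>t\<in>U_region (2 * r). \<forall>\<xi>\<in>\<Gamma>.
         norm (F t \<xi>) \<le> K * (exp (\<sigma> * Re t)
           / max 1 (- s * sgn (Re (p \<xi>)) * \<bar>Re (p \<xi>)\<bar> powr \<rho>))))
    \<and> (\<forall>\<sigma>>0. uniform_expansion {u. Re u > \<sigma>} \<Gamma> \<eta> (A_coeff p \<phi> \<psi> s \<Gamma>))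
    \<and> (\<forall>\<theta>\<^sub>1 \<theta>\<^sub>2. - pi/2 < \<theta>\<^sub>1 \<and> \<theta>\<^sub>1 \<le> \<theta>\<^sub>2 \<and> \<theta>\<^sub>2 < pi/2 \<longrightarrow>
         uniform_expansion {u. u \<noteq> 0 \<and> \<theta>\<^sub>1 \<le> Arg u \<and> Arg u \<le> \<theta>\<^sub>2} \<Gamma> \<eta> (A_coeff p \<phi> \<psi> s \<Gamma>))"
proof -
  interpret wkb_data p G \<Delta> \<Gamma> s d \<phi> \<psi> c \<rho>
    by unfold_locales (use assms in auto)
  have ex: "\<exists>\<gamma> H \<kappa> M K0. wkb_strips p G \<Delta> \<Gamma> s d \<phi> \<psi> c \<rho> r \<gamma> H \<kappa> M K0" if r: "0 < r" "r < d" for r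
  proof -
    obtain \<gamma> H \<kappa> M K0 where "strip_constants r \<gamma> H \<kappa> M" "K0 > 0"
      "\<And>x. H (x - d) \<le> K0 / max 1 (sgn x * \<bar>x\<bar> powr \<rho>)"
      using strip_constants_exist[OF r] by blast
    then have "wkb_strips p G \<Delta> \<Gamma> s d \<phi> \<psi> c \<rho> r \<gamma> H \<kappa> M K0"
      by unfold_locales (use r in auto)
    then show ?thesis by blast
  qed
  \<comment> \<open>For the claims in which no radius occurs, any value below \<open>d\<close>
    serves.\<close>
  have d2: "0 < d / 2" "d / 2 < d" using d by auto
  obtain \<gamma> H \<kappa> M K0 where "wkb_strips p G \<Delta> \<Gamma> s d \<phi> \<psi> c \<rho> (d / 2) \<gamma> H \<kappa> M K0"
    using ex[OF d2] by blast
  then interpret S: wkb_strips p G \<Delta> \<Gamma> s d \<phi> \<psi> c \<rho> "d / 2" \<gamma> H \<kappa> M K0 .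
  have \<Phi>: "has_spread_deriv p \<Phi> (\<phi> \<xi>) \<xi>" if "\<xi> \<in> \<Gamma>" for \<xi>
    using assms(9) that by (auto simp: integral_branch_def)
  define W where "W = (\<lambda>u \<xi>. exp (complex_of_real s * u * p \<xi> + complex_of_real s * (1/2) * \<Phi> \<xi>) * (1 + eta u \<xi>))"
  show ?thesis
  proof (rule exI[of _ W], rule exI[of _ eta], rule exI[of _ borel], intro conjI allI impI)
    fix u assume "Re u > 0"
    then show "solves_ode p \<phi> \<psi> \<Gamma> u (W u)"
      unfolding W_def using S.solution \<Phi> by blast
  next
    fix u \<xi> assume "Re u > 0 \<and> \<xi> \<in> \<Gamma>"
    show "W u \<xi> = exp (complex_of_real s * u * p \<xi> + complex_of_real s * (1/2) * \<Phi> \<xi>) * (1 + eta u \<xi>)"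
      by (simp add: W_def)
  next
    show "jointly_analytic p eta {u. Re u > 0} \<Gamma>"
      by (rule jointly_analytic_chart) (use S.joint_chart_eta in auto)
  next
    fix u assume "Re u > 0"
    then show "(eta u \<longlongrightarrow> 0) (inf (filtercomap (\<lambda>\<xi>. - s * Re (p \<xi>)) at_top) (principal \<Gamma>))"
      by (rule S.eta_limit)
  next
    fix u \<xi> assume "Re u > 0 \<and> \<xi> \<in> \<Gamma>"
    then show "((\<lambda>t. exp (- u * complex_of_real t) * borel (complex_of_real t) \<xi>) has_integral eta u \<xi>) {0..}"
      using S.eta_has_integral by blast
  next
    show "jointly_analytic p borel (U_region (2 * d)) \<Gamma>"
    proof (rule jointly_analytic_chart)
      fix t \<xi> assume t: "t \<in> U_region (2 * d)" and \<xi>: "\<xi> \<in> \<Gamma>"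
      \<comment> \<open>\<open>U(2d)\<close> is exhausted by smaller regions; the radius is adapted
        to the point \<open>t\<close>, while \<open>borel\<close> remains the same function.\<close>
      have "t \<in> half_strip 0 (2 * d)" using t by (simp add: half_strip_def)
      then obtain r' where r': "0 < r'" "r' < 2 * d" "t \<in> half_strip 0 r'"
        using half_strip_shrink[of "2 * d" t 0] d by auto
      then obtain \<gamma> H \<kappa> M K0 where "wkb_strips p G \<Delta> \<Gamma> s d \<phi> \<psi> c \<rho> (r' / 2) \<gamma> H \<kappa> M K0"
        using ex[of "r' / 2"] by auto
      then interpret T: wkb_strips p G \<Delta> \<Gamma> s d \<phi> \<psi> c \<rho> "r' / 2" \<gamma> H \<kappa> M K0 .
      show "\<exists>f S. hol2 f S \<and> open S \<and> (t, q \<xi>) \<in> S \<and>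
        (\<forall>(t', z)\<in>S. z \<in> half_strip (q \<xi>) d \<longrightarrow> lift \<xi> z \<in> \<Gamma> \<longrightarrow> borel t' (lift \<xi> z) = f (t', z))"
        using T.joint_chart[OF _ \<xi>, of t] r'(3) by (simp add: half_strip_def)
    qed
  next
    show "\<forall>t\<in>ball 0 (2 * d). \<forall>\<xi>\<in>\<Gamma>. (\<lambda>n. A_coeff p \<phi> \<psi> s \<Gamma> (n + 1) \<xi> / fact n * t ^ n) sums borel t \<xi>"
    proof (intro ballI)
      fix t :: complex and \<xi> assume t: "t \<in> ball 0 (2 * d)" and \<xi>: "\<xi> \<in> \<Gamma>"
      then obtain r' where r': "norm t < r'" "r' < 2 * d" using dense[of "norm t" "2 * d"] by auto
      then have "0 < r'" using norm_ge_zero[of t] by linarith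
      then obtain \<gamma> H \<kappa> M K0 where "wkb_strips p G \<Delta> \<Gamma> s d \<phi> \<psi> c \<rho> (r' / 2) \<gamma> H \<kappa> M K0"
        using ex[of "r' / 2"] r' by auto
      then interpret T: wkb_strips p G \<Delta> \<Gamma> s d \<phi> \<psi> c \<rho> "r' / 2" \<gamma> H \<kappa> M K0 .
      show "(\<lambda>n. A_coeff p \<phi> \<psi> s \<Gamma> (n + 1) \<xi> / fact n * t ^ n) sums borel t \<xi>"
        using T.borel_sums[OF \<xi>, of t] r' by simp
    qed
  next
    fix \<sigma> r :: real assume \<sigma>r: "\<sigma> > 0 \<and> 0 < r \<and> r < d"
    then obtain \<gamma> H \<kappa> M K0 where "wkb_strips p G \<Delta> \<Gamma> s d \<phi> \<psi> c \<rho> r \<gamma> H \<kappa> M K0"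
      using ex[of r] by auto
    then interpret T: wkb_strips p G \<Delta> \<Gamma> s d \<phi> \<psi> c \<rho> r \<gamma> H \<kappa> M K0 .
    show "\<exists>K>0. \<forall>t\<in>U_region (2 * r). \<forall>\<xi>\<in>\<Gamma>. norm (borel t \<xi>)
        \<le> K * (exp (\<sigma> * Re t) / max 1 (- s * sgn (Re (p \<xi>)) * \<bar>Re (p \<xi>)\<bar> powr \<rho>))"
      using T.borel_bound \<sigma>r by blast
  next
    fix \<sigma> :: real assume "\<sigma> > 0"
    then show "uniform_expansion {u. Re u > \<sigma>} \<Gamma> eta (A_coeff p \<phi> \<psi> s \<Gamma>)"
      by (rule S.expansion)
  next
    fix \<theta>\<^sub>1 \<theta>\<^sub>2 :: real assume "- pi / 2 < \<theta>\<^sub>1 \<and> \<theta>\<^sub>1 \<le> \<theta>\<^sub>2 \<and> \<theta>\<^sub>2 < pi / 2"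
    then show "uniform_expansion {u. u \<noteq> 0 \<and> \<theta>\<^sub>1 \<le> Arg u \<and> Arg u \<le> \<theta>\<^sub>2} \<Gamma> eta (A_coeff p \<phi> \<psi> s \<Gamma>)"
      using uniform_expansion_sector[OF S.expansion[of 1]] by simp
  qed
qed

end
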